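(* Let $d$ be a positive integer, let $\mathcal M$ be a complex separable Hilbert space and let $F$ be a $\mathcal B(\mathcal M)$-valued semispectral measure on $\partial\mathbb B^d$. Assume that for each $k=1,\ldots,d$, the coordinate function $z_k$ is a multiplier for the Dirichlet-type space $\mathscr D(F)$. Then the $d$-tuple $\mathscr M_z=(\mathscr M_{z_1},\ldots,\mathscr M_{z_d})$ of multiplication operators $\mathscr M_{z_k}f=z_kf$ on $\mathscr D(F)$ is a joint $2$-isometry.
   Context: $\mathbb B^d$ is the open Euclidean unit ball of $\mathbb C^d$, $\partial\mathbb B^d$ the unit sphere, $V$ the normalized volume measure on $\mathbb B^d$ ($V(\mathbb B^d)=1$). A $\mathcal B(\mathcal M)$-valued semispectral measure $F$ on $\partial\mathbb B^d$ is a finitely additive set function on the Borel sets of $\partial\mathbb B^d$ with values positive operators in $\mathcal B(\mathcal M)$ such that $\langle F(\cdot)x,y\rangle$ is a complex regular Borel measure for all $x,y\in\mathcal M$. Poisson kernel: $P(z,\zeta)=\frac{1-\|z\|^2}{\|z-\zeta\|^{2d}}$, $z\in\mathbb B^d$, $\zeta\in\partial\mathbb B^d$. Poisson integral: $P[F](z)=\int_{\partial\mathbb B^d}P(z,\zeta)\,dF(\zeta)\in\mathcal B(\mathcal M)$, i.e. $\langle P[F](z)x,y\rangle=\int P(z,\zeta)\,d\langle F(\zeta)x,y\rangle$. $H^2_{\mathcal M}(\mathbb B^d)$ is the Hardy space of $\mathcal M$-valued holomorphic functions $f(z)=\sum_{\alpha\in\mathbb Z_+^d}a_\alpha z^\alpha$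 on $\mathbb B^d$ with $\|f\|^2_{H^2_{\mathcal M}(\mathbb B^d)}=\sum_\alpha\|a_\alpha\|^2_{\mathcal M}\|z^\alpha\|^2_{H^2(\mathbb B^d)}<\infty$, where $\|z^\alpha\|^2_{H^2(\mathbb B^d)}=\frac{\alpha!\,(d-1)!}{(|\alpha|+d-1)!}$. The Dirichlet-type space $\mathscr D(F)$ is the (Hilbert) space of holomorphic $f:\mathbb B^d\to\mathcal M$ with $$\|f\|^2_{\mathscr D(F)}:=\|f\|^2_{H^2_{\mathcal M}(\mathbb B^d)}+\frac1d\int_{\mathbb B^d}\sum_{j=1}^d\Big\langle P[F](z)\frac{\partial f}{\partial z_j}(z),\frac{\partial f}{\partial z_j}(z)\Big\rangle_{\mathcal M}dV(z)<\infty.$$ $z_k$ is a multiplier for $\mathscr D(F)$ if $z_kf\in\mathscr D(F)$ for all $f\in\mathscr D(F)$ (then $\mathscr M_{z_k}$ is bounded on $\mathscr D(F)$). A commuting $d$-tuple $T=(T_1,\ldots,T_d)$ of bounded operators on a Hilbert space is a joint $m$-isometry if $\sum_{n=0}^m(-1)^n\binom mn Q_T^n(I)=0$, where $Q_T(X)=\sum_{j=1}^dT_j^*XT_j$, $Q_T^0(X)=X$, $Q_T^n(X)=Q_T(Q_T^{n-1}(X))$. *)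

theory Defs
  imports "HOL-Analysis.Analysis" "HOL-Library.Function_Algebras"
begin

section \<open>Complex Hilbert spaces and operators\<close>

text \<open>Inner products are linear in the first and conjugate-linear in the second argument.
  Completeness comes from \<^class>\<open>banach\<close>.\<close>

class scaleC =
  fixes scaleC :: "complex \<Rightarrow> 'a \<Rightarrow> 'a"  (infixr \<open>*\<^sub>C\<close> 75)

class complex_hilbert = banach + scaleC +
  fixes cinner :: "'a \<Rightarrow> 'a \<Rightarrow> complex"
  assumes scaleR_scaleC: "scaleR r x = complex_of_real r *\<^sub>C x"
    and scaleC_add_right: "c *\<^sub>C (x + y) = c *\<^sub>C x + c *\<^sub>C y"
    and scaleC_add_left: "(b + c) *\<^sub>C x = b *\<^sub>C x + c *\<^sub>C x"
    and scaleC_scaleC: "b *\<^sub>C c *\<^sub>C x = (b * c) *\<^sub>C x"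
    and cinner_add_left: "cinner (x + y) z = cinner x z + cinner y z"
    and cinner_scaleC_left: "cinner (c *\<^sub>C x) y = c * cinner x y"
    and cinner_commute: "cinner x y = cnj (cinner y x)"
    and cinner_self: "cinner x x = complex_of_real ((norm x)\<^sup>2)"

instantiation complex :: complex_hilbert
begin

definition scaleC_complex :: "complex \<Rightarrow> complex \<Rightarrow> complex"
  where "scaleC_complex = (*)"

definition cinner_complex :: "complex \<Rightarrow> complex \<Rightarrow> complex"
  where "cinner_complex x y = x * cnj y"

instance
  by standard
    (simp_all add: scaleC_complex_def cinner_complex_def scaleR_conv_of_real algebra_simps
      flip: complex_norm_square)

end

definition bounded_clinear :: "('m::complex_hilbert \<Rightarrow> 'm) \<Rightarrow> bool" where
  "bounded_clinear T \<longleftrightarrow> bounded_linear T \<and> (\<forall>c x. T (c *\<^sub>C x) = c *\<^sub>C T x)"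

definition positive_operator :: "('m::complex_hilbert \<Rightarrow> 'm) \<Rightarrow> bool" where
  "positive_operator T \<longleftrightarrow> bounded_clinear T \<and> (\<forall>x. cinner (T x) x \<in> \<real>\<^sub>\<ge>\<^sub>0)"


section \<open>Complex measures, semispectral measures and the Poisson integral\<close>

text \<open>The first argument, a \<^typ>\<open>'a measure\<close>, only supplies the underlying space and sigma-algebra.\<close>

definition complex_measure :: "'a measure \<Rightarrow> ('a set \<Rightarrow> complex) \<Rightarrow> bool" where
  "complex_measure N \<mu> \<longleftrightarrow>
     (\<forall>A :: nat \<Rightarrow> 'a set. range A \<subseteq> sets N \<longrightarrow> disjoint_family A \<longrightarrow>
        (\<lambda>n. \<mu> (A n)) sums \<mu> (\<Union>n. A n))"

definition regular_set_function ::
    "'a::topological_space measure \<Rightarrow> ('a set \<Rightarrow> complex) \<Rightarrow> bool" where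
  "regular_set_function N \<mu> \<longleftrightarrow>
     (\<forall>E\<in>sets N. \<forall>\<epsilon>>0. \<exists>K U. compact K \<and> open U \<and> K \<subseteq> E \<and> E \<subseteq> U \<and>
        (\<forall>A\<in>sets N. A \<subseteq> U - K \<longrightarrow> norm (\<mu> A) < \<epsilon>))"

text \<open>The positive part of the Jordan decomposition of a finite signed measure \<open>\<nu>\<close>:
  \<open>\<nu>\<^sup>+(A) = sup {\<nu>(B) | B \<subseteq> A}\<close>. Negative values are clipped by \<^const>\<open>ennreal\<close>,
  which does not change the supremum since \<open>\<nu>({}) = 0\<close>.\<close>

definition positive_variation :: "'a measure \<Rightarrow> ('a set \<Rightarrow> real) \<Rightarrow> 'a measure" where
  "positive_variation N \<nu> =
     measure_of (space N) (sets N) (\<lambda>A. SUP B\<in>{B \<in> sets N. B \<subseteq> A}. ennreal (\<nu> B))"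

definition signed_integral :: "'a measure \<Rightarrow> ('a set \<Rightarrow> real) \<Rightarrow> ('a \<Rightarrow> complex) \<Rightarrow> complex" where
  "signed_integral N \<nu> f =
     (LINT x|positive_variation N \<nu>. f x) - (LINT x|positive_variation N (\<lambda>A. - \<nu> A). f x)"

definition complex_measure_integral ::
    "'a measure \<Rightarrow> ('a set \<Rightarrow> complex) \<Rightarrow> ('a \<Rightarrow> complex) \<Rightarrow> complex" where
  "complex_measure_integral N \<mu> f =
     signed_integral N (\<lambda>A. Re (\<mu> A)) f + \<i> * signed_integral N (\<lambda>A. Im (\<mu> A)) f"

definition sphere_borel :: "(complex ^ 'd) measure" where
  "sphere_borel = restrict_space borel (sphere 0 1)"

definition semispectral_measure ::
    "((complex ^ 'd) set \<Rightarrow> 'm::complex_hilbert \<Rightarrow> 'm) \<Rightarrow> bool" where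
  "semispectral_measure F \<longleftrightarrow>
     (\<forall>A\<in>sets sphere_borel. positive_operator (F A)) \<and>
     (\<forall>A\<in>sets sphere_borel. \<forall>B\<in>sets sphere_borel. A \<inter> B = {} \<longrightarrow>
        (\<forall>x. F (A \<union> B) x = F A x + F B x)) \<and>
     (\<forall>x y. complex_measure sphere_borel (\<lambda>A. cinner (F A x) y) \<and>
            regular_set_function sphere_borel (\<lambda>A. cinner (F A x) y))"

definition poisson_kernel :: "complex ^ 'd \<Rightarrow> complex ^ 'd \<Rightarrow> real" where
  "poisson_kernel z \<zeta> = (1 - (norm z)\<^sup>2) / norm (z - \<zeta>) ^ (2 * CARD('d))"

definition poisson_integral ::
    "((complex ^ 'd) set \<Rightarrow> 'm::complex_hilbert \<Rightarrow> 'm) \<Rightarrow> complex ^ 'd \<Rightarrow> 'm \<Rightarrow> 'm" where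
  "poisson_integral F z =
     (THE T. bounded_clinear T \<and>
        (\<forall>x y. cinner (T x) y =
           complex_measure_integral sphere_borel (\<lambda>A. cinner (F A x) y)
             (\<lambda>\<zeta>. complex_of_real (poisson_kernel z \<zeta>))))"


section \<open>Holomorphic functions, the Hardy space and the Dirichlet-type space\<close>

definition cholomorphic_on ::
    "(complex ^ 'd \<Rightarrow> 'm::complex_hilbert) \<Rightarrow> (complex ^ 'd) set \<Rightarrow> bool" where
  "cholomorphic_on f S \<longleftrightarrow>
     (\<forall>z\<in>S. \<exists>D. (f has_derivative D) (at z) \<and> (\<forall>c v. D (c *s v) = c *\<^sub>C D v))"

text \<open>For a complex differentiable function the (real) Frechet derivative in direction
  \<open>e\<^sub>j\<close> is the complex partial derivative with respect to \<open>z\<^sub>j\<close>.\<close>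

definition cpartial :: "'d \<Rightarrow> (complex ^ 'd \<Rightarrow> 'm::complex_hilbert) \<Rightarrow> complex ^ 'd \<Rightarrow> 'm" where
  "cpartial j f z = frechet_derivative f (at z) (axis j 1)"

definition power_series_on_ball ::
    "(complex ^ 'd \<Rightarrow> 'm::complex_hilbert) \<Rightarrow> (('d \<Rightarrow> nat) \<Rightarrow> 'm) \<Rightarrow> bool" where
  "power_series_on_ball f a \<longleftrightarrow>
     (\<forall>z\<in>ball 0 1. ((\<lambda>\<alpha>. (\<Prod>j\<in>UNIV. (z $ j) ^ \<alpha> j) *\<^sub>C a \<alpha>) has_sum f z) UNIV)"

definition taylor_coeff :: "(complex ^ 'd \<Rightarrow> 'm::complex_hilbert) \<Rightarrow> ('d \<Rightarrow> nat) \<Rightarrow> 'm" where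
  "taylor_coeff f = (THE a. power_series_on_ball f a)"

definition monomial_norm_sq :: "('d::finite \<Rightarrow> nat) \<Rightarrow> real" where
  "monomial_norm_sq \<alpha> =
     (\<Prod>j\<in>UNIV. fact (\<alpha> j)) * fact (CARD('d) - 1) / fact ((\<Sum>j\<in>UNIV. \<alpha> j) + CARD('d) - 1)"

definition hardy_norm_sq :: "(complex ^ 'd \<Rightarrow> 'm::complex_hilbert) \<Rightarrow> ennreal" where
  "hardy_norm_sq f =
     (\<Sum>\<^sub>\<infinity>\<alpha>\<in>UNIV. ennreal ((norm (taylor_coeff f \<alpha>))\<^sup>2 * monomial_norm_sq \<alpha>))"

text \<open>Functions on the ball are represented by their extension by zero to the whole space, so that
  equality in the space is equality on the ball. The existence of the power series is automatic for
  holomorphic functions on the ball.\<close>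

definition ball_holomorphic :: "(complex ^ 'd \<Rightarrow> 'm::complex_hilbert) set" where
  "ball_holomorphic =
     {f. (\<forall>z. z \<notin> ball 0 1 \<longrightarrow> f z = 0) \<and> cholomorphic_on f (ball 0 1) \<and>
         (\<exists>a. power_series_on_ball f a)}"

definition ball_volume :: "(complex ^ 'd) measure" where
  "ball_volume = uniform_measure lborel (ball 0 1)"

definition dirichlet_norm_sq ::
    "((complex ^ 'd) set \<Rightarrow> 'm::complex_hilbert \<Rightarrow> 'm) \<Rightarrow> (complex ^ 'd \<Rightarrow> 'm) \<Rightarrow> ennreal" where
  "dirichlet_norm_sq F f =
     hardy_norm_sq f +
     ennreal (1 / real CARD('d)) *
       (\<integral>\<^sup>+ z. ennreal (\<Sum>j\<in>UNIV. Re (cinner (poisson_integral F z (cpartial j f z)) (cpartial j f z)))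
          \<partial>ball_volume)"

definition dirichlet_space ::
    "((complex ^ 'd) set \<Rightarrow> 'm::complex_hilbert \<Rightarrow> 'm) \<Rightarrow> (complex ^ 'd \<Rightarrow> 'm) set" where
  "dirichlet_space F = {f \<in> ball_holomorphic. dirichlet_norm_sq F f < \<infinity>}"

definition fun_scaleC :: "complex \<Rightarrow> ('a \<Rightarrow> 'm::complex_hilbert) \<Rightarrow> 'a \<Rightarrow> 'm" where
  "fun_scaleC c f = (\<lambda>z. c *\<^sub>C f z)"

text \<open>The inner product inducing the norm, obtained by polarization.\<close>

definition dirichlet_inner ::
    "((complex ^ 'd) set \<Rightarrow> 'm::complex_hilbert \<Rightarrow> 'm) \<Rightarrow>
     (complex ^ 'd \<Rightarrow> 'm) \<Rightarrow> (complex ^ 'd \<Rightarrow> 'm) \<Rightarrow> complex" where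
  "dirichlet_inner F f g =
     (\<Sum>k<4. \<i> ^ k * complex_of_real (enn2real (dirichlet_norm_sq F (f + fun_scaleC (\<i> ^ k) g)))) / 4"

definition coord_mult :: "'d \<Rightarrow> (complex ^ 'd \<Rightarrow> 'm::complex_hilbert) \<Rightarrow> complex ^ 'd \<Rightarrow> 'm" where
  "coord_mult k f = (\<lambda>z. (z $ k) *\<^sub>C f z)"

definition coord_multiplier :: "((complex ^ 'd) set \<Rightarrow> 'm::complex_hilbert \<Rightarrow> 'm) \<Rightarrow> 'd \<Rightarrow> bool" where
  "coord_multiplier F k \<longleftrightarrow> (\<forall>f\<in>dirichlet_space F. coord_mult k f \<in> dirichlet_space F)"


section \<open>Joint isometries\<close>

text \<open>\<open>\<D>(F)\<close> depends on \<open>F\<close> and hence is not a type; Hilbert spaces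
  and their operators are therefore also needed relative to a carrier \<open>H\<close> with inner product \<open>ip\<close>.\<close>

definition ip_norm :: "('v \<Rightarrow> 'v \<Rightarrow> complex) \<Rightarrow> 'v \<Rightarrow> real" where
  "ip_norm ip x = sqrt (Re (ip x x))"

locale hilbert_space_on = vector_space smul
  for smul :: "complex \<Rightarrow> 'v::ab_group_add \<Rightarrow> 'v" +
  fixes H :: "'v set" and ip :: "'v \<Rightarrow> 'v \<Rightarrow> complex"
  assumes carrier_subspace: "subspace H"
    and ip_add_left: "\<lbrakk>x \<in> H; y \<in> H; z \<in> H\<rbrakk> \<Longrightarrow> ip (x + y) z = ip x z + ip y z"
    and ip_smul_left: "\<lbrakk>x \<in> H; y \<in> H\<rbrakk> \<Longrightarrow> ip (smul c x) y = c * ip x y"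
    and ip_commute: "\<lbrakk>x \<in> H; y \<in> H\<rbrakk> \<Longrightarrow> ip x y = cnj (ip y x)"
    and ip_nonneg: "x \<in> H \<Longrightarrow> ip x x \<in> \<real>\<^sub>\<ge>\<^sub>0"
    and ip_definite: "\<lbrakk>x \<in> H; ip x x = 0\<rbrakk> \<Longrightarrow> x = 0"
    and complete:
      "\<lbrakk>range X \<subseteq> H; \<forall>\<epsilon>>0. \<exists>N :: nat. \<forall>m\<ge>N. \<forall>n\<ge>N. ip_norm ip (X m - X n) < \<epsilon>\<rbrakk>
       \<Longrightarrow> \<exists>x\<in>H. (\<lambda>n. ip_norm ip (X n - x)) \<longlonglongrightarrow> 0"

definition bounded_operator_on ::
    "(complex \<Rightarrow> 'v::ab_group_add \<Rightarrow> 'v) \<Rightarrow> 'v set \<Rightarrow> ('v \<Rightarrow> 'v \<Rightarrow> complex) \<Rightarrow> ('v \<Rightarrow> 'v) \<Rightarrow> bool" where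
  "bounded_operator_on smul H ip T \<longleftrightarrow>
     T ` H \<subseteq> H \<and>
     (\<forall>x\<in>H. \<forall>y\<in>H. T (x + y) = T x + T y) \<and>
     (\<forall>c. \<forall>x\<in>H. T (smul c x) = smul c (T x)) \<and>
     (\<exists>K. \<forall>x\<in>H. ip_norm ip (T x) \<le> K * ip_norm ip x)"

definition adjoint_on :: "'v set \<Rightarrow> ('v \<Rightarrow> 'v \<Rightarrow> complex) \<Rightarrow> ('v \<Rightarrow> 'v) \<Rightarrow> 'v \<Rightarrow> 'v" where
  "adjoint_on H ip T y = (THE w. w \<in> H \<and> (\<forall>x\<in>H. ip (T x) y = ip x w))"

definition tuple_map ::
    "'v::ab_group_add set \<Rightarrow> ('v \<Rightarrow> 'v \<Rightarrow> complex) \<Rightarrow> ('i::finite \<Rightarrow> 'v \<Rightarrow> 'v) \<Rightarrow>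
     ('v \<Rightarrow> 'v) \<Rightarrow> 'v \<Rightarrow> 'v" where
  "tuple_map H ip T X = (\<lambda>x. \<Sum>j\<in>UNIV. adjoint_on H ip (T j) (X (T j x)))"

definition joint_isometry_on ::
    "(complex \<Rightarrow> 'v::ab_group_add \<Rightarrow> 'v) \<Rightarrow> 'v set \<Rightarrow> ('v \<Rightarrow> 'v \<Rightarrow> complex) \<Rightarrow> nat \<Rightarrow>
     ('i::finite \<Rightarrow> 'v \<Rightarrow> 'v) \<Rightarrow> bool" where
  "joint_isometry_on smul H ip m T \<longleftrightarrow>
     hilbert_space_on smul H ip \<and>
     (\<forall>j. bounded_operator_on smul H ip (T j)) \<and>
     (\<forall>i j. \<forall>x\<in>H. T i (T j x) = T j (T i x)) \<and>
     (\<forall>x\<in>H. (\<Sum>n\<le>m. smul ((-1) ^ n * of_nat (m choose n)) ((tuple_map H ip T ^^ n) id x)) = 0)"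

end

(* With f = sum of a_alpha z^alpha and u = P[F], the Hardy part of the norm is invariant under
   f -> (z_1 f, ..., z_d f), so only the densities S(f) = sum_k <u d_k f, d_k f> matter. For
   0 < r < 1, the combination
     sum_ij S(z_i z_j f) - 2 r^2 sum_j S(z_j f) + r^4 S(f)
   is what sum_k d_k dbar_k ((r^2 - |z|^2)^2 f conj(f)) becomes when the product f conj(f) is
   replaced by <u f, f>. Since u is harmonic and (r^2 - |z|^2)^2 vanishes to second order on the
   sphere of radius r, Green's identity shows that its integral over the ball of radius r is 0;
   letting r tend to 1 gives the 2-isometry identity for quadratic forms. Working with r < 1 avoids
   all boundary regularity. Green's identity is checked for the Poisson kernel and monomials,
   integrated against F by Fubini, and extended to f in the Hardy space by truncating the series. *)
theory Submission
  imports Defs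
begin

section \<open>Hilbert spaces on a carrier\<close>

text \<open>The weights r^2 and r^4 come from |z_1|^2 + ... + |z_d|^2 = |z|^2: in the terms <u d_k
  f, d_k f>, one or two coordinate multiplications produce the factors |z|^2 and |z|^4, so the
  combination has the coefficient (r^2 - |z|^2)^2 there, and the product rule supplies exactly the
  remaining terms. Harmonicity refers to the Laplacian of R^(2d), for which the kernel with exponent
  2d is the Poisson kernel of the ball. The quadratic identity is only half of the matter. A joint
  2-isometry is defined through adjoints, so the Dirichlet-type space must be complete and the
  multiplications bounded, while the hypothesis only says that they map the space into itself. Both
  facts rest on one property: by Fatou's lemma the Dirichlet norm is lower semicontinuous under
  convergence in the Hardy norm. This upgrades coefficientwise limits to norm limits, and through
  Baire's theorem it gives boundedness. Polarization then turns the quadratic identity into the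
  operator identity.\<close>

context hilbert_space_on
begin

abbreviation nrm :: "'v \<Rightarrow> real" where "nrm \<equiv> ip_norm ip"

lemma diff_mem: "x \<in> H \<Longrightarrow> y \<in> H \<Longrightarrow> x - y \<in> H"
  using carrier_subspace subspace_diff by blast

lemma add_mem: "x \<in> H \<Longrightarrow> y \<in> H \<Longrightarrow> x + y \<in> H"
  using carrier_subspace subspace_add by blast

lemma smul_mem: "x \<in> H \<Longrightarrow> smul c x \<in> H"
  using carrier_subspace subspace_scale by blast

lemma zero_mem: "0 \<in> H"
  using carrier_subspace subspace_0 by blast

lemma sum_mem: "(\<And>i. i \<in> I \<Longrightarrow> f i \<in> H) \<Longrightarrow> (\<Sum>i\<in>I. f i) \<in> H"
  using carrier_subspace subspace_sum by blast

lemmas mem = diff_mem add_mem smul_mem zero_mem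

lemma ip_add_right: "\<lbrakk>x \<in> H; y \<in> H; z \<in> H\<rbrakk> \<Longrightarrow> ip x (y + z) = ip x y + ip x z"
  by (metis ip_add_left ip_commute complex_cnj_add add_mem)

lemma ip_smul_right: "\<lbrakk>x \<in> H; y \<in> H\<rbrakk> \<Longrightarrow> ip x (smul c y) = cnj c * ip x y"
  by (metis ip_smul_left ip_commute complex_cnj_mult smul_mem)

lemma ip_zero_left: "y \<in> H \<Longrightarrow> ip 0 y = 0"
  using ip_smul_left[of y y 0] by simp

lemma ip_zero_right: "y \<in> H \<Longrightarrow> ip y 0 = 0"
  using ip_smul_right[of y y 0] by simp

lemma ip_diff_left: "\<lbrakk>x \<in> H; y \<in> H; z \<in> H\<rbrakk> \<Longrightarrow> ip (x - y) z = ip x z - ip y z"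
  using ip_add_left[of "x - y" y z] by (simp add: mem)

lemma ip_diff_right: "\<lbrakk>x \<in> H; y \<in> H; z \<in> H\<rbrakk> \<Longrightarrow> ip x (y - z) = ip x y - ip x z"
  using ip_add_right[of x "y - z" z] by (simp add: mem)

lemma ip_sum_right:
  "\<lbrakk>\<And>i. i \<in> I \<Longrightarrow> f i \<in> H; y \<in> H\<rbrakk> \<Longrightarrow> ip y (\<Sum>i\<in>I. f i) = (\<Sum>i\<in>I. ip y (f i))"
  by (induction I rule: infinite_finite_induct) (auto simp: ip_zero_right ip_add_right sum_mem)

lemma nrm_sq: "x \<in> H \<Longrightarrow> (nrm x)\<^sup>2 = Re (ip x x)"
  using ip_nonneg[of x] by (auto simp: ip_norm_def complex_nonneg_Reals_iff)

lemma ip_self: "x \<in> H \<Longrightarrow> ip x x = complex_of_real ((nrm x)\<^sup>2)"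
  using ip_nonneg[of x] by (simp add: nrm_sq complex_eq_iff complex_nonneg_Reals_iff)

lemma nrm_nonneg: "x \<in> H \<Longrightarrow> 0 \<le> nrm x"
  using ip_nonneg[of x] by (auto simp: ip_norm_def complex_nonneg_Reals_iff)

lemma nrm_eq_0_iff: "x \<in> H \<Longrightarrow> nrm x = 0 \<longleftrightarrow> x = 0"
  using ip_definite[of x] ip_self[of x] ip_zero_left[of 0] zero_mem by force

lemma nrm_smul: "x \<in> H \<Longrightarrow> nrm (smul c x) = cmod c * nrm x"
proof -
  assume x: "x \<in> H"
  have "complex_of_real ((nrm (smul c x))\<^sup>2) = c * cnj c * complex_of_real ((nrm x)\<^sup>2)"
    using x by (subst (1 2) ip_self[symmetric]) (simp_all add: ip_smul_left ip_smul_right mem)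
  also have "\<dots> = complex_of_real ((cmod c * nrm x)\<^sup>2)"
    by (simp add: power_mult_distrib flip: complex_norm_square)
  finally have "complex_of_real ((nrm (smul c x))\<^sup>2) = complex_of_real ((cmod c * nrm x)\<^sup>2)" .
  then show ?thesis
    using x by (metis of_real_eq_iff power2_eq_imp_eq nrm_nonneg smul_mem mult_nonneg_nonneg norm_ge_zero)
qed

lemma nrm_add_sq:
  assumes "x \<in> H" "y \<in> H"
  shows "(nrm (x + y))\<^sup>2 = (nrm x)\<^sup>2 + (nrm y)\<^sup>2 + 2 * Re (ip x y)"
  using assms ip_commute[of y x]
  by (simp add: nrm_sq mem ip_add_left ip_add_right)

lemma nrm_uminus: "x \<in> H \<Longrightarrow> nrm (- x) = nrm x"
  using nrm_smul[of x "-1"] by simp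

lemma nrm_diff_sq:
  assumes "x \<in> H" "y \<in> H"
  shows "(nrm (x - y))\<^sup>2 = (nrm x)\<^sup>2 + (nrm y)\<^sup>2 - 2 * Re (ip x y)"
  using assms ip_commute[of y x]
  by (simp add: nrm_sq mem ip_diff_left ip_diff_right)

lemma cauchy_schwarz:
  assumes x: "x \<in> H" and y: "y \<in> H"
  shows "cmod (ip x y) \<le> nrm x * nrm y"
proof (cases "y = 0")
  case True
  then show ?thesis using x by (simp add: ip_zero_right nrm_nonneg zero_mem)
next
  case False
  \<comment> \<open>\<open>smul t y\<close> is the orthogonal projection of \<open>x\<close> onto
    the line through \<open>y\<close>; the claim is the nonnegativity of the squared norm of the
    remainder.\<close>
  define t where "t = ip x y / ip y y"
  have ny: "nrm y > 0" using False y nrm_eq_0_iff[of y] nrm_nonneg[of y] by linarith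
  have "cmod (ip x y) * cmod (ip x y) = Re (ip x y * cnj (ip x y))"
    by (simp add: complex_mult_cnj cmod_power2 flip: power2_eq_square)
  then have e: "Re (cnj t * ip x y) = (cmod (ip x y))\<^sup>2 / (nrm y)\<^sup>2"
    using y by (simp add: t_def ip_self power2_eq_square mult.commute)
  have "0 \<le> (nrm (x - smul t y))\<^sup>2" by simp
  also have "\<dots> = (nrm x)\<^sup>2 + (cmod t * nrm y)\<^sup>2 - 2 * Re (cnj t * ip x y)"
    using x y by (simp add: nrm_diff_sq mem nrm_smul ip_smul_right)
  also have "(cmod t * nrm y)\<^sup>2 = (cmod (ip x y))\<^sup>2 / (nrm y)\<^sup>2"
    using y ny by (simp add: t_def ip_self norm_divide norm_mult norm_power power2_eq_square field_simps)
  finally have "(cmod (ip x y))\<^sup>2 / (nrm y)\<^sup>2 \<le> (nrm x)\<^sup>2" using e by simp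
  then have "(cmod (ip x y))\<^sup>2 \<le> (nrm x * nrm y)\<^sup>2"
    using ny by (simp add: field_simps power_mult_distrib)
  then show ?thesis using x y nrm_nonneg power2_le_imp_le by (meson mult_nonneg_nonneg)
qed

lemma nrm_triangle:
  assumes x: "x \<in> H" and y: "y \<in> H"
  shows "nrm (x + y) \<le> nrm x + nrm y"
proof -
  have "Re (ip x y) \<le> nrm x * nrm y"
    using cauchy_schwarz[OF assms] complex_Re_le_cmod order_trans by blast
  then have "(nrm (x + y))\<^sup>2 \<le> (nrm x + nrm y)\<^sup>2"
    using assms by (simp add: nrm_add_sq power2_sum)
  then show ?thesis using assms nrm_nonneg power2_le_imp_le by (meson add_nonneg_nonneg)
qed

lemma nrm_triangle_diff:
  assumes "x \<in> H" "y \<in> H"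
  shows "nrm (x - y) \<le> nrm x + nrm y"
  using nrm_triangle[of x "- y"] assms diff_mem[OF zero_mem, of y] by (simp add: nrm_uminus)

text \<open>Variational proof. If \<open>w\<close> represents \<phi>, then \<open>J x\<close> is the
  squared norm of x - w minus that of \<open>w\<close>, so \<open>w\<close> is sought as the
  minimizer of \<open>J\<close>. A minimizing sequence is Cauchy by the parallelogram law,
  completeness yields its limit, and the first variation of \<open>J\<close> at the limit vanishes
  in every direction, which is the representation.\<close>

theorem riesz:
  assumes add: "\<And>x y. \<lbrakk>x \<in> H; y \<in> H\<rbrakk> \<Longrightarrow> \<phi> (x + y) = \<phi> x + \<phi> y"
    and smul: "\<And>c x. x \<in> H \<Longrightarrow> \<phi> (smul c x) = c * \<phi> x"
    and bd: "\<And>x. x \<in> H \<Longrightarrow> cmod (\<phi> x) \<le> K * nrm x"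
  obtains w where "w \<in> H" "\<And>x. x \<in> H \<Longrightarrow> \<phi> x = ip x w"
proof -
  define J where "J x = (nrm x)\<^sup>2 - 2 * Re (\<phi> x)" for x
  have Jlow: "- K\<^sup>2 \<le> J x" if "x \<in> H" for x
  proof -
    have "Re (\<phi> x) \<le> K * nrm x" using bd[OF that] complex_Re_le_cmod order_trans by blast
    moreover have "0 \<le> (nrm x - K)\<^sup>2" by simp
    ultimately show ?thesis by (simp add: J_def power2_diff mult.commute)
  qed
  define m where "m = Inf (J ` H)"
  have bdd: "bdd_below (J ` H)" using Jlow by (auto simp: bdd_below_def)
  have m: "m \<le> J x" if "x \<in> H" for x
    unfolding m_def using that bdd by (simp add: cINF_lower)
  have "\<exists>x\<in>H. J x < m + 1 / real (Suc n)" for n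
  proof -
    have "Inf (J ` H) < m + 1 / real (Suc n)" by (simp add: m_def)
    then show ?thesis using cInf_lessD[of "J ` H"] zero_mem by blast
  qed
  then obtain X where X: "\<And>n. X n \<in> H" "\<And>n. J (X n) < m + 1 / real (Suc n)" by metis
  \<comment> \<open>The parallelogram law expresses \<open>J\<close> at the midpoint through
    \<open>J (X i)\<close>, \<open>J (X j)\<close> and the distance of the two points. The midpoint
    value is at least \<open>m\<close>, so the distance is controlled by the excess of both values
    over \<open>m\<close>.\<close>
  have par: "(nrm (X i - X j))\<^sup>2 \<le> 2 * (1 / real (Suc i) + 1 / real (Suc j))" for i j
  proof -
    have \<phi>h: "\<phi> (smul (1/2) (X i + X j)) = (\<phi> (X i) + \<phi> (X j)) / 2"
      using X by (simp add: smul mem add)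
    have nh: "nrm (smul (1/2) (X i + X j)) = nrm (X i + X j) / 2"
      using X by (simp add: nrm_smul mem)
    have eJ: "J (smul (1/2) (X i + X j)) = (nrm (X i + X j))\<^sup>2 / 4 - Re (\<phi> (X i) + \<phi> (X j))"
      unfolding J_def \<phi>h nh by (simp add: power_divide add_divide_distrib)
    have "2 * J (smul (1/2) (X i + X j)) = J (X i) + J (X j) - (nrm (X i - X j))\<^sup>2 / 2"
      unfolding eJ using X(1)[of i] X(1)[of j]
      by (simp add: J_def nrm_add_sq nrm_diff_sq field_simps)
    moreover have "m \<le> J (smul (1/2) (X i + X j))" using X by (intro m) (simp add: mem)
    ultimately show ?thesis using X(2)[of i] X(2)[of j] by argo
  qed
  have "\<exists>N. \<forall>i\<ge>N. \<forall>j\<ge>N. nrm (X i - X j) < \<epsilon>" if "\<epsilon> > 0" for \<epsilon>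
  proof -
    obtain N where N: "4 / \<epsilon>\<^sup>2 < real N" using reals_Archimedean2 by blast
    have "nrm (X i - X j) < \<epsilon>" if "i \<ge> N" "j \<ge> N" for i j
    proof -
      have "4 / \<epsilon>\<^sup>2 < real (Suc i)" "4 / \<epsilon>\<^sup>2 < real (Suc j)" using N that by simp_all
      then have "1 / real (Suc i) < \<epsilon>\<^sup>2 / 4" "1 / real (Suc j) < \<epsilon>\<^sup>2 / 4"
        using \<open>\<epsilon> > 0\<close> by (simp_all add: field_simps)
      then have "(nrm (X i - X j))\<^sup>2 < \<epsilon>\<^sup>2" using par[of i j] by argo
      then show ?thesis using \<open>\<epsilon> > 0\<close> power2_less_imp_less less_imp_le by blast
    qed
    then show ?thesis by blast
  qed
  then obtain w where w: "w \<in> H" "(\<lambda>n. nrm (X n - w)) \<longlonglongrightarrow> 0"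
    using complete[of X] X(1) by blast
  have Jw: "J w \<le> m"
  proof -
    have lim1: "(\<lambda>n. nrm w - nrm (X n - w)) \<longlonglongrightarrow> nrm w - 0" by (intro tendsto_intros w)
    have lim2: "(\<lambda>n. nrm w + nrm (X n - w)) \<longlonglongrightarrow> nrm w + 0" by (intro tendsto_intros w)
    have "nrm w - nrm (X n - w) \<le> nrm (X n)" "nrm (X n) \<le> nrm w + nrm (X n - w)" for n
      using nrm_triangle_diff[of "X n" "X n - w"] nrm_triangle[of w "X n - w"] X(1) w(1)
      by (simp_all add: mem)
    then have "(\<lambda>n. nrm (X n)) \<longlonglongrightarrow> nrm w"
      by (intro tendsto_sandwich[OF _ _ lim1[simplified] lim2[simplified]]) simp_all
    moreover have "(\<lambda>n. \<phi> (X n)) \<longlonglongrightarrow> \<phi> w"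
    proof -
      have "cmod (\<phi> (X n) - \<phi> w) \<le> K * nrm (X n - w)" for n
        using bd[of "X n - w"] add[of "X n - w" w] X(1) w(1) by (simp add: mem)
      moreover have l: "(\<lambda>n. K * nrm (X n - w)) \<longlonglongrightarrow> 0"
        by (rule tendsto_mult_right_zero[OF w(2)])
      ultimately have "(\<lambda>n. \<phi> (X n) - \<phi> w) \<longlonglongrightarrow> 0"
        by (intro Lim_null_comparison[OF _ l]) simp
      then show ?thesis by (simp add: LIM_zero_iff)
    qed
    ultimately have "(\<lambda>n. J (X n)) \<longlonglongrightarrow> J w" unfolding J_def by (intro tendsto_intros)
    moreover have "(\<lambda>n. m + 1 / real (Suc n)) \<longlonglongrightarrow> m + 0"
      by (intro tendsto_intros LIMSEQ_inverse_real_of_nat[unfolded inverse_eq_divide])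
    ultimately show ?thesis using X(2) by (intro LIMSEQ_le[of "\<lambda>n. J (X n)" "J w"]) (auto intro: less_imp_le)
  qed
  have "\<phi> x = ip x w" if x: "x \<in> H" for x
  proof -
    define D where "D = ip x w - \<phi> x"
    \<comment> \<open>Perturbing \<open>w\<close> by \<open>smul c x\<close> with c = - e * cnj D
      changes the linear part of \<open>J\<close> by - 2 e |D|^2 and the quadratic part by e^2 |x|^2
      |D|^2. This \<open>e\<close> keeps e |x|^2 below 1, so minimality forces
      \<open>D = 0\<close>.\<close>
    define e where "e = 1 / ((nrm x)\<^sup>2 + 1)"
    have e: "e > 0" "e * (nrm x)\<^sup>2 < 1"
      using add_nonneg_pos[of "(nrm x)\<^sup>2" 1] by (simp_all add: e_def field_simps)
    define c where "c = - (of_real e * cnj D)"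
    have "m \<le> J (w + smul c x)" using x w by (intro m) (simp add: mem)
    also have "J (w + smul c x) = J w + (cmod c * nrm x)\<^sup>2 + 2 * Re (c * D)"
      using x w ip_commute[of w "smul c x"]
      by (simp add: J_def nrm_add_sq mem nrm_smul add smul ip_smul_left D_def algebra_simps)
    also have "Re (c * D) = - e * (cmod D)\<^sup>2"
      unfolding cmod_power2 by (simp add: c_def algebra_simps power2_eq_square)
    also have "(cmod c * nrm x)\<^sup>2 = e * (e * (nrm x)\<^sup>2) * (cmod D)\<^sup>2"
      using e by (simp add: c_def norm_mult power_mult_distrib power2_eq_square)
    finally have "2 * (e * (cmod D)\<^sup>2) \<le> (e * (nrm x)\<^sup>2) * (e * (cmod D)\<^sup>2)"
      using Jw by (simp add: algebra_simps)
    moreover have "(e * (nrm x)\<^sup>2) * (e * (cmod D)\<^sup>2) \<le> 1 * (e * (cmod D)\<^sup>2)"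
      using e by (intro mult_right_mono) auto
    ultimately have "e * (cmod D)\<^sup>2 \<le> 0" by linarith
    then have "D = 0" using e(1) by (simp add: mult_le_0_iff)
    then show ?thesis by (simp add: D_def)
  qed
  then show ?thesis using w(1) that by blast
qed

lemma ip_eqI:
  assumes "v \<in> H" "w \<in> H" "\<And>x. x \<in> H \<Longrightarrow> ip x v = ip x w"
  shows "v = w"
  using assms ip_definite[of "v - w"] by (simp add: mem ip_diff_right)

text \<open>Riesz applied to \<open>\<lambda>x. ip (T x) y\<close> gives a witness for the definite
  description, boundedness of \<open>T\<close> being the continuity of this functional. The witness
  is unique because a vector of \<open>H\<close> is determined by its inner products with
  \<open>H\<close>.\<close>

lemma adjoint_on:
  assumes T: "bounded_operator_on smul H ip T" and y: "y \<in> H"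
  shows "adjoint_on H ip T y \<in> H" "x \<in> H \<Longrightarrow> ip x (adjoint_on H ip T y) = ip (T x) y"
proof -
  have TH: "\<And>x. x \<in> H \<Longrightarrow> T x \<in> H"
    and T1: "\<And>x y. x \<in> H \<Longrightarrow> y \<in> H \<Longrightarrow> T (x + y) = T x + T y"
    and T2: "\<And>c x. x \<in> H \<Longrightarrow> T (smul c x) = smul c (T x)"
    using T by (auto simp: bounded_operator_on_def)
  obtain K where K: "\<And>x. x \<in> H \<Longrightarrow> nrm (T x) \<le> K * nrm x"
    using T unfolding bounded_operator_on_def by blast
  obtain w where w: "w \<in> H" "\<And>x. x \<in> H \<Longrightarrow> ip (T x) y = ip x w"
  proof (rule riesz[of "\<lambda>x. ip (T x) y" "K * nrm y"])
    show "cmod (ip (T x) y) \<le> K * nrm y * nrm x" if "x \<in> H" for x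
      using cauchy_schwarz[OF TH y, of x] mult_right_mono[OF K nrm_nonneg[OF y], of x] that
      by (simp add: mult_ac)
  qed (use TH T1 T2 y in \<open>auto simp: ip_add_left ip_smul_left\<close>)
  have "adjoint_on H ip T y = w"
    unfolding adjoint_on_def
    by (rule the_equality) (use w in \<open>auto intro!: ip_eqI\<close>)
  with w show "adjoint_on H ip T y \<in> H" "x \<in> H \<Longrightarrow> ip x (adjoint_on H ip T y) = ip (T x) y"
    by auto
qed

text \<open>Boundedness follows from Baire's theorem since the sublevel sets of
  \<open>x \<mapsto> \<Parallel>T x\<Parallel>\<close> are closed.\<close>

theorem bounded_operator_of_lsc:
  assumes TH: "\<And>x. x \<in> H \<Longrightarrow> T x \<in> H"
    and T1: "\<And>x y. x \<in> H \<Longrightarrow> y \<in> H \<Longrightarrow> T (x + y) = T x + T y"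
    and T2: "\<And>c x. x \<in> H \<Longrightarrow> T (smul c x) = smul c (T x)"
    and lsc: "\<And>X x c. \<lbrakk>\<And>n. X n \<in> H; x \<in> H; (\<lambda>n. nrm (X n - x)) \<longlonglongrightarrow> 0; \<And>n. nrm (T (X n)) \<le> c\<rbrakk>
      \<Longrightarrow> nrm (T x) \<le> c"
  shows "bounded_operator_on smul H ip T"
proof -
  \<comment> \<open>\<open>Metric_space\<close> asks for nonnegativity and symmetry on the whole
    type, so the distance is set to 0 off the carrier.\<close>
  define d where "d x y = (if x \<in> H \<and> y \<in> H then nrm (x - y) else 0)" for x y
  interpret M: Metric_space H d
  proof
    show "0 \<le> d x y" for x y by (simp add: d_def nrm_nonneg mem)
    show "d x y = d y x" for x y
      using nrm_uminus[of "x - y"] by (simp add: d_def mem)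
    show "d x y = 0 \<longleftrightarrow> x = y" if "x \<in> H" "y \<in> H" for x y
      using that by (simp add: d_def nrm_eq_0_iff mem)
    show "d x z \<le> d x y + d y z" if "x \<in> H" "y \<in> H" "z \<in> H" for x y z
      using that nrm_triangle[of "x - y" "y - z"] by (simp add: d_def mem)
  qed
  have limd: "limitin M.mtopology X x sequentially \<longleftrightarrow> (\<lambda>n. nrm (X n - x)) \<longlonglongrightarrow> 0"
    if "\<And>n. X n \<in> H" "x \<in> H" for X x
    using that by (simp add: M.limitin_metric_dist_null d_def)
  have "M.mcomplete"
    unfolding M.mcomplete_def
  proof (intro allI impI)
    fix X assume X: "M.MCauchy X"
    then have XH: "X n \<in> H" for n by (auto simp: M.MCauchy_def)
    have "\<exists>x\<in>H. (\<lambda>n. nrm (X n - x)) \<longlonglongrightarrow> 0"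
    proof (rule complete)
      show "\<forall>\<epsilon>>0. \<exists>N. \<forall>m\<ge>N. \<forall>n\<ge>N. nrm (X m - X n) < \<epsilon>"
        using X XH unfolding M.MCauchy_def d_def by fastforce
    qed (use XH in auto)
    then show "\<exists>x. limitin M.mtopology X x sequentially" using limd XH by blast
  qed
  define C where "C n = {x \<in> H. nrm (T x) \<le> real n}" for n
  have clo: "closedin M.mtopology (C n)" for n
    unfolding M.metric_closedin_iff_sequentially_closed
  proof (intro conjI allI impI)
    show "C n \<subseteq> H" by (auto simp: C_def)
    fix X x assume X: "range X \<subseteq> C n \<and> limitin M.mtopology X x sequentially"
    then have "x \<in> H" using M.limitin_mspace by blast
    moreover have XC: "X k \<in> H" "nrm (T (X k)) \<le> real n" for k
      using X by (auto simp: C_def)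
    ultimately show "x \<in> C n" using lsc[of X x "real n"] limd[of X x] X by (simp add: C_def)
  qed
  have "\<Union> (range C) = H" by (auto simp: C_def real_arch_simple)
  moreover have "M.mtopology interior_of H = H"
    using interior_of_topspace[of M.mtopology] by simp
  ultimately obtain n where n: "M.mtopology interior_of (C n) \<noteq> {}"
    using M.metric_Baire_category_alt[OF \<open>M.mcomplete\<close>, of "range C"] clo zero_mem by auto
  then obtain x0 \<epsilon> where x0: "x0 \<in> H" "\<epsilon> > 0" "M.mball x0 \<epsilon> \<subseteq> C n"
    by (auto simp: M.in_interior_of_mball)
  \<comment> \<open>\<open>T y\<close> is the difference of the images of \<open>x0 + y\<close> and
    \<open>x0\<close>, two points of the ball contained in \<open>C n\<close>; this moves the bound
    from the ball around \<open>x0\<close> to one around the origin.\<close>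
  have small: "nrm (T y) \<le> 2 * real n" if y: "y \<in> H" "nrm y < \<epsilon>" for y
  proof -
    have "x0 + y \<in> M.mball x0 \<epsilon>" "x0 \<in> M.mball x0 \<epsilon>"
      using x0 y nrm_uminus[of y] nrm_eq_0_iff[OF zero_mem] by (simp_all add: d_def mem)
    then have "nrm (T (x0 + y)) \<le> n" "nrm (T x0) \<le> n" using x0(3) by (auto simp: C_def)
    moreover have "T y = T (x0 + y) - T x0" using T1 x0 y by simp
    ultimately show ?thesis
      using nrm_triangle_diff[of "T (x0 + y)" "T x0"] TH x0 y by (simp add: mem)
  qed
  have "nrm (T x) \<le> (4 * real n / \<epsilon>) * nrm x" if x: "x \<in> H" for x
  proof (cases "x = 0")
    case True
    then show ?thesis using T2[OF zero_mem, of 0] nrm_eq_0_iff[OF zero_mem] by simp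
  next
    case False
    then have nx: "nrm x > 0" using nrm_eq_0_iff[OF x] nrm_nonneg[OF x] by linarith
    define t where "t = \<epsilon> / (2 * nrm x)"
    have t: "t > 0" using nx x0 by (simp add: t_def)
    have "nrm (smul (of_real t) x) = \<epsilon> / 2" using x nx t by (simp add: nrm_smul) (simp add: t_def)
    then have "nrm (T (smul (of_real t) x)) \<le> 2 * real n" using x0(2) x by (intro small) (auto simp: mem)
    moreover have "nrm (T (smul (of_real t) x)) = t * nrm (T x)"
      using x t by (simp add: T2 nrm_smul TH)
    ultimately have "t * nrm (T x) \<le> 2 * real n" by simp
    then have "nrm (T x) \<le> 2 * real n / t" using t by (simp add: field_simps)
    then show ?thesis by (simp add: t_def mult_ac)
  qed
  then show ?thesis unfolding bounded_operator_on_def using TH T1 T2 by blast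
qed

text \<open>The diagonal at \<open>x + y\<close> kills the sum of \<open>B x y\<close> and
  \<open>B y x\<close>, the diagonal at \<open>x + smul \<i> y\<close> their difference. Operator
  identities can thus be checked on quadratic forms.\<close>

lemma polarization:
  assumes "x \<in> H" "y \<in> H" and B1: "\<And>x y z. \<lbrakk>x \<in> H; y \<in> H; z \<in> H\<rbrakk> \<Longrightarrow> B (x + y) z = B x z + B y z"
    and B2: "\<And>x y z. \<lbrakk>x \<in> H; y \<in> H; z \<in> H\<rbrakk> \<Longrightarrow> B z (x + y) = B z x + B z y"
    and B3: "\<And>c x y. \<lbrakk>x \<in> H; y \<in> H\<rbrakk> \<Longrightarrow> B (smul c x) y = c * B x y"
    and B4: "\<And>c x y. \<lbrakk>x \<in> H; y \<in> H\<rbrakk> \<Longrightarrow> B x (smul c y) = cnj c * B x y"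
    and B0: "\<And>x. x \<in> H \<Longrightarrow> B x x = (0::complex)"
  shows "B x y = 0"
proof -
  have "B x y + B y x = 0"
    using B0[of "x + y"] B0[of x] B0[of y] assms(1-4) by (simp add: mem add.commute)
  moreover have "B (x + smul \<i> y) (x + smul \<i> y) = 0" using assms by (intro B0) (simp add: mem)
  then have "\<i> * (B y x - B x y) = 0" using assms(1-6) B0[of x] B0[of y] by (simp add: mem algebra_simps)
  ultimately show ?thesis by simp
qed

text \<open>Paired with a vector, the operator in the definition of a joint 2-isometry becomes a
  sesquilinear form, each adjoint moving over to the other argument. Its diagonal is the left side
  of \<open>quad\<close>, so polarization makes the form, and hence the operator, vanish.\<close>

theorem joint_two_isometry:
  fixes T :: "'i::finite \<Rightarrow> 'v \<Rightarrow> 'v"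
  assumes T: "\<And>j. bounded_operator_on smul H ip (T j)"
    and comm: "\<And>i j x. x \<in> H \<Longrightarrow> T i (T j x) = T j (T i x)"
    and quad: "\<And>x. x \<in> H \<Longrightarrow>
      (nrm x)\<^sup>2 - 2 * (\<Sum>j\<in>UNIV. (nrm (T j x))\<^sup>2) + (\<Sum>j\<in>UNIV. \<Sum>i\<in>UNIV. (nrm (T i (T j x)))\<^sup>2) = 0"
  shows "joint_isometry_on smul H ip 2 T"
proof -
  have TH: "\<And>j x. x \<in> H \<Longrightarrow> T j x \<in> H"
    and T1: "\<And>j x y. x \<in> H \<Longrightarrow> y \<in> H \<Longrightarrow> T j (x + y) = T j x + T j y"
    and T2: "\<And>j c x. x \<in> H \<Longrightarrow> T j (smul c x) = smul c (T j x)"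
    using T by (simp_all add: bounded_operator_on_def image_subset_iff)
  define Q where "Q = tuple_map H ip T"
  have QH: "Q X x \<in> H" if "\<And>x. x \<in> H \<Longrightarrow> X x \<in> H" "x \<in> H" for X x
    unfolding Q_def tuple_map_def using that adjoint_on(1)[OF T] TH by (intro sum_mem) auto
  have Qip: "ip y (Q X x) = (\<Sum>j\<in>UNIV. ip (T j y) (X (T j x)))"
    if "\<And>x. x \<in> H \<Longrightarrow> X x \<in> H" "x \<in> H" "y \<in> H" for X x y
  proof -
    have "ip y (Q X x) = (\<Sum>j\<in>UNIV. ip y (adjoint_on H ip (T j) (X (T j x))))"
      unfolding Q_def tuple_map_def
      using that adjoint_on(1)[OF T] TH by (intro ip_sum_right) auto
    then show ?thesis using that adjoint_on(2)[OF T] TH by simp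
  qed
  define B where "B x y = ip x y - 2 * (\<Sum>j\<in>UNIV. ip (T j x) (T j y))
    + (\<Sum>j\<in>UNIV. \<Sum>i\<in>UNIV. ip (T i (T j x)) (T i (T j y)))" for x y
  have "B x y = 0" if "x \<in> H" "y \<in> H" for x y
  proof (rule polarization[where B = B])
    show "B x x = 0" if "x \<in> H" for x
    proof -
      have "B x x = of_real ((nrm x)\<^sup>2 - 2 * (\<Sum>j\<in>UNIV. (nrm (T j x))\<^sup>2)
          + (\<Sum>j\<in>UNIV. \<Sum>i\<in>UNIV. (nrm (T i (T j x)))\<^sup>2))"
        using that TH by (simp add: B_def ip_self)
      then show ?thesis using quad[OF that] by simp
    qed
  qed (use that TH in \<open>simp_all add: B_def T1 T2 mem ip_add_left ip_add_right ip_smul_left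
      ip_smul_right sum.distrib sum_distrib_left algebra_simps\<close>)
  moreover have "ip y (\<Sum>n\<le>2. smul ((-1) ^ n * of_nat (2 choose n)) ((Q ^^ n) id x)) = B y x"
    if x: "x \<in> H" and y: "y \<in> H" for x y
  proof -
    have "(\<Sum>n\<le>2. smul ((-1) ^ n * of_nat (2 choose n)) ((Q ^^ n) id x)) = x + smul (- 2) (Q id x) + Q (Q id) x"
      by (simp add: numeral_2_eq_2)
    then show ?thesis
      using x y QH TH by (simp add: B_def mem ip_add_right ip_diff_right ip_smul_right Qip)
  qed
  moreover have "(\<Sum>n\<le>2. smul ((-1) ^ n * of_nat (2 choose n)) ((Q ^^ n) id x)) \<in> H" if "x \<in> H" for x
    using that QH by (simp add: numeral_2_eq_2 mem)
  ultimately have "(\<Sum>n\<le>2. smul ((-1) ^ n * of_nat (2 choose n)) ((Q ^^ n) id x)) = 0" if "x \<in> H" for x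
    using that by (intro ip_eqI) (auto simp: zero_mem ip_zero_right)
  then show ?thesis
    unfolding joint_isometry_on_def Q_def[symmetric]
    using T comm hilbert_space_on_axioms by blast
qed

end

section \<open>Complex Hilbert space types as instances of the carrier version\<close>

lemma scaleC_one [simp]: "1 *\<^sub>C (x::'m::complex_hilbert) = x"
  using scaleR_scaleC[of 1 x] by simp

lemma norm_scaleC: "norm (c *\<^sub>C (x::'m::complex_hilbert)) = cmod c * norm x"
proof -
  have "complex_of_real ((norm (c *\<^sub>C x))\<^sup>2) = c * cnj c * complex_of_real ((norm x)\<^sup>2)"
    using cinner_commute[of x "c *\<^sub>C x"]
    by (simp only: cinner_self[symmetric] cinner_scaleC_left complex_cnj_mult mult_ac
        cinner_commute[of x x, symmetric])
  also have "\<dots> = complex_of_real ((cmod c * norm x)\<^sup>2)"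
    by (simp add: power_mult_distrib flip: complex_norm_square)
  finally show ?thesis
    by (metis of_real_eq_iff power2_eq_imp_eq norm_ge_zero mult_nonneg_nonneg)
qed

lemma ip_norm_cinner [simp]: "ip_norm cinner (x::'m::complex_hilbert) = norm x"
  by (simp add: ip_norm_def cinner_self)

text \<open>Makes Cauchy-Schwarz and the Riesz theorem available in the value space
  \<open>'m\<close> too, with the whole type as carrier.\<close>

lemma hilbert_space_on_UNIV:
  "hilbert_space_on (scaleC :: complex \<Rightarrow> 'm::complex_hilbert \<Rightarrow> 'm) UNIV cinner"
proof -
  interpret vector_space "scaleC :: complex \<Rightarrow> 'm \<Rightarrow> 'm"
    by standard (simp_all add: scaleC_add_right scaleC_add_left scaleC_scaleC)
  show ?thesis
  proof
    show "subspace (UNIV :: 'm set)" by (simp add: subspace_def)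
    show "cinner x x \<in> \<real>\<^sub>\<ge>\<^sub>0" for x :: 'm by (simp add: cinner_self complex_nonneg_Reals_iff)
    show "cinner x x = 0 \<Longrightarrow> x = 0" for x :: 'm by (simp add: cinner_self)
    show "\<exists>x\<in>UNIV. (\<lambda>n. ip_norm cinner (X n - x)) \<longlonglongrightarrow> 0"
      if "\<forall>\<epsilon>>0. \<exists>N :: nat. \<forall>m\<ge>N. \<forall>n\<ge>N. ip_norm cinner (X m - X n) < \<epsilon>" for X :: "nat \<Rightarrow> 'm"
    proof -
      have "Cauchy X" using that by (auto simp: Cauchy_def dist_norm)
      then obtain x where "X \<longlonglongrightarrow> x" using Cauchy_convergent_iff convergent_def by blast
      then have "(\<lambda>n. norm (X n - x)) \<longlonglongrightarrow> 0" by (simp add: LIM_zero tendsto_norm_zero)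
      then show ?thesis by auto
    qed
  qed (auto intro: cinner_add_left cinner_scaleC_left cinner_commute)
qed

interpretation hilbert: hilbert_space_on "scaleC :: complex \<Rightarrow> 'm::complex_hilbert \<Rightarrow> 'm" UNIV cinner
  by (rule hilbert_space_on_UNIV)

lemmas cinner_add_right = hilbert.ip_add_right[OF UNIV_I UNIV_I UNIV_I]
  and cinner_scaleC_right = hilbert.ip_smul_right[OF UNIV_I UNIV_I]
  and cinner_zero_right [simp] = hilbert.ip_zero_right[OF UNIV_I]
  and cinner_zero_left [simp] = hilbert.ip_zero_left[OF UNIV_I]

lemma cinner_cauchy_schwarz: "cmod (cinner (x::'m::complex_hilbert) y) \<le> norm x * norm y"
  using hilbert.cauchy_schwarz[of x y] by simp

lemma cinner_eqI: "(\<And>y. cinner v y = cinner w (y::'m::complex_hilbert)) \<Longrightarrow> v = w"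
  by (rule hilbert.ip_eqI) (auto, metis cinner_commute)

lemma bounded_bilinear_scaleC:
  "bounded_bilinear (scaleC :: complex \<Rightarrow> 'm::complex_hilbert \<Rightarrow> 'm)"
proof
  show "r *\<^sub>C a *\<^sub>R b = a *\<^sub>R r *\<^sub>C b" for a r and b :: 'm
    by (simp add: scaleR_scaleC[where 'a='m] scaleC_scaleC mult.commute)
  show "(a *\<^sub>R r) *\<^sub>C b = a *\<^sub>R r *\<^sub>C b" for a r and b :: 'm
    by (simp add: scaleR_scaleC[where 'a='m] scaleC_scaleC scaleR_conv_of_real)
  show "\<exists>K. \<forall>a b::'m. norm (a *\<^sub>C b) \<le> norm a * norm b * K"
    by (rule exI[of _ 1]) (simp add: norm_scaleC)
qed (simp_all add: scaleC_add_right scaleC_add_left)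

lemma bounded_bilinear_cinner:
  "bounded_bilinear (cinner :: 'm::complex_hilbert \<Rightarrow> 'm \<Rightarrow> complex)"
proof
  show "cinner (a *\<^sub>R x) y = a *\<^sub>R cinner x y" for a and x y :: 'm
    by (simp add: scaleR_scaleC[where 'a='m] cinner_scaleC_left scaleR_conv_of_real)
  show "cinner x (a *\<^sub>R y) = a *\<^sub>R cinner x y" for a and x y :: 'm
    by (simp add: scaleR_scaleC[where 'a='m] cinner_scaleC_right scaleR_conv_of_real)
  show "\<exists>K. \<forall>a b::'m. norm (cinner a b) \<le> norm a * norm b * K"
    by (rule exI[of _ 1]) (simp add: cinner_cauchy_schwarz)
qed (simp_all add: cinner_add_left cinner_add_right)

lemmas has_derivative_scaleC = bounded_bilinear.FDERIV[OF bounded_bilinear_scaleC]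
  and tendsto_cinner = bounded_bilinear.tendsto[OF bounded_bilinear_cinner]

section \<open>Operator-valued integrals against a semispectral measure\<close>

text \<open>Linear relations between finitely many measures pass from sets to bounded nonnegative
  functions by induction on measurable functions. The principle serves twice: for the independence
  of a signed integral from the chosen decomposition, and for the sesquilinearity of integrals
  against a semispectral measure.\<close>

lemma integral_linear_relation:
  fixes c :: "'i \<Rightarrow> complex" and M :: "'i \<Rightarrow> 'a measure" and f :: "'a \<Rightarrow> real"
  assumes I: "finite I" and fin: "\<And>i. i \<in> I \<Longrightarrow> finite_measure (M i)"
    and sets: "\<And>i. i \<in> I \<Longrightarrow> sets (M i) = sets N"
    and rel: "\<And>A. A \<in> sets N \<Longrightarrow> (\<Sum>i\<in>I. c i * of_real (measure (M i) A)) = 0"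
    and f: "f \<in> borel_measurable N" "\<And>x. 0 \<le> f x" "\<And>x. x \<in> space N \<Longrightarrow> f x \<le> K"
  shows "(\<Sum>i\<in>I. c i * of_real (\<integral>x. f x \<partial>M i)) = 0"
proof -
  have meas: "u \<in> borel_measurable (M i)" if "u \<in> borel_measurable N" "i \<in> I" for u :: "'a \<Rightarrow> real" and i
    using that sets by (simp cong: measurable_cong_sets)
  have sp: "space (M i) = space N" if "i \<in> I" for i
    using sets_eq_imp_space_eq[OF sets[OF that]] .
  have int: "integrable (M i) u"
    if "u \<in> borel_measurable N" "\<And>x. 0 \<le> u x" "\<And>x. x \<in> space N \<Longrightarrow> u x \<le> K" "i \<in> I"
    for u :: "'a \<Rightarrow> real" and i K
  proof (rule finite_measure.integrable_const_bound[OF fin[OF that(4)], of _ K])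
    show "AE x in M i. norm (u x) \<le> K" using that sp[OF that(4)] by (intro AE_I2) simp
  qed (rule meas[OF that(1,4)])
  \<comment> \<open>The bound belongs to the induction statement, for every \<open>K\<close>: the
    pieces of a bounded function must be bounded again for their integrals to be additive, and
    scaling changes the constant.\<close>
  have "(\<forall>x\<in>space N. f x \<le> K) \<longrightarrow> (\<Sum>i\<in>I. c i * of_real (\<integral>x. f x \<partial>M i)) = 0" for K
    using f(1,2)
  proof (induction arbitrary: K rule: borel_measurable_induct_real)
    case (set A)
    then have "A \<inter> space N = A" by (simp add: Int_absorb2 sets.sets_into_space)
    then show ?case using rel[OF set] sp by (simp cong: sum.cong)
  next
    case (mult u a)
    show ?case
    proof (cases "a = 0")
      case False
      then have "a > 0" using mult by simp
      show ?thesis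
      proof
        assume "\<forall>x\<in>space N. a * u x \<le> K"
        then have "\<forall>x\<in>space N. u x \<le> K / a" using \<open>a > 0\<close> by (simp add: field_simps)
        then have "(\<Sum>i\<in>I. c i * of_real (\<integral>x. u x \<partial>M i)) = 0" using mult by blast
        then have "of_real a * (\<Sum>i\<in>I. c i * of_real (\<integral>x. u x \<partial>M i)) = 0" by simp
        then show "(\<Sum>i\<in>I. c i * of_real (\<integral>x. a * u x \<partial>M i)) = 0"
          by (simp add: sum_distrib_left mult_ac)
      qed
    qed simp
  next
    case (add u v)
    show ?case
    proof
      assume K: "\<forall>x\<in>space N. v x + u x \<le> K"
      have "\<forall>x\<in>space N. u x \<le> K" "\<forall>x\<in>space N. v x \<le> K"
        using K add.hyps(2,4) by (force intro: order_trans[rotated])+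
      moreover have "(\<integral>x. v x + u x \<partial>M i) = (\<integral>x. v x \<partial>M i) + (\<integral>x. u x \<partial>M i)" if "i \<in> I" for i
        using int[OF add.hyps(1,2) _ that, of K] int[OF add.hyps(3,4) _ that, of K] calculation
        by (intro Bochner_Integration.integral_add) auto
      ultimately show "(\<Sum>i\<in>I. c i * of_real (\<integral>x. v x + u x \<partial>M i)) = 0"
        using add.IH(1)[of K] add.IH(2)[of K] by (simp add: distrib_left sum.distrib)
    qed
  next
    case (seq U)
    show ?case
    proof
      assume K: "\<forall>x\<in>space N. f x \<le> K"
      have UK: "U n x \<le> K" if "x \<in> space N" for n x
      proof -
        have "incseq (\<lambda>n. U n x)" using seq.hyps(3) by (simp add: incseq_def le_fun_def)
        then have "U n x \<le> f x" using seq.hyps(4)[OF that] by (rule incseq_le)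
        then show ?thesis using K that by force
      qed
      have fm: "f \<in> borel_measurable N"
        by (rule borel_measurable_LIMSEQ_real[OF seq.hyps(4) seq.hyps(1)])
      have "(\<lambda>n. \<integral>x. U n x \<partial>M i) \<longlonglongrightarrow> (\<integral>x. f x \<partial>M i)" if i: "i \<in> I" for i
      proof (rule integral_dominated_convergence[where w = "\<lambda>_. K"])
        show "integrable (M i) (\<lambda>_. K)" using fin[OF i] by (simp add: finite_measure.integrable_const)
        show "f \<in> borel_measurable (M i)" "U n \<in> borel_measurable (M i)" for n
          by (rule meas[OF _ i]; fact)+
        show "AE x in M i. (\<lambda>n. U n x) \<longlonglongrightarrow> f x"
          by (rule AE_I2) (rule seq.hyps(4), simp add: sp[OF i])
        show "AE x in M i. norm (U n x) \<le> K" for n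
          by (rule AE_I2) (use UK seq.hyps(2) in \<open>simp add: sp[OF i]\<close>)
      qed
      then have "(\<lambda>n. \<Sum>i\<in>I. c i * of_real (\<integral>x. U n x \<partial>M i)) \<longlonglongrightarrow> (\<Sum>i\<in>I. c i * of_real (\<integral>x. f x \<partial>M i))"
        by (intro tendsto_intros)
      moreover have "(\<Sum>i\<in>I. c i * of_real (\<integral>x. U n x \<partial>M i)) = 0" for n
        using seq.IH[of n K] UK by blast
      ultimately show "(\<Sum>i\<in>I. c i * of_real (\<integral>x. f x \<partial>M i)) = 0" 
        by (simp add: LIMSEQ_const_iff)
    qed
  qed
  then show ?thesis using f(3) by blast
qed

text \<open>\<open>Y\<close> is the positive set of a Hahn decomposition. Passing from a subset
  \<open>B\<close> of \<open>A\<close> to \<open>A \<inter> Y\<close> drops a part outside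
  \<open>Y\<close>, where \<nu> is nonpositive, and adds a part inside \<open>Y\<close>, where it is
  nonnegative. The supremum in the definition is therefore attained at
  \<open>A \<inter> Y\<close>.\<close>

lemma positive_variation_Hahn:
  assumes fin: "finite_measure M1" "finite_measure M2"
    and sets: "sets M1 = sets N" "sets M2 = sets N"
    and \<nu>: "\<And>A. A \<in> sets N \<Longrightarrow> \<nu> A = measure M1 A - measure M2 A"
    and Y: "Y \<in> sets N" "\<And>A. A \<in> sets N \<Longrightarrow> A \<subseteq> Y \<Longrightarrow> 0 \<le> \<nu> A"
      "\<And>A. A \<in> sets N \<Longrightarrow> A \<inter> Y = {} \<Longrightarrow> \<nu> A \<le> 0"
  shows "sets (positive_variation N \<nu>) = sets N" "finite_measure (positive_variation N \<nu>)"
    "\<And>A. A \<in> sets N \<Longrightarrow> measure (positive_variation N \<nu>) A = \<nu> (A \<inter> Y)"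
proof -
  interpret M1: finite_measure M1 by fact
  interpret M2: finite_measure M2 by fact
  have sp: "space M1 = space N" "space M2 = space N"
    using sets sets_eq_imp_space_eq by blast+
  have split: "\<nu> (A \<union> B) = \<nu> A + \<nu> B" if "A \<in> sets N" "B \<in> sets N" "A \<inter> B = {}" for A B
    using that sets by (simp add: \<nu> M1.finite_measure_Union M2.finite_measure_Union)
  \<comment> \<open>A genuine measure with the expected values, so that \<open>measure_of\<close> in
    the definition of the positive variation really returns them.\<close>
  define p where "p = diff_measure (density M1 (indicator Y)) (density M2 (indicator Y))"
  have e: "emeasure (density M1 (indicator Y)) A = ennreal (measure M1 (A \<inter> Y))"
    "emeasure (density M2 (indicator Y)) A = ennreal (measure M2 (A \<inter> Y))" if "A \<in> sets N" for A
    using that Y(1) sets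
    by (simp_all add: emeasure_restricted M1.emeasure_eq_measure M2.emeasure_eq_measure Int_commute)
  have fd: "finite_measure (density M1 (indicator Y))" "finite_measure (density M2 (indicator Y))"
    using e[of "space N"] sp by (auto intro!: finite_measureI)
  have ep: "emeasure p A = ennreal (\<nu> (A \<inter> Y))" if "A \<in> sets N" for A
    unfolding p_def
  proof (subst emeasure_diff_measure[OF fd])
    fix A assume "A \<in> sets (density M1 (indicator Y))"
    then have "A \<in> sets N" using sets by simp
    then show "emeasure (density M2 (indicator Y)) A \<le> emeasure (density M1 (indicator Y)) A"
      using Y(2)[of "A \<inter> Y"] \<nu>[of "A \<inter> Y"] Y(1) by (simp add: e)
  qed (use that sets Y \<nu>[of "A \<inter> Y"] in \<open>simp_all add: e ennreal_minus\<close>)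
  have "positive_variation N \<nu> = measure_of (space p) (sets p) (emeasure p)"
    unfolding positive_variation_def
  proof -
    have s: "space p = space N" "sets p = sets N" by (simp_all add: p_def sets sp)
    show "measure_of (space N) (sets N) (\<lambda>A. SUP B\<in>{B \<in> sets N. B \<subseteq> A}. ennreal (\<nu> B)) =
      measure_of (space p) (sets p) (emeasure p)"
      unfolding s
    proof (rule measure_of_eq)
      show "sets N \<subseteq> Pow (space N)" by (rule sets.space_closed)
      fix A assume "A \<in> sigma_sets (space N) (sets N)"
      then have A: "A \<in> sets N" by (simp add: sets.sigma_sets_eq)
      have "(SUP B\<in>{B \<in> sets N. B \<subseteq> A}. ennreal (\<nu> B)) = ennreal (\<nu> (A \<inter> Y))"
      proof (rule antisym)
        show "(SUP B\<in>{B \<in> sets N. B \<subseteq> A}. ennreal (\<nu> B)) \<le> ennreal (\<nu> (A \<inter> Y))"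
        proof (rule SUP_least)
          fix B assume "B \<in> {B \<in> sets N. B \<subseteq> A}"
          then have B: "B \<in> sets N" "B \<subseteq> A" by auto
          have "\<nu> B = \<nu> (B \<inter> Y) + \<nu> (B - Y)"
            using split[of "B \<inter> Y" "B - Y"] B Y(1) by (simp add: Int_Diff_Un Int_Diff_disjoint)
          moreover have "\<nu> (B - Y) \<le> 0" using B Y(1) by (intro Y(3)) auto
          moreover have "\<nu> (A \<inter> Y) = \<nu> (B \<inter> Y) + \<nu> ((A - B) \<inter> Y)"
            using split[of "B \<inter> Y" "(A - B) \<inter> Y"] A B Y(1)
            by (simp add: Int_Un_distrib2[symmetric] Un_absorb1) blast
          moreover have "0 \<le> \<nu> ((A - B) \<inter> Y)" using A B Y(1) by (intro Y(2)) auto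
          ultimately show "ennreal (\<nu> B) \<le> ennreal (\<nu> (A \<inter> Y))" by (intro ennreal_leI) linarith
        qed
        show "ennreal (\<nu> (A \<inter> Y)) \<le> (SUP B\<in>{B \<in> sets N. B \<subseteq> A}. ennreal (\<nu> B))"
          using A Y(1) by (intro SUP_upper) auto
      qed
      then show "(SUP B\<in>{B \<in> sets N. B \<subseteq> A}. ennreal (\<nu> B)) = emeasure p A" using ep[OF A] by simp
    qed
  qed
  then have pp: "positive_variation N \<nu> = p" by (simp add: measure_of_of_measure)
  show "sets (positive_variation N \<nu>) = sets N" by (simp add: pp p_def sets)
  show "finite_measure (positive_variation N \<nu>)"
    unfolding pp using ep[of "space N"] by (intro finite_measureI) (simp add: p_def sp)
  show "measure (positive_variation N \<nu>) A = \<nu> (A \<inter> Y)" if "A \<in> sets N" for A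
    unfolding pp measure_def using ep[OF that] Y(1) Y(2)[of "A \<inter> Y"] that by simp
qed

text \<open>\<open>M1\<close> and \<open>M2\<close> may differ from the Jordan parts of \<nu>. Both
  differences agree with \<nu> on sets, which is a four-term linear relation between measures and
  therefore passes to integrals.\<close>

lemma signed_integral_difference:
  fixes f :: "'a \<Rightarrow> real"
  assumes fin: "finite_measure M1" "finite_measure M2"
    and sets: "sets M1 = sets N" "sets M2 = sets N"
    and \<nu>: "\<And>A. A \<in> sets N \<Longrightarrow> \<nu> A = measure M1 A - measure M2 A"
    and f: "f \<in> borel_measurable N" "\<And>x. 0 \<le> f x" "\<And>x. x \<in> space N \<Longrightarrow> f x \<le> K"
  shows "signed_integral N \<nu> (\<lambda>x. complex_of_real (f x))
    = of_real ((\<integral>x. f x \<partial>M1) - (\<integral>x. f x \<partial>M2))"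
proof -
  interpret M1: finite_measure M1 by fact
  interpret M2: finite_measure M2 by fact
  have sp: "space M1 = space N" "space M2 = space N"
    using sets sets_eq_imp_space_eq by blast+
  have "\<exists>Y\<in>sets M1. Y \<subseteq> space N \<and> (\<forall>X\<in>sets M1. X \<subseteq> Y \<longrightarrow> emeasure M2 X \<le> emeasure M1 X) \<and>
     (\<forall>X\<in>sets M1. X \<subseteq> space N \<longrightarrow> X \<inter> Y = {} \<longrightarrow> emeasure M1 X \<le> emeasure M2 X)"
    by (rule unsigned_Hahn_decomposition) (use sets sp in auto)
  then obtain Y where Y: "Y \<in> sets N"
    "\<And>A. A \<in> sets N \<Longrightarrow> A \<subseteq> Y \<Longrightarrow> emeasure M2 A \<le> emeasure M1 A"
    "\<And>A. A \<in> sets N \<Longrightarrow> A \<inter> Y = {} \<Longrightarrow> emeasure M1 A \<le> emeasure M2 A"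
    using sets sets.sets_into_space by metis
  have Y': "0 \<le> \<nu> A" if "A \<in> sets N" "A \<subseteq> Y" for A
    using Y(2)[OF that] that \<nu> by (simp add: M1.emeasure_eq_measure M2.emeasure_eq_measure)
  have Y'': "\<nu> A \<le> 0" if "A \<in> sets N" "A \<inter> Y = {}" for A
    using Y(3)[OF that] that \<nu> by (simp add: M1.emeasure_eq_measure M2.emeasure_eq_measure)
  have pos: "sets (positive_variation N \<nu>) = sets N" "finite_measure (positive_variation N \<nu>)"
    "\<And>A. A \<in> sets N \<Longrightarrow> measure (positive_variation N \<nu>) A = \<nu> (A \<inter> Y)"
  proof -
    note pv = positive_variation_Hahn[OF fin sets _ Y(1)]
    show "sets (positive_variation N \<nu>) = sets N"
      by (rule pv(1)) (blast intro: \<nu> Y' Y'')+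
    show "finite_measure (positive_variation N \<nu>)"
      by (rule pv(2)) (blast intro: \<nu> Y' Y'')+
    show "measure (positive_variation N \<nu>) A = \<nu> (A \<inter> Y)" if "A \<in> sets N" for A
      by (rule pv(3)) (use that in \<open>blast intro: \<nu> Y' Y''\<close>)+
  qed
  have neg: "sets (positive_variation N (\<lambda>A. - \<nu> A)) = sets N"
    "finite_measure (positive_variation N (\<lambda>A. - \<nu> A))"
    "\<And>A. A \<in> sets N \<Longrightarrow> measure (positive_variation N (\<lambda>A. - \<nu> A)) A = - \<nu> (A \<inter> (space N - Y))"
  proof -
    have 1: "- \<nu> A = measure M2 A - measure M1 A" if "A \<in> sets N" for A using \<nu>[OF that] by simp
    have 2: "0 \<le> - \<nu> A" if "A \<in> sets N" "A \<subseteq> space N - Y" for A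
      using Y''[of A] that by auto
    have 3: "- \<nu> A \<le> 0" if "A \<in> sets N" "A \<inter> (space N - Y) = {}" for A
      using Y'[of A] that sets.sets_into_space[OF that(1)] by auto
    have 4: "space N - Y \<in> sets N" using Y(1) by simp
    note pv = positive_variation_Hahn[OF fin(2,1) sets(2,1) _ 4]
    show "sets (positive_variation N (\<lambda>A. - \<nu> A)) = sets N"
      by (rule pv(1)) (blast intro: 1 2 3)+
    show "finite_measure (positive_variation N (\<lambda>A. - \<nu> A))"
      by (rule pv(2)) (blast intro: 1 2 3)+
    show "measure (positive_variation N (\<lambda>A. - \<nu> A)) A = - \<nu> (A \<inter> (space N - Y))"
      if "A \<in> sets N" for A
      by (rule pv(3)) (use that in \<open>blast intro: 1 2 3\<close>)+
  qed
  define M where "M = (!) [positive_variation N \<nu>, positive_variation N (\<lambda>A. - \<nu> A), M1, M2]"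
  define c :: "nat \<Rightarrow> complex" where "c = (!) [1, -1, -1, 1]"
  have "(\<Sum>i<4. c i * of_real (\<integral>x. f x \<partial>M i)) = 0"
  proof (rule integral_linear_relation)
    show "finite_measure (M i)" "sets (M i) = sets N" if "i \<in> {..<4}" for i
      using that pos neg fin sets
      by (auto simp: M_def eval_nat_numeral less_Suc_eq)
    show "(\<Sum>i<4. c i * of_real (measure (M i) A)) = 0" if "A \<in> sets N" for A
    proof -
      have "measure Mi A = measure Mi (A \<inter> Y) + measure Mi (A \<inter> (space N - Y))"
        if "finite_measure Mi" "sets Mi = sets N" for Mi
      proof -
        interpret finite_measure Mi by fact
        have "A = (A \<inter> Y) \<union> (A \<inter> (space N - Y))" using \<open>A \<in> sets N\<close> sets.sets_into_space by blast
        then show ?thesis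
          using finite_measure_Union[of "A \<inter> Y" "A \<inter> (space N - Y)"] that \<open>A \<in> sets N\<close> Y(1) by auto
      qed
      moreover have "A \<inter> (space N - Y) \<inter> Y = {}" "A \<inter> Y \<inter> (space N - Y) = {}" by auto
      ultimately show ?thesis
        using that pos neg Y(1) fin sets \<nu>[of "{}"] \<nu>[of "A \<inter> Y"] \<nu>[of "A \<inter> (space N - Y)"]
        by (simp add: M_def c_def eval_nat_numeral)
    qed
  qed (fact finite_lessThan f(1) f(2) f(3))+
  then show ?thesis
    by (simp add: signed_integral_def M_def c_def eval_nat_numeral algebra_simps)
qed

section \<open>Integrals against the measures of a semispectral measure\<close>

definition semi_measure ::
    "((complex ^ 'd) set \<Rightarrow> 'm::complex_hilbert \<Rightarrow> 'm) \<Rightarrow> 'm \<Rightarrow> (complex ^ 'd) measure" where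
  "semi_measure F x =
     measure_of (space sphere_borel) (sets sphere_borel) (\<lambda>A. ennreal (Re (cinner (F A x) x)))"

definition semi_integral ::
    "((complex ^ 'd) set \<Rightarrow> 'm::complex_hilbert \<Rightarrow> 'm) \<Rightarrow> (complex ^ 'd \<Rightarrow> real) \<Rightarrow> 'm \<Rightarrow> real" where
  "semi_integral F g x = (\<integral>\<zeta>. g \<zeta> \<partial>semi_measure F x)"

text \<open>A quadratic form squares the factor 1/2, which absorbs the division by 4 in the
  polarization formula.\<close>

definition polar_vec :: "nat \<Rightarrow> 'm::complex_hilbert \<Rightarrow> 'm \<Rightarrow> 'm" where
  "polar_vec k x y = (1/2) *\<^sub>C (x + (\<i> ^ k) *\<^sub>C y)"

text \<open>Polarization of the quadratic form \<open>semi_integral F g\<close>, which for a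
  semispectral \<open>F\<close> involves only finite positive measures;
  \<open>complex_measure_integral_eq\<close> identifies it with the integral against a complex
  measure.\<close>

definition semi_form ::
    "((complex ^ 'd) set \<Rightarrow> 'm::complex_hilbert \<Rightarrow> 'm) \<Rightarrow> (complex ^ 'd \<Rightarrow> real) \<Rightarrow> 'm \<Rightarrow> 'm \<Rightarrow> complex" where
  "semi_form F g x y = (\<Sum>k<4. \<i> ^ k * of_real (semi_integral F g (polar_vec k x y)))"

lemma space_sphere_borel: "space sphere_borel = sphere 0 1"
  by (simp add: sphere_borel_def space_restrict_space)

locale semispectral =
  fixes F :: "(complex ^ 'd) set \<Rightarrow> 'm::complex_hilbert \<Rightarrow> 'm"
  assumes semispectral: "semispectral_measure F"
begin

lemma F_linear:
  assumes "A \<in> sets sphere_borel"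
  shows "F A (x + y) = F A x + F A y" "F A (c *\<^sub>C x) = c *\<^sub>C F A x" "bounded_linear (F A)"
  using semispectral assms
  by (auto simp: semispectral_measure_def positive_operator_def bounded_clinear_def linear_simps)

lemma F_pos:
  assumes "A \<in> sets sphere_borel"
  shows "cinner (F A x) x = of_real (Re (cinner (F A x) x))" "0 \<le> Re (cinner (F A x) x)"
  using semispectral assms
  by (auto simp: semispectral_measure_def positive_operator_def complex_nonneg_Reals_iff complex_eq_iff)

lemma polar_F:
  assumes "A \<in> sets sphere_borel"
  shows "cinner (F A x) y
    = (\<Sum>k<4. \<i> ^ k * of_real (Re (cinner (F A (polar_vec k x y)) (polar_vec k x y))))"
proof -
  have "(\<Sum>k<4. \<i> ^ k * of_real (Re (cinner (F A (polar_vec k x y)) (polar_vec k x y))))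
    = (\<Sum>k<4. \<i> ^ k * cinner (F A (polar_vec k x y)) (polar_vec k x y))"
    by (simp flip: F_pos(1)[OF assms])
  also have "\<dots> = cinner (F A x) y"
    by (simp add: polar_vec_def eval_nat_numeral F_linear[OF assms] cinner_add_left cinner_add_right
        cinner_scaleC_left cinner_scaleC_right algebra_simps)
  finally show ?thesis ..
qed

lemma semi_measure:
  shows "sets (semi_measure F x) = sets sphere_borel"
    and "finite_measure (semi_measure F x)"
    and "\<And>A. A \<in> sets sphere_borel \<Longrightarrow> measure (semi_measure F x) A = Re (cinner (F A x) x)"
proof -
  let ?\<nu> = "\<lambda>A. Re (cinner (F A x) x)"
  have "complex_measure sphere_borel (\<lambda>A. cinner (F A x) x)"
    using semispectral by (simp add: semispectral_measure_def)
  then have sums: "(\<lambda>n. ?\<nu> (A n)) sums ?\<nu> (\<Union>n. A n)"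
    if "range A \<subseteq> sets sphere_borel" "disjoint_family A" for A :: "nat \<Rightarrow> _"
    using that sums_Re unfolding complex_measure_def by blast
  \<comment> \<open>The constant sequence of empty sets is disjoint; convergence of its series
    forces the constant value to be 0.\<close>
  have "(\<lambda>n::nat. ?\<nu> {}) sums ?\<nu> {}"
    using sums[of "\<lambda>_. {}"] by (simp add: disjoint_family_on_def)
  from summable_LIMSEQ_zero[OF sums_summable[OF this]] have "?\<nu> {} = 0"
    by (simp add: LIMSEQ_const_iff)
  have em: "emeasure (semi_measure F x) A = ennreal (?\<nu> A)" if "A \<in> sets sphere_borel" for A
    unfolding semi_measure_def
  proof (rule emeasure_measure_of_sigma)
    show "positive (sets sphere_borel) (\<lambda>A. ennreal (?\<nu> A))"
      using \<open>?\<nu> {} = 0\<close> by (simp add: positive_def)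
    show "countably_additive (sets sphere_borel) (\<lambda>A. ennreal (?\<nu> A))"
    proof (rule countably_additiveI)
      fix A :: "nat \<Rightarrow> (complex ^ 'd) set"
      assume A: "range A \<subseteq> sets sphere_borel" "disjoint_family A" "(\<Union>i. A i) \<in> sets sphere_borel"
      have "(\<lambda>n. ennreal (?\<nu> (A n))) sums ennreal (?\<nu> (\<Union>n. A n))"
        using sums[OF A(1,2)] A F_pos(2) by (intro sums_ennreal[THEN iffD2]) auto
      then show "(\<Sum>i. ennreal (?\<nu> (A i))) = ennreal (?\<nu> (\<Union>i. A i))" by (rule sums_unique[symmetric])
    qed
  qed (use that in \<open>auto intro: sets.sigma_algebra_axioms\<close>)
  show "sets (semi_measure F x) = sets sphere_borel"
    by (simp add: semi_measure_def sets.space_closed sets.sigma_sets_eq)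
  have "space (semi_measure F x) = space sphere_borel"
    by (simp add: semi_measure_def)
  then show "finite_measure (semi_measure F x)"
    by (intro finite_measureI) (simp add: em)
  show "measure (semi_measure F x) A = Re (cinner (F A x) x)" if "A \<in> sets sphere_borel" for A
    using em[OF that] F_pos(2)[OF that, of x] by (simp add: measure_def)
qed

lemma space_semi_measure: "space (semi_measure F x) = sphere 0 1"
  using sets_eq_imp_space_eq[OF semi_measure(1)] space_sphere_borel by blast

definition total :: real where "total = onorm (F (sphere 0 1))"

lemma sphere_in_sets: "sphere 0 1 \<in> sets sphere_borel"
  using sets.top[of sphere_borel] by (simp add: space_sphere_borel)

lemma total_nonneg: "0 \<le> total"
  unfolding total_def by (rule onorm_pos_le[OF F_linear(3)[OF sphere_in_sets]])

lemma measure_semi_measure_le: "measure (semi_measure F x) (sphere 0 1) \<le> total * (norm x)\<^sup>2"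
proof -
  have "measure (semi_measure F x) (sphere 0 1) \<le> norm (F (sphere 0 1) x) * norm x"
    using semi_measure(3)[OF sphere_in_sets, of x] cinner_cauchy_schwarz[of "F (sphere 0 1) x" x]
      complex_Re_le_cmod[of "cinner (F (sphere 0 1) x) x"] by linarith
  also have "\<dots> \<le> (total * norm x) * norm x"
    unfolding total_def by (intro mult_right_mono onorm[OF F_linear(3)[OF sphere_in_sets]]) simp
  finally show ?thesis by (simp add: power2_eq_square mult_ac)
qed

context
  fixes g :: "complex ^ 'd \<Rightarrow> real" and K :: real
  assumes g: "g \<in> borel_measurable sphere_borel" "\<And>\<zeta>. 0 \<le> g \<zeta>" "\<And>\<zeta>. \<zeta> \<in> sphere 0 1 \<Longrightarrow> g \<zeta> \<le> K"
begin

lemma semi_integral_relation: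
  assumes "finite I"
    and "\<And>A. A \<in> sets sphere_borel \<Longrightarrow> (\<Sum>i\<in>I. c i * cinner (F A (v i)) (v i)) = 0"
  shows "(\<Sum>i\<in>I. c i * of_real (semi_integral F g (v i))) = 0"
  unfolding semi_integral_def
proof (rule integral_linear_relation[OF assms(1) semi_measure(2,1)])
  show "(\<Sum>i\<in>I. c i * of_real (measure (semi_measure F (v i)) A)) = 0" if "A \<in> sets sphere_borel" for A
    using assms(2)[OF that] F_pos(1)[OF that, symmetric] by (simp add: semi_measure(3)[OF that])
qed (use g in \<open>auto simp: space_sphere_borel\<close>)

lemma semi_integral_nonneg: "0 \<le> semi_integral F g x"
  unfolding semi_integral_def using g by simp

lemma semi_integral_le: "semi_integral F g x \<le> K * total * (norm x)\<^sup>2"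
proof -
  interpret finite_measure "semi_measure F x" by (rule semi_measure(2))
  obtain \<zeta> :: "complex ^ 'd" where "\<zeta> \<in> sphere 0 1" by (metis vector_choose_size zero_le_one mem_sphere_0)
  then have K: "0 \<le> K" using g(2,3)[of \<zeta>] by linarith
  have gm: "g \<in> borel_measurable (semi_measure F x)"
    using g(1) semi_measure(1) by (simp cong: measurable_cong_sets)
  have "semi_integral F g x \<le> (\<integral>\<zeta>. K \<partial>semi_measure F x)"
    unfolding semi_integral_def
  proof (rule integral_mono_AE)
    show "integrable (semi_measure F x) g"
      by (rule integrable_const_bound[of _ K]) (use g gm in \<open>auto simp: space_semi_measure\<close>)
    show "AE \<zeta> in semi_measure F x. g \<zeta> \<le> K"
      by (rule AE_I2) (use g(3) in \<open>simp add: space_semi_measure\<close>)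
  qed simp
  also have "\<dots> \<le> K * (total * (norm x)\<^sup>2)"
    using mult_right_mono[OF measure_semi_measure_le[of x] K] by (simp add: space_semi_measure mult.commute)
  finally show ?thesis by (simp add: mult.assoc)
qed

text \<open>Polarization turns a relation between values of \<open>F\<close> into one between
  quadratic forms, which passes to integrals. The sesquilinearity lemmas are its instances with two
  or three terms, written with list indexing.\<close>

lemma semi_form_relation:
  assumes "finite J"
    and "\<And>A. A \<in> sets sphere_borel \<Longrightarrow> (\<Sum>j\<in>J. s j * cinner (F A (x j)) (y j)) = 0"
  shows "(\<Sum>j\<in>J. s j * semi_form F g (x j) (y j)) = 0"
proof -
  have "(\<Sum>(j,k)\<in>J \<times> {..<4}. (s j * \<i> ^ k) * of_real (semi_integral F g (polar_vec k (x j) (y j)))) = 0"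
    unfolding case_prod_beta
  proof (rule semi_integral_relation)
    fix A assume A: "A \<in> sets (sphere_borel :: (complex ^ 'd) measure)"
    have "(\<Sum>p\<in>J \<times> {..<4}. s (fst p) * \<i> ^ snd p
        * cinner (F A (polar_vec (snd p) (x (fst p)) (y (fst p)))) (polar_vec (snd p) (x (fst p)) (y (fst p))))
      = (\<Sum>j\<in>J. s j * cinner (F A (x j)) (y j))"
      by (subst polar_F[OF A])
        (simp add: sum.cartesian_product' sum_distrib_left mult.assoc F_pos(1)[OF A, symmetric])
    with assms(2)[OF A] show "(\<Sum>p\<in>J \<times> {..<4}. s (fst p) * \<i> ^ snd p
        * cinner (F A (polar_vec (snd p) (x (fst p)) (y (fst p)))) (polar_vec (snd p) (x (fst p)) (y (fst p)))) = 0"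
      by simp
  qed (use assms in simp)
  then show ?thesis
    by (simp add: semi_form_def sum_distrib_left mult.assoc sum.cartesian_product)
qed

lemma semi_form_add_left: "semi_form F g (x + x') y = semi_form F g x y + semi_form F g x' y"
  using semi_form_relation[of "{..<3::nat}" "(!) [1, -1, -1]" "(!) [x + x', x, x']" "\<lambda>_. y"]
  by (simp add: eval_nat_numeral F_linear cinner_add_left diff_eq_eq add.commute)

lemma semi_form_add_right: "semi_form F g x (y + y') = semi_form F g x y + semi_form F g x y'"
  using semi_form_relation[of "{..<3::nat}" "(!) [1, -1, -1]" "\<lambda>_. x" "(!) [y + y', y, y']"]
  by (simp add: eval_nat_numeral cinner_add_right diff_eq_eq add.commute)

lemma semi_form_scale_left: "semi_form F g (c *\<^sub>C x) y = c * semi_form F g x y"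
  using semi_form_relation[of "{..<2::nat}" "(!) [1, -c]" "(!) [c *\<^sub>C x, x]" "\<lambda>_. y"]
  by (simp add: eval_nat_numeral F_linear cinner_scaleC_left)

lemma semi_form_scale_right: "semi_form F g x (c *\<^sub>C y) = cnj c * semi_form F g x y"
  using semi_form_relation[of "{..<2::nat}" "(!) [1, - cnj c]" "\<lambda>_. x" "(!) [c *\<^sub>C y, y]"]
  by (simp add: eval_nat_numeral cinner_scaleC_right)

lemma semi_form_diff_left: "semi_form F g (x - x') y = semi_form F g x y - semi_form F g x' y"
  using semi_form_add_left[of "x - x'" x' y] by simp

lemma semi_form_diff_right: "semi_form F g x (y - y') = semi_form F g x y - semi_form F g x y'"
  using semi_form_add_right[of x "y - y'" y'] by simp

text \<open>A five-term relation: the indices 0 to 3 are the polarization of \<open>x\<close> with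
  itself, the index 4 is the form at \<open>x\<close> with coefficient -1.\<close>

lemma semi_form_self: "semi_form F g x x = of_real (semi_integral F g x)"
proof -
  have "(\<Sum>k<5. (if k < 4 then \<i> ^ k else - 1) * of_real (semi_integral F g (if k < 4 then polar_vec k x x else x))) = 0"
  proof (rule semi_integral_relation)
    fix A assume A: "A \<in> sets (sphere_borel :: (complex ^ 'd) measure)"
    show "(\<Sum>k<5. (if k < 4 then \<i> ^ k else - 1)
        * cinner (F A (if k < 4 then polar_vec k x x else x)) (if k < 4 then polar_vec k x x else x)) = 0"
      using polar_F[OF A, of x x]
      by (simp add: eval_nat_numeral F_pos(1)[OF A, symmetric])
  qed simp
  then show ?thesis by (simp add: semi_form_def eval_nat_numeral)
qed

text \<open>The mixed terms cancel over the four powers of \<open>\<i>\<close>, as in the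
  parallelogram law.\<close>

lemma sum_semi_integral_polar:
  "(\<Sum>k<4. semi_integral F g (polar_vec k x y)) = semi_integral F g x + semi_integral F g y"
proof -
  have "complex_of_real (\<Sum>k<4. semi_integral F g (polar_vec k x y))
     = of_real (semi_integral F g x + semi_integral F g y)"
    by (simp add: eval_nat_numeral semi_form_self[symmetric] polar_vec_def semi_form_add_left
        semi_form_add_right semi_form_diff_left semi_form_diff_right semi_form_scale_left semi_form_scale_right algebra_simps)
  then show ?thesis by (simp only: of_real_eq_iff)
qed

text \<open>Estimating the four polarization terms separately gives a weak form of the
  Cauchy-Schwarz inequality. It suffices for integrability and, after normalization, for a bound by
  the product of the norms.\<close>

lemma semi_form_le: "cmod (semi_form F g x y) \<le> semi_integral F g x + semi_integral F g y"
proof -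
  have "cmod (semi_form F g x y) \<le> (\<Sum>k<4. cmod (\<i> ^ k * of_real (semi_integral F g (polar_vec k x y))))"
    unfolding semi_form_def by (rule norm_sum)
  also have "\<dots> = (\<Sum>k<4. semi_integral F g (polar_vec k x y))"
    by (simp add: norm_mult norm_power semi_integral_nonneg)
  finally show ?thesis by (simp add: sum_semi_integral_polar)
qed

text \<open>Normalizing \<open>x\<close> and \<open>y\<close> turns the additive estimate into a
  multiplicative one; the factor 2 counts the two unit vectors.\<close>

lemma semi_form_bound: "cmod (semi_form F g x y) \<le> 2 * K * total * norm x * norm y"
proof (cases "x = 0 \<or> y = 0")
  case True
  then show ?thesis
    using semi_form_scale_left[of 0 x y] semi_form_scale_right[of x 0 y]
      scaleR_scaleC[of 0 x] scaleR_scaleC[of 0 y] by auto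
next
  case False
  define x' where "x' = (1 / of_real (norm x)) *\<^sub>C x"
  define y' where "y' = (1 / of_real (norm y)) *\<^sub>C y"
  have n: "norm x' = 1" "norm y' = 1" using False by (simp_all add: x'_def y'_def norm_scaleC norm_divide)
  have xy: "x = of_real (norm x) *\<^sub>C x'" "y = of_real (norm y) *\<^sub>C y'"
    using False by (simp_all add: x'_def y'_def scaleC_scaleC)
  have "semi_form F g x y = of_real (norm x) * of_real (norm y) * semi_form F g x' y'"
    by (subst xy(1), subst xy(2)) (simp add: semi_form_scale_left semi_form_scale_right)
  moreover have "cmod (semi_form F g x' y') \<le> 2 * K * total"
    using semi_form_le[of x' y'] semi_integral_le[of x'] semi_integral_le[of y'] n by simp
  ultimately show ?thesis
    using mult_left_mono[of "cmod (semi_form F g x' y')" "2 * K * total" "norm x * norm y"]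
    by (simp add: norm_mult mult_ac)
qed

text \<open>In the polarization formula the even powers of \<open>\<i>\<close> make up the real part
  and the odd ones the imaginary part, so each part is a difference of two positive measures of the
  form \<open>semi_measure F v\<close>.\<close>

lemma complex_measure_integral_eq:
  "complex_measure_integral sphere_borel (\<lambda>A. cinner (F A x) y) (\<lambda>\<zeta>. of_real (g \<zeta>)) = semi_form F g x y"
proof -
  have *: "signed_integral sphere_borel \<nu> (\<lambda>\<zeta>. complex_of_real (g \<zeta>))
      = of_real (semi_integral F g v - semi_integral F g w)"
    if "\<And>A. A \<in> sets sphere_borel \<Longrightarrow> \<nu> A = Re (cinner (F A v) v) - Re (cinner (F A w) w)" for \<nu> v w
    unfolding semi_integral_def
    by (rule signed_integral_difference)
      (use g in \<open>auto simp: semi_measure that space_sphere_borel\<close>)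
  have re: "signed_integral sphere_borel (\<lambda>A. Re (cinner (F A x) y)) (\<lambda>\<zeta>. complex_of_real (g \<zeta>))
      = of_real (semi_integral F g (polar_vec 0 x y) - semi_integral F g (polar_vec 2 x y))"
    by (rule *) (subst polar_F, auto simp: eval_nat_numeral)
  have im: "signed_integral sphere_borel (\<lambda>A. Im (cinner (F A x) y)) (\<lambda>\<zeta>. complex_of_real (g \<zeta>))
      = of_real (semi_integral F g (polar_vec 1 x y) - semi_integral F g (polar_vec 3 x y))"
    by (rule *) (subst polar_F, auto simp: eval_nat_numeral)
  show ?thesis
    unfolding complex_measure_integral_def re im semi_form_def
    by (simp add: eval_nat_numeral algebra_simps)
qed

text \<open>Riesz in the second argument, applied to the conjugate because \<open>semi_form\<close>
  is conjugate-linear there, gives \<open>T x\<close>, and the bound on the form makes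
  \<open>T\<close> bounded. This justifies the definite description in
  \<open>poisson_integral\<close>.\<close>

lemma ex1_operator:
  "\<exists>!T. bounded_clinear T \<and> (\<forall>x y. cinner (T x) y =
      complex_measure_integral sphere_borel (\<lambda>A. cinner (F A x) y) (\<lambda>\<zeta>. of_real (g \<zeta>)))"
  unfolding complex_measure_integral_eq
proof (rule ex_ex1I)
  have "\<exists>w. \<forall>y. cinner w y = semi_form F g x y" for x
  proof -
    obtain w where "\<And>y. cnj (semi_form F g x y) = cinner y w"
    proof (rule hilbert.riesz[of "\<lambda>y. cnj (semi_form F g x y)" "2 * K * total * norm x"])
    qed (auto simp: semi_form_add_right semi_form_scale_right semi_form_bound)
    then show ?thesis by (metis cinner_commute complex_cnj_cnj)
  qed
  then obtain T where T: "\<And>x y. cinner (T x) y = semi_form F g x y" by metis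
  have "bounded_linear T"
  proof
    show "T (x + y) = T x + T y" for x y
      by (rule cinner_eqI) (simp add: T cinner_add_left semi_form_add_left)
    show "T (r *\<^sub>R x) = r *\<^sub>R T x" for r x
      by (rule cinner_eqI) (simp add: T scaleR_scaleC[where 'a='m] cinner_scaleC_left semi_form_scale_left)
    have "norm (T x) \<le> norm x * (2 * K * total)" for x
    proof (cases "T x = 0")
      case True
      have "0 \<le> (K * total) * (norm x)\<^sup>2" using semi_integral_nonneg[of x] semi_integral_le[of x] by linarith
      then have "x \<noteq> 0 \<Longrightarrow> 0 \<le> K * total" by (simp add: zero_le_mult_iff)
      then show ?thesis using True by (cases "x = 0") simp_all
    next
      case False
      have "(norm (T x))\<^sup>2 = cmod (cinner (T x) (T x))" by (simp add: cinner_self norm_power)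
      also have "\<dots> \<le> (2 * K * total * norm x) * norm (T x)"
        unfolding T by (rule semi_form_bound)
      finally show ?thesis using False by (simp add: power2_eq_square mult_ac)
    qed
    then show "\<exists>K. \<forall>x. norm (T x) \<le> norm x * K" by blast
  qed
  moreover have "T (c *\<^sub>C x) = c *\<^sub>C T x" for c x
    by (rule cinner_eqI) (simp add: T cinner_scaleC_left semi_form_scale_left)
  ultimately show "\<exists>T. bounded_clinear T \<and> (\<forall>x y. cinner (T x) y = semi_form F g x y)"
    using T unfolding bounded_clinear_def by blast
next
  fix S T assume "bounded_clinear S \<and> (\<forall>x y. cinner (S x) y = semi_form F g x y)"
    "bounded_clinear T \<and> (\<forall>x y. cinner (T x) y = semi_form F g x y)"
  then show "S = T" by (intro ext) (rule cinner_eqI, simp)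
qed

end

section \<open>The Poisson kernel and the Poisson integral\<close>

lemma poisson_kernel_nonneg: "norm z < 1 \<Longrightarrow> 0 \<le> poisson_kernel z \<zeta>"
  unfolding poisson_kernel_def
  by (intro divide_nonneg_nonneg) (auto intro: power_le_one)

text \<open>A point of norm at most \<open>r\<close> has distance at least 1 - r from the sphere,
  and the numerator is at most 1.\<close>

lemma poisson_kernel_le:
  fixes z \<zeta> :: "complex ^ 'd"
  assumes "norm z \<le> r" "r < 1" "\<zeta> \<in> sphere 0 1"
  shows "poisson_kernel z \<zeta> \<le> 1 / (1 - r) ^ (2 * CARD('d))"
proof -
  have "1 - r \<le> norm (z - \<zeta>)" using norm_triangle_ineq3[of z \<zeta>] assms by simp
  then have "(1 - r) ^ (2 * CARD('d)) \<le> norm (z - \<zeta>) ^ (2 * CARD('d))"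
    using assms by (intro power_mono) auto
  then show ?thesis
    unfolding poisson_kernel_def using assms norm_ge_zero[of z]
    by (intro frac_le) auto
qed

lemma poisson_kernel_measurable: "poisson_kernel z \<in> borel_measurable sphere_borel"
  unfolding poisson_kernel_def[abs_def] sphere_borel_def by (intro measurable_restrict_space1) measurable

definition U :: "complex ^ 'd \<Rightarrow> 'm \<Rightarrow> real" where
  "U z = semi_integral F (poisson_kernel z)"

text \<open>The constant of \<open>semi_form_bound\<close> for the Poisson kernel at points of norm
  at most \<open>r\<close>.\<close>

definition K :: "real \<Rightarrow> real" where "K r = 2 * (1 / (1 - r) ^ (2 * CARD('d))) * total"

context
  fixes z :: "complex ^ 'd"
  assumes z: "norm z < 1"
begin

lemmas kernel_facts = poisson_kernel_measurable[of z] poisson_kernel_nonneg[OF z]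
  poisson_kernel_le[OF order_refl z]

lemma poisson_integral:
  "bounded_clinear (poisson_integral F z)"
  "cinner (poisson_integral F z x) y = semi_form F (poisson_kernel z) x y"
proof -
  have "bounded_clinear (poisson_integral F z) \<and> (\<forall>x y. cinner (poisson_integral F z x) y =
      complex_measure_integral sphere_borel (\<lambda>A. cinner (F A x) y)
        (\<lambda>\<zeta>. complex_of_real (poisson_kernel z \<zeta>)))"
  proof -
    define P where "P = (\<lambda>T. bounded_clinear T \<and> (\<forall>x y. cinner (T x) y =
      complex_measure_integral sphere_borel (\<lambda>A. cinner (F A x) y)
        (\<lambda>\<zeta>. complex_of_real (poisson_kernel z \<zeta>))))"
    have "\<exists>!T. P T" unfolding P_def by (rule ex1_operator[OF kernel_facts])
    then have "P (THE T. P T)" by (rule theI')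
    then show ?thesis unfolding P_def poisson_integral_def .
  qed
  moreover have "complex_measure_integral sphere_borel (\<lambda>A. cinner (F A x) y)
        (\<lambda>\<zeta>. complex_of_real (poisson_kernel z \<zeta>)) = semi_form F (poisson_kernel z) x y"
    by (rule complex_measure_integral_eq[OF kernel_facts])
  ultimately show "bounded_clinear (poisson_integral F z)"
    "cinner (poisson_integral F z x) y = semi_form F (poisson_kernel z) x y" by simp_all
qed

lemma poisson_integral_self: "cinner (poisson_integral F z x) x = of_real (U z x)"
  unfolding poisson_integral(2) U_def by (rule semi_form_self[OF kernel_facts])

lemma U_nonneg: "0 \<le> U z x"
  unfolding U_def by (rule semi_integral_nonneg[OF kernel_facts])

lemma poisson_integral_le: "cmod (cinner (poisson_integral F z x) y) \<le> U z x + U z y"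
  unfolding poisson_integral(2) U_def by (rule semi_form_le[OF kernel_facts])

lemma poisson_integral_bound:
  assumes "norm z \<le> r" "r < 1"
  shows "cmod (cinner (poisson_integral F z x) y) \<le> K r * norm x * norm y"
  unfolding poisson_integral(2) K_def
  by (rule semi_form_bound[OF kernel_facts(1,2) poisson_kernel_le[OF assms]])

end

end

section \<open>Power series on the ball\<close>

lemma nonneg_summable_on_le:
  fixes f g :: "'a \<Rightarrow> real"
  assumes "g summable_on A" "\<And>x. x \<in> A \<Longrightarrow> 0 \<le> f x" "\<And>x. x \<in> A \<Longrightarrow> f x \<le> g x"
  shows "f summable_on A"
proof -
  have "(\<lambda>x. norm (g x)) summable_on A"
    by (rule iffD1[OF summable_on_iff_abs_summable_on_real assms(1)])
  then have "(\<lambda>x. norm (f x)) summable_on A"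
  proof (rule Infinite_Sum.abs_summable_on_comparison_test)
    show "norm (f x) \<le> norm (g x)" if "x \<in> A" for x
      using assms(2,3)[OF that] by simp
  qed
  then show ?thesis by (rule iffD2[OF summable_on_iff_abs_summable_on_real])
qed

section \<open>Multi-indices and monomials\<close>

definition mdeg :: "('d::finite \<Rightarrow> nat) \<Rightarrow> nat" where "mdeg \<alpha> = (\<Sum>j\<in>UNIV. \<alpha> j)"

definition inc :: "'d \<Rightarrow> ('d \<Rightarrow> nat) \<Rightarrow> 'd \<Rightarrow> nat" where "inc k \<alpha> = \<alpha>(k := Suc (\<alpha> k))"

definition dec :: "'d \<Rightarrow> ('d \<Rightarrow> nat) \<Rightarrow> 'd \<Rightarrow> nat" where "dec k \<alpha> = \<alpha>(k := \<alpha> k - 1)"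

definition zpow :: "complex ^ 'd \<Rightarrow> ('d \<Rightarrow> nat) \<Rightarrow> complex" where
  "zpow z \<alpha> = (\<Prod>j\<in>UNIV. (z $ j) ^ \<alpha> j)"

text \<open>The partial derivative of the monomial in the \<open>k\<close>-th variable. If
  \<open>\<alpha> k = 0\<close>, the truncated subtraction in \<open>dec\<close> does no harm since
  the factor in front is 0.\<close>

definition dzpow :: "'d \<Rightarrow> complex ^ 'd \<Rightarrow> ('d \<Rightarrow> nat) \<Rightarrow> complex" where
  "dzpow k z \<alpha> = of_nat (\<alpha> k) * zpow z (dec k \<alpha>)"

lemma dec_inc [simp]: "dec k (inc k \<alpha>) = \<alpha>" by (auto simp: dec_def inc_def)

lemma inc_dec: "\<alpha> k > 0 \<Longrightarrow> inc k (dec k \<alpha>) = \<alpha>" by (auto simp: dec_def inc_def)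

lemma inj_inc: "inj (inc k)" by (metis dec_inc injI)

lemma range_inc: "range (inc k) = {\<alpha>. \<alpha> k > 0}"
  by (auto simp: inc_def image_iff) (metis inc_def inc_dec)

lemma prod_split: "(\<Prod>j\<in>UNIV. f j) = f (k::'d::finite) * (\<Prod>j\<in>UNIV - {k}. f j)"
  by (rule prod.remove) auto

lemma sum_split: "(\<Sum>j\<in>UNIV. f j) = f (k::'d::finite) + (\<Sum>j\<in>UNIV - {k}. f j)"
  by (rule sum.remove) auto

lemma zpow_split: "zpow z \<alpha> = (z $ k) ^ \<alpha> k * (\<Prod>j\<in>UNIV - {k}. (z $ j) ^ \<alpha> j)"
  unfolding zpow_def by (rule prod_split)

lemma zpow_inc: "zpow z (inc k \<alpha>) = z $ k * zpow z \<alpha>"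
proof -
  have "(\<Prod>j\<in>UNIV - {k}. z $ j ^ inc k \<alpha> j) = (\<Prod>j\<in>UNIV - {k}. z $ j ^ \<alpha> j)"
    by (rule prod.cong) (auto simp: inc_def)
  then show ?thesis by (simp add: zpow_split[of z _ k]) (simp add: inc_def)
qed

lemma mdeg_inc: "mdeg (inc k \<alpha>) = Suc (mdeg \<alpha>)"
proof -
  have "(\<Sum>j\<in>UNIV - {k}. inc k \<alpha> j) = (\<Sum>j\<in>UNIV - {k}. \<alpha> j)"
    by (rule sum.cong) (auto simp: inc_def)
  then show ?thesis by (simp add: mdeg_def sum_split[of _ k]) (simp add: inc_def)
qed

lemma mdeg_eq_0_iff: "mdeg \<alpha> = 0 \<longleftrightarrow> \<alpha> = (\<lambda>_. 0)"
  by (auto simp: mdeg_def)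

lemma norm_zpow: "norm (zpow z \<alpha>) = (\<Prod>j\<in>UNIV. norm (z $ j) ^ \<alpha> j)"
  by (simp add: zpow_def prod_norm norm_power flip: prod_norm)

lemma norm_zpow_mono:
  assumes "\<And>j. norm (z $ j) \<le> norm (w $ j)"
  shows "norm (zpow z \<alpha>) \<le> norm (zpow w \<alpha>)"
  unfolding norm_zpow by (intro prod_mono) (auto intro: power_mono assms)

lemma zpow_scaleR: "zpow (t *\<^sub>R z) \<alpha> = of_real t ^ mdeg \<alpha> * zpow z \<alpha>"
  by (simp add: zpow_def mdeg_def prod.distrib power_mult_distrib scaleR_conv_of_real[where 'a = complex] power_sum)

lemma finite_mdeg_le: "finite {\<alpha> :: 'd::finite \<Rightarrow> nat. mdeg \<alpha> \<le> n}"
proof (rule finite_subset)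
  show "{\<alpha> :: 'd \<Rightarrow> nat. mdeg \<alpha> \<le> n} \<subseteq> PiE UNIV (\<lambda>_. {..n})"
  proof
    fix \<alpha> :: "'d \<Rightarrow> nat" assume "\<alpha> \<in> {\<alpha>. mdeg \<alpha> \<le> n}"
    then have "\<alpha> j \<le> n" for j
      using member_le_sum[of j UNIV \<alpha>] by (simp add: mdeg_def)
    then show "\<alpha> \<in> PiE UNIV (\<lambda>_. {..n})" by auto
  qed
qed (simp add: finite_PiE)

text \<open>The sets of multi-indices of bounded degree are cofinal among the finite sets. They turn
  unordered sums into sequences, as termwise differentiation and dominated convergence
  require.\<close>

lemma filterlim_mdeg_le:
  "filterlim (\<lambda>n. {\<alpha> :: 'd::finite \<Rightarrow> nat. mdeg \<alpha> \<le> n}) (finite_subsets_at_top UNIV) sequentially"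
  unfolding filterlim_finite_subsets_at_top
proof (intro allI impI)
  fix X :: "('d \<Rightarrow> nat) set" assume X: "finite X \<and> X \<subseteq> UNIV"
  show "\<forall>\<^sub>F n in sequentially. finite {\<alpha> :: 'd \<Rightarrow> nat. mdeg \<alpha> \<le> n} \<and> X \<subseteq> {\<alpha>. mdeg \<alpha> \<le> n} \<and> {\<alpha>. mdeg \<alpha> \<le> n} \<subseteq> UNIV"
    using eventually_ge_at_top[of "\<Sum>\<alpha>\<in>X. mdeg \<alpha>"]
  proof eventually_elim
    case (elim n)
    have "mdeg \<alpha> \<le> n" if "\<alpha> \<in> X" for \<alpha>
      using member_le_sum[of \<alpha> X mdeg] that X elim by simp
    then show ?case using finite_mdeg_le by auto
  qed
qed

lemma has_sum_mdeg_tendsto: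
  fixes f :: "('d::finite \<Rightarrow> nat) \<Rightarrow> 'a::{comm_monoid_add, topological_space}"
  assumes "(f has_sum S) UNIV"
  shows "(\<lambda>n. \<Sum>\<alpha> | mdeg \<alpha> \<le> n. f \<alpha>) \<longlonglongrightarrow> S"
  using filterlim_compose[OF assms[unfolded has_sum_def] filterlim_mdeg_le] .

text \<open>A finite set of multi-indices lies in a cube, over which the sum factors into one
  geometric sum per variable.\<close>

lemma geometric_summable:
  fixes x :: real
  assumes x: "0 \<le> x" "x < 1"
  shows "(\<lambda>\<alpha>::'d::finite \<Rightarrow> nat. x ^ mdeg \<alpha>) summable_on UNIV"
proof (rule nonneg_bdd_above_summable_on)
  show "bdd_above (sum (\<lambda>\<alpha>::'d \<Rightarrow> nat. x ^ mdeg \<alpha>) ` {F. F \<subseteq> UNIV \<and> finite F})"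
  proof (rule bdd_aboveI2)
    fix F :: "('d \<Rightarrow> nat) set" assume "F \<in> {F. F \<subseteq> UNIV \<and> finite F}"
    then have F: "finite F" by simp
    define n where "n = (\<Sum>\<alpha>\<in>F. mdeg \<alpha>)"
    have "F \<subseteq> PiE UNIV (\<lambda>_. {..n})"
    proof
      fix \<alpha> assume \<alpha>: "\<alpha> \<in> F"
      have "\<alpha> j \<le> n" for j
        using member_le_sum[of \<alpha> F mdeg] member_le_sum[of j UNIV \<alpha>] F \<alpha>
        by (simp add: n_def mdeg_def)
      then show "\<alpha> \<in> PiE UNIV (\<lambda>_. {..n})" by auto
    qed
    then have "(\<Sum>\<alpha>\<in>F. x ^ mdeg \<alpha>) \<le> (\<Sum>\<alpha>\<in>PiE (UNIV::'d set) (\<lambda>_. {..n}). x ^ mdeg \<alpha>)"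
      by (rule sum_mono2[rotated]) (use x in \<open>auto intro: finite_PiE\<close>)
    also have "\<dots> = (\<Prod>j\<in>(UNIV::'d set). \<Sum>i\<le>n. x ^ i)"
      by (subst prod_sum_PiE) (simp_all add: mdeg_def power_sum)
    also have "\<dots> \<le> (\<Prod>j\<in>(UNIV::'d set). 1 / (1 - x))"
    proof (intro prod_mono conjI)
      show "(\<Sum>i\<le>n. x ^ i) \<le> 1 / (1 - x)"
        using x by (simp add: sum_gp0 divide_right_mono)
    qed (use x in \<open>auto intro: sum_nonneg\<close>)
    finally show "(\<Sum>\<alpha>\<in>F. x ^ mdeg \<alpha>) \<le> (\<Prod>j\<in>(UNIV::'d set). 1 / (1 - x))" .
  qed
qed (use x in auto)

text \<open>A term outside the finite set \<open>X\<close> is the difference of two partial sums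
  within distance 1 of the limit. Absolute convergence is avoided here, since unordered summability
  does not imply it in infinite-dimensional spaces.\<close>

lemma has_sum_bounded_terms:
  fixes f :: "'a \<Rightarrow> 'b::real_normed_vector"
  assumes "(f has_sum S) A"
  obtains C where "\<And>x. x \<in> A \<Longrightarrow> norm (f x) \<le> C"
proof -
  have "\<forall>\<^sub>F Y in finite_subsets_at_top A. dist (sum f Y) S < 1"
    using assms unfolding has_sum_def by (intro tendstoD) auto
  then obtain X where X: "finite X" "X \<subseteq> A"
    "\<forall>Y. finite Y \<and> X \<subseteq> Y \<and> Y \<subseteq> A \<longrightarrow> dist (sum f Y) S < 1"
    by (auto simp: eventually_finite_subsets_at_top)
  have "norm (f x) \<le> 2 + (\<Sum>y\<in>X. norm (f y))" if x: "x \<in> A" for x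
  proof (cases "x \<in> X")
    case True
    then show ?thesis using member_le_sum[of x X "\<lambda>y. norm (f y)"] X(1) by simp
  next
    case False
    have "f x = sum f (insert x X) - sum f X" using False X(1) by simp
    also have "norm \<dots> \<le> dist (sum f (insert x X)) S + dist (sum f X) S"
      by (metis dist_norm dist_triangle2)
    also have "\<dots> < 2" using X(3)[rule_format, of "insert x X"] X(3)[rule_format, of X] X(1,2) x subset_insertI[of X x] by auto
    finally show ?thesis using sum_nonneg[of X "\<lambda>y. norm (f y)"] by simp
  qed
  then show ?thesis using that by blast
qed

text \<open>Stated with norms, since at a single point unordered convergence of vectors is weaker.
  On the open ball as a whole the two notions agree, by \<open>power_series_abs_conv\<close> and
  \<open>abs_conv_power_series\<close>.\<close>

definition abs_conv :: "(('d::finite \<Rightarrow> nat) \<Rightarrow> 'm::complex_hilbert) \<Rightarrow> bool" where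
  "abs_conv a \<longleftrightarrow> (\<forall>z::complex ^ 'd. norm z < 1 \<longrightarrow> (\<lambda>\<alpha>. norm (zpow z \<alpha>) * norm (a \<alpha>)) summable_on UNIV)"

definition psum :: "(('d \<Rightarrow> nat) \<Rightarrow> 'm::complex_hilbert) \<Rightarrow> complex ^ 'd \<Rightarrow> 'm" where
  "psum a z = (\<Sum>\<^sub>\<infinity>\<alpha>. zpow z \<alpha> *\<^sub>C a \<alpha>)"

text \<open>The coefficients of the series differentiated in the \<open>k\<close>-th variable,
  reindexed as a power series.\<close>

definition dcoef :: "'d \<Rightarrow> (('d \<Rightarrow> nat) \<Rightarrow> 'm::complex_hilbert) \<Rightarrow> ('d \<Rightarrow> nat) \<Rightarrow> 'm" where
  "dcoef k a \<alpha> = of_nat (Suc (\<alpha> k)) *\<^sub>C a (inc k \<alpha>)"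

lemma power_series_abs_conv:
  assumes "power_series_on_ball f a"
  shows "abs_conv a"
  unfolding abs_conv_def
proof (intro allI impI)
  fix z :: "complex ^ 'a" assume z: "norm z < 1"
  \<comment> \<open>Exceeds 1 while \<open>t * norm z\<close> stays below 1: the bounded terms at
    the dilated point leave a geometric factor 1 / t per degree at \<open>z\<close>.\<close>
  define t where "t = 2 / (1 + norm z)"
  have t: "t > 1" "t * norm z < 1"
    using z norm_ge_zero[of z] by (simp_all add: t_def field_simps add_pos_nonneg)
  have "norm (t *\<^sub>R z) < 1" using t by simp
  then have "((\<lambda>\<alpha>. zpow (t *\<^sub>R z) \<alpha> *\<^sub>C a \<alpha>) has_sum f (t *\<^sub>R z)) UNIV"
    using assms unfolding power_series_on_ball_def zpow_def[symmetric] by (simp only: mem_ball_0 Ball_def)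
  then obtain C where C: "\<And>\<alpha>. norm (zpow (t *\<^sub>R z) \<alpha> *\<^sub>C a \<alpha>) \<le> C"
    by (rule has_sum_bounded_terms) auto
  have "norm (zpow z \<alpha>) * norm (a \<alpha>) \<le> C * (1 / t) ^ mdeg \<alpha>" for \<alpha>
  proof -
    have "norm (zpow (t *\<^sub>R z) \<alpha> *\<^sub>C a \<alpha>) = t ^ mdeg \<alpha> * (norm (zpow z \<alpha>) * norm (a \<alpha>))"
      using t by (simp add: norm_scaleC zpow_scaleR norm_mult norm_power)
    with C[of \<alpha>] show ?thesis using t by (simp add: field_simps)
  qed
  note le = this
  have "(\<lambda>\<alpha>::'a \<Rightarrow> nat. (1 / t) ^ mdeg \<alpha>) summable_on UNIV"
    by (rule geometric_summable) (use t in auto)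
  then have "(\<lambda>\<alpha>::'a \<Rightarrow> nat. C * (1 / t) ^ mdeg \<alpha>) summable_on UNIV"
    by (rule summable_on_cmult_right)
  then show "(\<lambda>\<alpha>. norm (zpow z \<alpha>) * norm (a \<alpha>)) summable_on UNIV"
    by (rule nonneg_summable_on_le) (simp, rule le)
qed

lemma psum_has_sum:
  assumes "abs_conv a" "norm z < 1"
  shows "((\<lambda>\<alpha>. zpow z \<alpha> *\<^sub>C a \<alpha>) has_sum psum a z) UNIV"
  unfolding psum_def
proof (rule has_sum_infsum, rule Infinite_Sum.abs_summable_summable)
  show "(\<lambda>\<alpha>. norm (zpow z \<alpha> *\<^sub>C a \<alpha>)) summable_on UNIV"
    using assms(1)[unfolded abs_conv_def, rule_format, OF assms(2)] by (simp only: norm_scaleC)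
qed

lemma abs_conv_power_series:
  assumes "abs_conv a" "\<And>z. norm z < 1 \<Longrightarrow> f z = psum a z"
  shows "power_series_on_ball f a"
  unfolding power_series_on_ball_def zpow_def[symmetric]
proof
  fix z :: "complex ^ 'a" assume "z \<in> ball 0 1"
  then have z: "norm z < 1" by simp
  show "((\<lambda>\<alpha>. zpow z \<alpha> *\<^sub>C a \<alpha>) has_sum f z) UNIV"
    unfolding assms(2)[OF z] by (rule psum_has_sum[OF assms(1) z])
qed

text \<open>The moduli of the coordinates, the \<open>k\<close>-th one enlarged by \<delta>.
  Evaluating a series there plays the role of Cauchy's estimate for its derivative in the
  \<open>k\<close>-th variable.\<close>

definition bump :: "'d \<Rightarrow> real \<Rightarrow> complex ^ 'd \<Rightarrow> complex ^ 'd" where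
  "bump k \<delta> z = (\<chi> j. of_real (norm (z $ j) + (if j = k then \<delta> else 0)))"

lemma norm_vec_le_sum: "norm (z :: complex ^ 'd) \<le> (\<Sum>j\<in>UNIV. norm (z $ j))"
  unfolding norm_vec_def by (rule L2_set_le_sum) simp

lemma norm_bump: "0 \<le> \<delta> \<Longrightarrow> norm (bump k \<delta> z) \<le> norm z + \<delta>"
proof -
  assume \<delta>: "0 \<le> \<delta>"
  have "bump k \<delta> z = (\<chi> j. of_real (norm (z $ j))) + axis k (of_real \<delta>)"
    by (simp add: bump_def vec_eq_iff axis_def)
  also have "norm \<dots> \<le> norm (\<chi> j. complex_of_real (norm (z $ j))) + norm (axis k (complex_of_real \<delta>))"
    by (rule norm_triangle_ineq)
  also have "norm (\<chi> j. complex_of_real (norm (z $ j))) = norm z"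
    by (simp add: norm_vec_def)
  also have "norm (axis k (complex_of_real \<delta>)) \<le> \<delta>"
    using norm_vec_le_sum[of "axis k (complex_of_real \<delta>)"] \<delta> by (simp add: axis_def if_distrib cong: if_cong)
  finally show ?thesis by simp
qed

text \<open>The left side is one term of the binomial expansion of the right side.\<close>

lemma bernoulli_shift: "0 \<le> x \<Longrightarrow> 0 \<le> \<delta> \<Longrightarrow> real (Suc n) * x ^ n * \<delta> \<le> (x + \<delta>) ^ Suc n"
proof (induction n)
  case (Suc n)
  have "x * (real (Suc n) * x ^ n * \<delta>) + \<delta> * x ^ Suc n \<le> x * (x + \<delta>) ^ Suc n + \<delta> * (x + \<delta>) ^ Suc n"
    using Suc by (intro add_mono mult_left_mono power_mono) auto
  then show ?case by (simp add: algebra_simps)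
qed simp

text \<open>By \<open>bernoulli_shift\<close> in the \<open>k\<close>-th variable, the factor
  produced by differentiation is paid for by 1 / \<delta> and a move to the enlarged point.\<close>

lemma dcoef_term_le:
  assumes \<delta>: "0 < \<delta>"
  shows "norm (zpow z \<alpha>) * norm (dcoef k a \<alpha>)
    \<le> (1 / \<delta>) * (norm (zpow (bump k \<delta> z) (inc k \<alpha>)) * norm (a (inc k \<alpha>)))"
proof -
  let ?R = "\<Prod>j\<in>UNIV - {k}. norm (z $ j) ^ \<alpha> j"
  have R: "?R \<ge> 0" by (intro prod_nonneg) auto
  have 1: "norm (zpow z \<alpha>) = norm (z $ k) ^ \<alpha> k * ?R"
    unfolding norm_zpow by (rule prod_split)
  have 2: "norm (zpow (bump k \<delta> z) (inc k \<alpha>)) = (norm (z $ k) + \<delta>) ^ Suc (\<alpha> k) * ?R"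
    unfolding norm_zpow prod_split[of _ k]
    using \<delta> by (intro arg_cong2[of _ _ _ _ "(*)"] prod.cong) (auto simp: bump_def inc_def simp del: power_Suc of_real_add simp flip: of_real_add)
  have "norm (zpow z \<alpha>) * real (Suc (\<alpha> k)) * \<delta> = (real (Suc (\<alpha> k)) * norm (z $ k) ^ \<alpha> k * \<delta>) * ?R"
    by (simp add: 1)
  also have "\<dots> \<le> norm (zpow (bump k \<delta> z) (inc k \<alpha>))"
    unfolding 2 using bernoulli_shift[of "norm (z $ k)" \<delta> "\<alpha> k"] \<delta> R by (intro mult_right_mono) auto
  finally have "norm (zpow z \<alpha>) * real (Suc (\<alpha> k)) \<le> (1 / \<delta>) * norm (zpow (bump k \<delta> z) (inc k \<alpha>))"
    using \<delta> by (simp add: field_simps)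
  from mult_right_mono[OF this, of "norm (a (inc k \<alpha>))"] show ?thesis
    by (simp add: dcoef_def norm_scaleC mult_ac del: of_nat_Suc)
qed

lemma bump_in_ball:
  assumes "norm z < 1"
  shows "norm (bump k ((1 - norm z) / 2) z) < 1" "(1 - norm z) / 2 > 0"
  using norm_bump[of "(1 - norm z) / 2" k z] assms by (simp_all add: field_simps)

lemma abs_conv_dcoef:
  assumes a: "abs_conv a"
  shows "abs_conv (dcoef k a)"
  unfolding abs_conv_def
proof (intro allI impI)
  fix z :: "complex ^ 'a" assume z: "norm z < 1"
  let ?\<delta> = "(1 - norm z) / 2"
  have "(\<lambda>\<alpha>. norm (zpow (bump k ?\<delta> z) \<alpha>) * norm (a \<alpha>)) summable_on range (inc k)"
    by (rule summable_on_subset_banach[OF a[unfolded abs_conv_def, rule_format, OF bump_in_ball(1)[OF z]]]) simp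
  then have "(\<lambda>\<alpha>. (1 / ?\<delta>) * (norm (zpow (bump k ?\<delta> z) (inc k \<alpha>)) * norm (a (inc k \<alpha>)))) summable_on UNIV"
    unfolding summable_on_reindex[OF inj_inc] o_def by (rule summable_on_cmult_right)
  then show "(\<lambda>\<alpha>. norm (zpow z \<alpha>) * norm (dcoef k a \<alpha>)) summable_on UNIV"
    by (rule nonneg_summable_on_le) (simp, rule dcoef_term_le[OF bump_in_ball(2)[OF z]])
qed

lemma dzpow_inc: "dzpow k z (inc k \<alpha>) = of_nat (Suc (\<alpha> k)) * zpow z \<alpha>"
  unfolding dzpow_def dec_inc by (simp add: inc_def)

lemma dzpow_has_sum:
  assumes "abs_conv a" "norm z < 1"
  shows "((\<lambda>\<alpha>. dzpow k z \<alpha> *\<^sub>C a \<alpha>) has_sum psum (dcoef k a) z) UNIV"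
proof -
  have "((\<lambda>\<alpha>. dzpow k z (inc k \<alpha>) *\<^sub>C a (inc k \<alpha>)) has_sum psum (dcoef k a) z) UNIV"
  proof -
    have "zpow z \<alpha> *\<^sub>C dcoef k a \<alpha> = dzpow k z (inc k \<alpha>) *\<^sub>C a (inc k \<alpha>)" for \<alpha>
      by (simp add: dcoef_def dzpow_inc scaleC_scaleC mult.commute)
    then show ?thesis
      using psum_has_sum[OF abs_conv_dcoef[OF assms(1)] assms(2), of k] by simp
  qed
  then have "((\<lambda>\<alpha>. dzpow k z \<alpha> *\<^sub>C a \<alpha>) has_sum psum (dcoef k a) z) (range (inc k))"
    unfolding has_sum_reindex[OF inj_inc] o_def .
  then show ?thesis
    by (subst has_sum_cong_neutral[where T = "range (inc k)"]) (auto simp: range_inc dzpow_def)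
qed

lemma norm_dzpow_mono:
  assumes "\<And>j. norm (z $ j) \<le> norm (w $ j)"
  shows "norm (dzpow k z \<alpha>) \<le> norm (dzpow k w \<alpha>)"
  unfolding dzpow_def norm_mult by (intro mult_left_mono norm_zpow_mono assms) auto

lemma dzpow_abs_summable:
  assumes a: "abs_conv a" and z: "norm z < 1"
  shows "(\<lambda>\<alpha>. norm (dzpow k z \<alpha>) * norm (a \<alpha>)) summable_on UNIV"
proof -
  have "(\<lambda>\<alpha>. norm (dzpow k z (inc k \<alpha>)) * norm (a (inc k \<alpha>))) summable_on UNIV"
    using abs_conv_dcoef[OF a, of k] z unfolding abs_conv_def
    by (simp add: dcoef_def dzpow_inc norm_mult norm_scaleC mult_ac)
  then have "(\<lambda>\<alpha>. norm (dzpow k z \<alpha>) * norm (a \<alpha>)) summable_on range (inc k)"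
    unfolding summable_on_reindex[OF inj_inc] o_def .
  then show ?thesis
    by (subst summable_on_cong_neutral[where T = "range (inc k)"]) (auto simp: range_inc dzpow_def)
qed

lemma zpow_has_derivative:
  "((\<lambda>z. zpow z \<alpha>) has_derivative (\<lambda>h. \<Sum>k\<in>UNIV. h $ k * dzpow k z \<alpha>)) (at z within S)"
proof -
  have p: "((\<lambda>z::complex^'a. (z $ k) ^ \<alpha> k) has_derivative (\<lambda>h. of_nat (\<alpha> k) * (h $ k) * (z $ k) ^ (\<alpha> k - 1))) (at z within S)" for k
  proof -
    have "((\<lambda>z::complex^'a. z $ k) has_derivative (\<lambda>h. h $ k)) (at z within S)"
      by (rule bounded_linear.has_derivative[OF bounded_linear_vec_nth has_derivative_ident])
    from has_derivative_power[OF this, of "\<alpha> k"] show ?thesis by simp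
  qed
  have d: "dzpow k z \<alpha> = of_nat (\<alpha> k) * (z $ k) ^ (\<alpha> k - 1) * (\<Prod>j\<in>UNIV - {k}. (z $ j) ^ \<alpha> j)" for k
    unfolding dzpow_def zpow_split[of z _ k] by (simp add: dec_def)
  have "((\<lambda>z. zpow z \<alpha>) has_derivative (\<lambda>h. \<Sum>k\<in>UNIV. of_nat (\<alpha> k) * (h $ k) * (z $ k) ^ (\<alpha> k - 1) * (\<Prod>j\<in>UNIV - {k}. (z $ j) ^ \<alpha> j))) (at z within S)"
    unfolding zpow_def by (rule has_derivative_prod) (rule p)
  then show ?thesis by (rule has_derivative_eq_rhs) (simp add: d mult_ac)
qed

text \<open>Termwise differentiation: the derivatives of the truncations by degree converge
  uniformly on a small ball around \<open>z\<close>. The Weierstrass test uses a single point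
  \<open>w\<close> of the unit ball whose coordinates dominate those of all points of the small ball
  in modulus.\<close>

lemma psum_has_derivative:
  assumes a: "abs_conv a" and z: "norm z < 1"
  shows "(psum a has_derivative (\<lambda>h. \<Sum>k\<in>UNIV. (h $ k) *\<^sub>C psum (dcoef k a) z)) (at z)"
proof -
  \<comment> \<open>Every coordinate modulus is enlarged by \<delta> in \<open>w\<close>, so the
    norm grows by at most the dimension times \<delta>, which is half the distance of
    \<open>z\<close> from the sphere.\<close>
  define \<delta> where "\<delta> = (1 - norm z) / (2 * CARD('a))"
  have \<delta>: "\<delta> > 0" using z by (simp add: \<delta>_def)
  define w :: "complex ^ 'a" where "w = (\<chi> j. of_real (norm (z $ j) + \<delta>))"
  have "norm w < 1"
  proof -
    have "w = (\<chi> j. of_real (norm (z $ j))) + (\<chi> j. of_real \<delta>)"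
      by (simp add: w_def vec_eq_iff)
    also have "norm \<dots> \<le> norm (\<chi> j::'a. complex_of_real (norm (z $ j))) + norm (\<chi> j::'a. complex_of_real \<delta>)"
      by (rule norm_triangle_ineq)
    also have "norm (\<chi> j. complex_of_real (norm (z $ j))) = norm z"
      by (simp add: norm_vec_def)
    also have "norm (\<chi> j::'a. complex_of_real \<delta>) \<le> (\<Sum>j\<in>(UNIV::'a set). \<delta>)"
      using norm_vec_le_sum[of "\<chi> j::'a. complex_of_real \<delta>"] \<delta> by simp
    also have "norm z + (\<Sum>j\<in>(UNIV::'a set). \<delta>) < 1" using z by (simp add: \<delta>_def field_simps)
    finally show ?thesis by simp
  qed
  define S where "S = ball z \<delta>"
  have Sw: "norm (x $ j) \<le> norm (w $ j)" if "x \<in> S" for x j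
  proof -
    have "norm (x $ j) \<le> norm (z $ j) + norm ((x - z) $ j)"
      by (metis norm_triangle_sub vector_minus_component)
    also have "norm ((x - z) $ j) \<le> norm (x - z)" by (rule Finite_Cartesian_Product.norm_nth_le)
    also have "norm (x - z) \<le> \<delta>" using that by (simp add: S_def dist_norm norm_minus_commute)
    finally show ?thesis using \<delta> by (simp add: w_def del: of_real_add)
  qed
  have S1: "norm x < 1" if "x \<in> S" for x
  proof -
    have "norm x \<le> norm z + norm (x - z)" by (rule norm_triangle_sub)
    moreover have "norm (x - z) < \<delta>" using that by (simp add: S_def dist_norm norm_minus_commute)
    moreover have "\<delta> \<le> (1 - norm z) / 2"
      unfolding \<delta>_def using z by (intro divide_left_mono) (auto simp: Suc_le_eq)
    ultimately show ?thesis using z by argo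
  qed
  define f where "f n x = (\<Sum>\<alpha> | mdeg \<alpha> \<le> n. zpow x \<alpha> *\<^sub>C a \<alpha>)" for n x
  define f' where "f' n x h = (\<Sum>\<alpha> | mdeg \<alpha> \<le> n. (\<Sum>k\<in>UNIV. h $ k * dzpow k x \<alpha>) *\<^sub>C a \<alpha>)" for n x h
  define g' where "g' x h = (\<Sum>k\<in>UNIV. (h $ k) *\<^sub>C psum (dcoef k a) x)" for x h
  have "\<exists>g. \<forall>x\<in>S. (\<lambda>n. f n x) \<longlonglongrightarrow> g x \<and> (g has_derivative g' x) (at x within S)"
  proof (rule has_derivative_sequence)
    show "convex S" by (simp add: S_def)
    show "(f n has_derivative f' n x) (at x within S)" if "x \<in> S" for n x
      unfolding f_def f'_def
    proof (rule has_derivative_sum)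
      fix \<alpha>
      show "((\<lambda>x. zpow x \<alpha> *\<^sub>C a \<alpha>) has_derivative (\<lambda>h. (\<Sum>k\<in>UNIV. h $ k * dzpow k x \<alpha>) *\<^sub>C a \<alpha>)) (at x within S)"
        by (rule bounded_linear.has_derivative[OF bounded_bilinear.bounded_linear_left[OF bounded_bilinear_scaleC] zpow_has_derivative])
    qed
    show "z \<in> S" using \<delta> by (simp add: S_def)
    show "(\<lambda>n. f n z) \<longlonglongrightarrow> psum a z"
      unfolding f_def by (rule has_sum_mdeg_tendsto[OF psum_has_sum[OF a z]])
    fix e :: real assume e: "e > 0"
    have unif: "uniform_limit S (\<lambda>n x. \<Sum>\<alpha> | mdeg \<alpha> \<le> n. dzpow k x \<alpha> *\<^sub>C a \<alpha>) (psum (dcoef k a)) sequentially" for k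
    proof -
      have "uniform_limit S (\<lambda>X x. \<Sum>\<alpha>\<in>X. dzpow k x \<alpha> *\<^sub>C a \<alpha>) (psum (dcoef k a)) (finite_subsets_at_top UNIV)"
      proof (rule Weierstrass_m_test_general'[where M = "\<lambda>\<alpha>. norm (dzpow k w \<alpha>) * norm (a \<alpha>)"])
        show "norm (dzpow k x \<alpha> *\<^sub>C a \<alpha>) \<le> norm (dzpow k w \<alpha>) * norm (a \<alpha>)" if "x \<in> S" for x \<alpha>
          unfolding norm_scaleC using Sw[OF that] by (intro mult_right_mono norm_dzpow_mono) auto
        show "((\<lambda>\<alpha>. dzpow k x \<alpha> *\<^sub>C a \<alpha>) has_sum psum (dcoef k a) x) UNIV" if "x \<in> S" for x
          by (rule dzpow_has_sum[OF a S1[OF that]])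
        show "(\<lambda>\<alpha>. norm (dzpow k w \<alpha>) * norm (a \<alpha>)) summable_on UNIV"
          by (rule dzpow_abs_summable[OF a \<open>norm w < 1\<close>])
      qed
      from filterlim_compose[OF this filterlim_mdeg_le] show ?thesis by (simp add: o_def)
    qed
    \<comment> \<open>The error in direction \<open>h\<close> is a sum over the coordinates of
      \<open>h\<close>, each at most \<open>norm h\<close> in modulus; hence the division by the
      dimension.\<close>
    define e' where "e' = e / CARD('a)"
    have e': "e' > 0" using e by (simp add: e'_def)
    have "\<forall>\<^sub>F n in sequentially. \<forall>k\<in>UNIV. \<forall>x\<in>S. dist (\<Sum>\<alpha> | mdeg \<alpha> \<le> n. dzpow k x \<alpha> *\<^sub>C a \<alpha>) (psum (dcoef k a) x) < e'"
      by (rule eventually_ball_finite) (use unif e' in \<open>auto simp: uniform_limit_iff\<close>)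
    then show "\<forall>\<^sub>F n in sequentially. \<forall>x\<in>S. \<forall>h. norm (f' n x h - g' x h) \<le> e * norm h"
    proof eventually_elim
      case (elim n)
      show ?case
      proof (intro ballI allI)
        fix x h assume x: "x \<in> S"
        let ?D = "\<lambda>k. (\<Sum>\<alpha> | mdeg \<alpha> \<le> n. dzpow k x \<alpha> *\<^sub>C a \<alpha>) - psum (dcoef k a) x"
        have "f' n x h = (\<Sum>k\<in>UNIV. (h $ k) *\<^sub>C (\<Sum>\<alpha> | mdeg \<alpha> \<le> n. dzpow k x \<alpha> *\<^sub>C a \<alpha>))"
          unfolding f'_def hilbert.scale_sum_left hilbert.scale_sum_right
          by (subst sum.swap) (simp add: scaleC_scaleC)
        then have "f' n x h - g' x h = (\<Sum>k\<in>UNIV. (h $ k) *\<^sub>C ?D k)"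
          by (simp add: g'_def hilbert.scale_right_diff_distrib sum_subtractf)
        also have "norm \<dots> \<le> (\<Sum>k\<in>(UNIV::'a set). norm h * e')"
        proof (rule sum_norm_le)
          fix k
          show "norm ((h $ k) *\<^sub>C ?D k) \<le> norm h * e'"
            unfolding norm_scaleC using elim x
            by (intro mult_mono Finite_Cartesian_Product.norm_nth_le) (auto simp: dist_norm intro: less_imp_le)
        qed
        also have "\<dots> = e * norm h" by (simp add: e'_def)
        finally show "norm (f' n x h - g' x h) \<le> e * norm h" .
      qed
    qed
  qed
  then obtain g where g: "\<And>x. x \<in> S \<Longrightarrow> (\<lambda>n. f n x) \<longlonglongrightarrow> g x"
    "\<And>x. x \<in> S \<Longrightarrow> (g has_derivative g' x) (at x within S)" by blast
  have gp: "g x = psum a x" if "x \<in> S" for x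
    using LIMSEQ_unique[OF g(1)[OF that, unfolded f_def] has_sum_mdeg_tendsto[OF psum_has_sum[OF a S1[OF that]]]] .
  have "z \<in> S" using \<delta> unfolding S_def by simp
  moreover have "open S" unfolding S_def by (rule open_ball)
  ultimately have zS: "z \<in> S" "open S" .
  have "(g has_derivative g' z) (at z)"
    using g(2)[OF zS(1)] unfolding at_within_open[OF zS] .
  then have "(psum a has_derivative g' z) (at z)"
    by (rule has_derivative_transform_within_open[OF _ zS(2,1)]) (rule gp)
  moreover have "g' z = (\<lambda>h. \<Sum>k\<in>UNIV. (h $ k) *\<^sub>C psum (dcoef k a) z)"
    by (rule ext) (simp only: g'_def)
  ultimately show ?thesis by simp
qed

section \<open>Uniqueness of the coefficients\<close>

lemma psum_zero:
  fixes a :: "('d::finite \<Rightarrow> nat) \<Rightarrow> 'm::complex_hilbert"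
  shows "psum a 0 = a (\<lambda>_. 0)"
proof -
  have z: "zpow 0 \<alpha> = (if \<alpha> = (\<lambda>_. 0) then 1 else 0)" for \<alpha> :: "'d \<Rightarrow> nat"
    by (auto simp: zpow_def)
  have "psum a 0 = (\<Sum>\<^sub>\<infinity>\<alpha>\<in>{\<lambda>_. 0}. zpow 0 \<alpha> *\<^sub>C a \<alpha>)"
    unfolding psum_def by (rule infsum_cong_neutral) (auto simp: z)
  then show ?thesis by (simp add: z)
qed

text \<open>Induction on the degree: the derivatives of a vanishing series vanish, a coefficient of
  positive degree is up to a nonzero factor a coefficient of lower degree of some derivative, and
  degree 0 is the value at the origin.\<close>

lemma psum_unique:
  fixes a :: "('d::finite \<Rightarrow> nat) \<Rightarrow> 'm::complex_hilbert"
  assumes "abs_conv a" "\<And>z. norm z < 1 \<Longrightarrow> psum a z = 0"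
  shows "a \<alpha> = 0"
  using assms
proof (induction "mdeg \<alpha>" arbitrary: a \<alpha>)
  case 0
  then have "\<alpha> = (\<lambda>_. 0)" by (simp add: mdeg_eq_0_iff)
  then show ?case using psum_zero[of a] 0(3)[of 0] by simp
next
  case (Suc n)
  have "mdeg \<alpha> \<noteq> 0" using Suc by simp
  then obtain k where k: "\<alpha> k > 0" by (auto simp: mdeg_def)
  have "dcoef k a (dec k \<alpha>) = 0"
  proof (rule Suc.hyps(1))
    show "n = mdeg (dec k \<alpha>)" using Suc.hyps(2) mdeg_inc[of k "dec k \<alpha>"] inc_dec[of \<alpha> k] k by simp
    show "abs_conv (dcoef k a)" by (rule abs_conv_dcoef[OF Suc.prems(1)])
    fix z :: "complex ^ 'd" assume z: "norm z < 1"
    have "((\<lambda>_. 0) has_derivative (\<lambda>h. \<Sum>k\<in>UNIV. (h $ k) *\<^sub>C psum (dcoef k a) z)) (at z)"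
      by (rule has_derivative_transform_within_open[OF psum_has_derivative[OF Suc.prems(1) z], of "ball 0 1"])
        (use z Suc.prems(2) in auto)
    then have "(\<lambda>h. \<Sum>k\<in>UNIV. (h $ k) *\<^sub>C psum (dcoef k a) z) = (\<lambda>_. 0)"
      using has_derivative_unique[OF _ has_derivative_const] by blast
    from fun_cong[OF this, of "axis k 1"] show "psum (dcoef k a) z = 0"
      by (simp add: axis_def if_distrib[of "\<lambda>c. c *\<^sub>C _"] cong: if_cong)
  qed
  moreover have "dcoef k a (dec k \<alpha>) = of_nat (\<alpha> k) *\<^sub>C a \<alpha>"
    using k inc_dec[of \<alpha> k] by (simp add: dcoef_def) (simp add: dec_def)
  ultimately show ?case using k by simp
qed

text \<open>From here on a function on the ball is represented by its coefficients. The extension by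
  0 is the one required in \<open>ball_holomorphic\<close>, whose elements are exactly the functions
  \<open>ball_ext a\<close> with \<open>abs_conv a\<close>.\<close>

definition ball_ext :: "(('d \<Rightarrow> nat) \<Rightarrow> 'm::complex_hilbert) \<Rightarrow> complex ^ 'd \<Rightarrow> 'm" where
  "ball_ext a z = (if norm z < 1 then psum a z else 0)"

lemma psum_add:
  assumes "abs_conv a" "abs_conv b" "norm z < 1"
  shows "psum (\<lambda>\<alpha>. a \<alpha> + b \<alpha>) z = psum a z + psum b z"
  unfolding psum_def
  using has_sum_add[OF psum_has_sum[OF assms(1,3)] psum_has_sum[OF assms(2,3)]]
  by (intro infsumI) (simp add: scaleC_add_right psum_def)

lemma psum_scale:
  assumes "abs_conv a" "norm z < 1"
  shows "psum (\<lambda>\<alpha>. c *\<^sub>C a \<alpha>) z = c *\<^sub>C psum a z"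
proof -
  have "((\<lambda>\<alpha>. c *\<^sub>C (zpow z \<alpha> *\<^sub>C a \<alpha>)) has_sum c *\<^sub>C psum a z) UNIV"
    using has_sum_bounded_linear[OF bounded_bilinear.bounded_linear_right[OF bounded_bilinear_scaleC] psum_has_sum[OF assms]]
    by (simp add: o_def)
  then show ?thesis
    unfolding psum_def by (intro infsumI) (simp add: scaleC_scaleC psum_def mult.commute)
qed

lemma abs_conv_add: "abs_conv a \<Longrightarrow> abs_conv b \<Longrightarrow> abs_conv (\<lambda>\<alpha>. a \<alpha> + b \<alpha>)"
  unfolding abs_conv_def
proof (intro allI impI)
  fix z :: "complex ^ 'a" assume *: "\<forall>z::complex^'a. norm z < 1 \<longrightarrow> (\<lambda>\<alpha>. norm (zpow z \<alpha>) * norm (a \<alpha>)) summable_on UNIV"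
    "\<forall>z::complex^'a. norm z < 1 \<longrightarrow> (\<lambda>\<alpha>. norm (zpow z \<alpha>) * norm (b \<alpha>)) summable_on UNIV" "norm z < 1"
  have "(\<lambda>\<alpha>. norm (zpow z \<alpha>) * norm (a \<alpha>) + norm (zpow z \<alpha>) * norm (b \<alpha>)) summable_on UNIV"
    using * by (intro summable_on_add) auto
  then show "(\<lambda>\<alpha>. norm (zpow z \<alpha>) * norm (a \<alpha> + b \<alpha>)) summable_on UNIV"
    by (rule nonneg_summable_on_le)
      (auto simp: distrib_left[symmetric] intro!: mult_left_mono norm_triangle_ineq)
qed

lemma abs_conv_scale: "abs_conv a \<Longrightarrow> abs_conv (\<lambda>\<alpha>. c *\<^sub>C a \<alpha>)"
  unfolding abs_conv_def norm_scaleC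
  by (auto simp: mult.left_commute[of _ "cmod c"] intro: summable_on_cmult_right)

lemma abs_conv_minus: "abs_conv a \<Longrightarrow> abs_conv (\<lambda>\<alpha>. - a \<alpha>)"
  by (simp add: abs_conv_def)

lemma abs_conv_diff: "abs_conv a \<Longrightarrow> abs_conv b \<Longrightarrow> abs_conv (\<lambda>\<alpha>. a \<alpha> - b \<alpha>)"
  using abs_conv_add[OF _ abs_conv_minus, of a b] by simp

lemma psum_diff:
  assumes "abs_conv a" "abs_conv b" "norm z < 1"
  shows "psum (\<lambda>\<alpha>. a \<alpha> - b \<alpha>) z = psum a z - psum b z"
  using psum_add[OF assms(1) abs_conv_scale[OF assms(2), of "-1"] assms(3)] psum_scale[OF assms(2,3), of "-1"]
  by simp

lemma psum_inject:
  assumes "abs_conv a" "abs_conv b" "\<And>z. norm z < 1 \<Longrightarrow> psum a z = psum b z"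
  shows "a = b"
proof
  fix \<alpha>
  have "(\<lambda>\<alpha>. a \<alpha> - b \<alpha>) \<alpha> = 0"
    by (rule psum_unique[OF abs_conv_diff[OF assms(1,2)]]) (simp add: psum_diff assms)
  then show "a \<alpha> = b \<alpha>" by simp
qed

text \<open>Any family representing the function converges absolutely and has the same sums, so
  \<open>psum_inject\<close> determines the definite description.\<close>

lemma taylor_coeff_ball_ext:
  assumes "abs_conv a"
  shows "taylor_coeff (ball_ext a) = a"
  unfolding taylor_coeff_def
proof (rule the_equality)
  show "power_series_on_ball (ball_ext a) a"
    by (rule abs_conv_power_series[OF assms]) (simp add: ball_ext_def)
  fix b assume b: "power_series_on_ball (ball_ext a) b"
  have "psum b z = psum a z" if z: "norm z < 1" for z
  proof -
    have "((\<lambda>\<alpha>. zpow z \<alpha> *\<^sub>C b \<alpha>) has_sum ball_ext a z) UNIV"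
      using b z unfolding power_series_on_ball_def zpow_def[symmetric] by simp
    then show ?thesis using z unfolding psum_def by (simp add: infsumI ball_ext_def psum_def)
  qed
  then show "b = a" by (intro psum_inject power_series_abs_conv[OF b] assms)
qed

lemma ball_ext_has_derivative:
  assumes "abs_conv a" "norm z < 1"
  shows "(ball_ext a has_derivative (\<lambda>h. \<Sum>k\<in>UNIV. (h $ k) *\<^sub>C psum (dcoef k a) z)) (at z)"
  by (rule has_derivative_transform_within_open[OF psum_has_derivative[OF assms], of "ball 0 1"])
    (use assms in \<open>auto simp: ball_ext_def\<close>)

lemma cpartial_ball_ext:
  assumes "abs_conv a" "norm z < 1"
  shows "cpartial k (ball_ext a) z = psum (dcoef k a) z"
proof -
  have "frechet_derivative (ball_ext a) (at z) = (\<lambda>h. \<Sum>k\<in>UNIV. (h $ k) *\<^sub>C psum (dcoef k a) z)"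
    by (rule frechet_derivative_at[OF ball_ext_has_derivative[OF assms], symmetric])
  then show ?thesis
    by (simp add: cpartial_def axis_def if_distrib[of "\<lambda>c. c *\<^sub>C _"] cong: if_cong)
qed

lemma ball_ext_holomorphic:
  assumes "abs_conv a"
  shows "ball_ext a \<in> ball_holomorphic"
proof -
  have "cholomorphic_on (ball_ext a) (ball 0 1)"
    unfolding cholomorphic_on_def
  proof
    fix z :: "complex ^ 'a" assume "z \<in> ball 0 1"
    then have z: "norm z < 1" by simp
    show "\<exists>D. (ball_ext a has_derivative D) (at z) \<and> (\<forall>c v. D (c *s v) = c *\<^sub>C D v)"
      by (rule exI, rule conjI, rule ball_ext_has_derivative[OF assms z])
        (simp add: hilbert.scale_sum_right scaleC_scaleC)
  qed
  moreover have "power_series_on_ball (ball_ext a) a"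
    by (rule abs_conv_power_series[OF assms]) (simp add: ball_ext_def)
  ultimately show ?thesis unfolding ball_holomorphic_def by (auto simp: ball_ext_def)
qed

lemma ball_holomorphicE:
  assumes "f \<in> ball_holomorphic"
  obtains a where "abs_conv a" "f = ball_ext a"
proof -
  from assms obtain a where a: "power_series_on_ball f a" and 0: "\<And>z. z \<notin> ball 0 1 \<Longrightarrow> f z = 0"
    unfolding ball_holomorphic_def by blast
  have "f z = ball_ext a z" for z
  proof (cases "norm z < 1")
    case True
    then have "((\<lambda>\<alpha>. zpow z \<alpha> *\<^sub>C a \<alpha>) has_sum f z) UNIV"
      using a unfolding power_series_on_ball_def zpow_def[symmetric] by simp
    with True show ?thesis by (simp add: ball_ext_def psum_def infsumI)
  qed (use 0 in \<open>simp add: ball_ext_def\<close>)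
  then show ?thesis using that[OF power_series_abs_conv[OF a]] by blast
qed

section \<open>Multiplication by a coordinate, on coefficients\<close>

definition shift :: "'d \<Rightarrow> (('d \<Rightarrow> nat) \<Rightarrow> 'm::complex_hilbert) \<Rightarrow> ('d \<Rightarrow> nat) \<Rightarrow> 'm" where
  "shift k a \<alpha> = (if \<alpha> k > 0 then a (dec k \<alpha>) else 0)"

lemma shift_inc [simp]: "shift k a (inc k \<alpha>) = a \<alpha>"
  unfolding shift_def dec_inc by (simp add: inc_def)

lemma psum_shift_has_sum:
  assumes "abs_conv a" "norm z < 1"
  shows "((\<lambda>\<alpha>. zpow z \<alpha> *\<^sub>C shift k a \<alpha>) has_sum (z $ k) *\<^sub>C psum a z) UNIV"
proof -
  have "((\<lambda>\<alpha>. (z $ k) *\<^sub>C (zpow z \<alpha> *\<^sub>C a \<alpha>)) has_sum (z $ k) *\<^sub>C psum a z) UNIV"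
    using has_sum_bounded_linear[OF bounded_bilinear.bounded_linear_right[OF bounded_bilinear_scaleC] psum_has_sum[OF assms]]
    by (simp add: o_def)
  then have "((\<lambda>\<alpha>. zpow z (inc k \<alpha>) *\<^sub>C shift k a (inc k \<alpha>)) has_sum (z $ k) *\<^sub>C psum a z) UNIV"
    by (simp add: zpow_inc scaleC_scaleC)
  then have "((\<lambda>\<alpha>. zpow z \<alpha> *\<^sub>C shift k a \<alpha>) has_sum (z $ k) *\<^sub>C psum a z) (range (inc k))"
    unfolding has_sum_reindex[OF inj_inc] o_def .
  then show ?thesis
    by (subst has_sum_cong_neutral[where T = "range (inc k)"]) (auto simp: range_inc shift_def)
qed

lemma abs_conv_shift:
  assumes "abs_conv a"
  shows "abs_conv (shift k a)"
  by (rule power_series_abs_conv[of "\<lambda>z. (z $ k) *\<^sub>C psum a z"])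
    (use psum_shift_has_sum[OF assms] in \<open>simp add: power_series_on_ball_def zpow_def[symmetric]\<close>)

lemma psum_shift:
  assumes "abs_conv a" "norm z < 1"
  shows "psum (shift k a) z = (z $ k) *\<^sub>C psum a z"
  using psum_shift_has_sum[OF assms] by (simp add: psum_def infsumI)

lemma coord_mult_ball_ext:
  assumes "abs_conv a"
  shows "coord_mult k (ball_ext a) = ball_ext (shift k a)"
  using assms by (auto simp: coord_mult_def ball_ext_def psum_shift)

text \<open>The product rule, read off by comparing two derivatives of the same function: that of
  the shifted series and that of the product with the coordinate.\<close>

lemma psum_dcoef_shift:
  assumes a: "abs_conv a" and z: "norm z < 1"
  shows "psum (dcoef j (shift k a)) z = (if j = k then psum a z else 0) + (z $ k) *\<^sub>C psum (dcoef j a) z"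
proof -
  have "(ball_ext (shift k a) has_derivative (\<lambda>h. (z $ k) *\<^sub>C (\<Sum>i\<in>UNIV. (h $ i) *\<^sub>C psum (dcoef i a) z) + (h $ k) *\<^sub>C ball_ext a z)) (at z)"
    unfolding coord_mult_ball_ext[OF a, symmetric] coord_mult_def
    by (rule has_derivative_scaleC[OF bounded_linear.has_derivative[OF bounded_linear_vec_nth has_derivative_ident] ball_ext_has_derivative[OF a z]])
  from has_derivative_unique[OF ball_ext_has_derivative[OF abs_conv_shift[OF a] z] this]
  have "(\<lambda>h. \<Sum>i\<in>UNIV. (h $ i) *\<^sub>C psum (dcoef i (shift k a)) z) =
    (\<lambda>h. (z $ k) *\<^sub>C (\<Sum>i\<in>UNIV. (h $ i) *\<^sub>C psum (dcoef i a) z) + (h $ k) *\<^sub>C ball_ext a z)" .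
  from fun_cong[OF this, of "axis j 1"] show ?thesis
    using z by (simp add: axis_def ball_ext_def if_distrib[of "\<lambda>c. c *\<^sub>C _"] cong: if_cong)
qed

section \<open>The Hardy space\<close>

text \<open>Induction on \<open>n\<close>: multiplying by the sum of the variables sends \<alpha> to
  the multi-indices \<open>inc k \<alpha>\<close>, and the resulting weights add up over
  \<open>k\<close> to the degree. The formula evaluates the Hardy kernel on the diagonal, one degree
  at a time.\<close>

lemma multinomial:
  fixes x :: "'d::finite \<Rightarrow> real"
  shows "(\<Sum>\<alpha> | mdeg \<alpha> = n. (\<Prod>j\<in>UNIV. x j ^ \<alpha> j) * (fact n / (\<Prod>j\<in>UNIV. fact (\<alpha> j)))) = (\<Sum>j\<in>UNIV. x j) ^ n"
proof (induction n)
  case 0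
  have "{\<alpha> :: 'd \<Rightarrow> nat. mdeg \<alpha> = 0} = {\<lambda>_. 0}" by (auto simp: mdeg_eq_0_iff)
  then show ?case by simp
next
  case (Suc n)
  have fin: "finite {\<alpha> :: 'd \<Rightarrow> nat. mdeg \<alpha> = m}" for m
    by (rule finite_subset[OF _ finite_mdeg_le[of m]]) auto
  let ?p = "\<lambda>\<alpha>. (\<Prod>j\<in>UNIV. x j ^ \<alpha> j) / (\<Prod>j\<in>UNIV. fact (\<alpha> j))"
  have p: "x k * ?p \<alpha> = ?p (inc k \<alpha>) * real (inc k \<alpha> k)" for k \<alpha>
  proof -
    have 1: "(\<Prod>j\<in>UNIV - {k}. x j ^ inc k \<alpha> j) = (\<Prod>j\<in>UNIV - {k}. x j ^ \<alpha> j)"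
      by (rule prod.cong) (auto simp: inc_def)
    have 2: "(\<Prod>j\<in>UNIV - {k}. fact (inc k \<alpha> j) :: real) = (\<Prod>j\<in>UNIV - {k}. fact (\<alpha> j))"
      by (rule prod.cong) (auto simp: inc_def)
    have 3: "inc k \<alpha> k = Suc (\<alpha> k)" by (simp add: inc_def)
    have 4: "fact (Suc (\<alpha> k)) = real (Suc (\<alpha> k)) * fact (\<alpha> k)" by simp
    show ?thesis
      unfolding prod_split[of _ k] 1 2 3 4 by (simp del: of_nat_Suc)
  qed
  have "(\<Sum>j\<in>UNIV. x j) ^ Suc n = (\<Sum>k\<in>UNIV. x k) * (\<Sum>\<alpha> | mdeg \<alpha> = n. (\<Prod>j\<in>UNIV. x j ^ \<alpha> j) * (fact n / (\<Prod>j\<in>UNIV. fact (\<alpha> j))))"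
    by (simp only: Suc.IH power_Suc)
  also have "\<dots> = fact n * (\<Sum>k\<in>UNIV. \<Sum>\<alpha> | mdeg \<alpha> = n. x k * ?p \<alpha>)"
    unfolding sum_product unfolding sum_distrib_left by (intro sum.cong refl) (simp add: mult_ac)
  also have "(\<Sum>k\<in>UNIV. \<Sum>\<alpha> | mdeg \<alpha> = n. x k * ?p \<alpha>) = (\<Sum>k\<in>UNIV. \<Sum>\<beta> | mdeg \<beta> = Suc n. ?p \<beta> * real (\<beta> k))"
  proof (rule sum.cong[OF refl])
    fix k :: 'd
    have "(\<Sum>\<alpha> | mdeg \<alpha> = n. x k * ?p \<alpha>) = (\<Sum>\<alpha> | mdeg \<alpha> = n. ?p (inc k \<alpha>) * real (inc k \<alpha> k))"
      by (simp only: p)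
    also have "\<dots> = (\<Sum>\<beta>\<in>inc k ` {\<alpha>. mdeg \<alpha> = n}. ?p \<beta> * real (\<beta> k))"
      by (subst sum.reindex) (auto intro: inj_on_subset[OF inj_inc])
    also have "\<dots> = (\<Sum>\<beta> | mdeg \<beta> = Suc n. ?p \<beta> * real (\<beta> k))"
    proof (rule sum.mono_neutral_left[OF fin])
      \<comment> \<open>The multi-indices missed by \<open>inc k\<close> have
        \<open>\<beta> k = 0\<close> and contribute nothing.\<close>
      show "\<forall>\<beta>\<in>{\<beta>. mdeg \<beta> = Suc n} - inc k ` {\<alpha>. mdeg \<alpha> = n}. ?p \<beta> * real (\<beta> k) = 0"
      proof
        fix \<beta> assume \<beta>: "\<beta> \<in> {\<beta>. mdeg \<beta> = Suc n} - inc k ` {\<alpha>. mdeg \<alpha> = n}"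
        have "\<beta> k = 0"
        proof (rule ccontr)
          assume "\<beta> k \<noteq> 0"
          then have "\<beta> = inc k (dec k \<beta>)" by (simp add: inc_dec)
          moreover from this have "mdeg (dec k \<beta>) = n" using \<beta> mdeg_inc[of k "dec k \<beta>"] by simp
          ultimately show False using \<beta> by blast
        qed
        then show "?p \<beta> * real (\<beta> k) = 0" by simp
      qed
    qed (auto simp: mdeg_inc)
    finally show "(\<Sum>\<alpha> | mdeg \<alpha> = n. x k * ?p \<alpha>) = (\<Sum>\<beta> | mdeg \<beta> = Suc n. ?p \<beta> * real (\<beta> k))" .
  qed
  also have "\<dots> = (\<Sum>\<beta> | mdeg \<beta> = Suc n. ?p \<beta> * real (mdeg \<beta>))"
  proof -
    have "real (mdeg \<beta>) = (\<Sum>k\<in>UNIV. real (\<beta> k))" for \<beta> :: "'d \<Rightarrow> nat" by (simp add: mdeg_def)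
    then show ?thesis by (subst sum.swap) (simp only: sum_distrib_left)
  qed
  also have "\<dots> = (\<Sum>\<beta> | mdeg \<beta> = Suc n. ?p \<beta>) * real (Suc n)"
    by (simp add: sum_distrib_right)
  finally have e: "(\<Sum>j\<in>UNIV. x j) ^ Suc n
    = fact n * ((\<Sum>\<beta> | mdeg \<beta> = Suc n. ?p \<beta>) * real (Suc n))" .
  show ?case
    unfolding e by (simp add: sum_distrib_left sum_distrib_right mult_ac del: of_nat_Suc)
qed

lemma monomial_norm_sq_pos: "0 < monomial_norm_sq \<alpha>"
  unfolding monomial_norm_sq_def by (intro divide_pos_pos mult_pos_pos prod_pos) auto

lemma monomial_norm_sq_inc:
  fixes \<alpha> :: "'d::finite \<Rightarrow> nat"
  shows "monomial_norm_sq (inc k \<alpha>) = monomial_norm_sq \<alpha> * (real (Suc (\<alpha> k)) / real (mdeg \<alpha> + CARD('d)))"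
proof -
  have 2: "(\<Prod>j\<in>UNIV - {k}. fact (inc k \<alpha> j) :: real) = (\<Prod>j\<in>UNIV - {k}. fact (\<alpha> j))"
    by (rule prod.cong) (auto simp: inc_def)
  have 3: "inc k \<alpha> k = Suc (\<alpha> k)" by (simp add: inc_def)
  have 4: "fact (Suc (\<alpha> k)) = real (Suc (\<alpha> k)) * fact (\<alpha> k)" by simp
  have "mdeg (inc k \<alpha>) + CARD('d) - 1 = Suc (mdeg \<alpha> + CARD('d) - 1)"
    using zero_less_card_finite[where 'a='d] by (simp add: mdeg_inc)
  moreover have "Suc (mdeg \<alpha> + CARD('d) - 1) = mdeg \<alpha> + CARD('d)"
    using zero_less_card_finite[where 'a='d] by simp
  ultimately have 5: "(fact (mdeg (inc k \<alpha>) + CARD('d) - 1) :: real) = real (mdeg \<alpha> + CARD('d)) * fact (mdeg \<alpha> + CARD('d) - 1)"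
    by (metis fact_Suc)
  show ?thesis
    unfolding monomial_norm_sq_def mdeg_def[symmetric] 5 prod_split[of _ k] 2 3 4
    by (simp add: mult_ac del: of_nat_Suc of_nat_add)
qed

text \<open>The numerators of the ratios in \<open>monomial_norm_sq_inc\<close> add up to the common
  denominator. This is why the coordinates act as a joint isometry on the Hardy space.\<close>

lemma sum_monomial_norm_sq_inc:
  fixes \<alpha> :: "'d::finite \<Rightarrow> nat"
  shows "(\<Sum>k\<in>UNIV. monomial_norm_sq (inc k \<alpha>)) = monomial_norm_sq \<alpha>"
proof -
  have "(\<Sum>k\<in>UNIV. real (Suc (\<alpha> k))) = real (mdeg \<alpha> + CARD('d))"
    by (simp add: mdeg_def sum.distrib)
  moreover have "real (mdeg \<alpha> + CARD('d)) \<noteq> 0"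
    using zero_less_card_finite[where 'a='d] by linarith
  ultimately have e: "(\<Sum>k\<in>UNIV. real (Suc (\<alpha> k)) / real (mdeg \<alpha> + CARD('d))) = 1"
    by (simp del: of_nat_Suc of_nat_add flip: sum_divide_distrib)
  show ?thesis
    unfolding monomial_norm_sq_inc sum_distrib_left[symmetric] by (simp only: e mult_1_right)
qed

lemma monomial_norm_sq_inc_le: "monomial_norm_sq (inc k \<alpha>) \<le> monomial_norm_sq \<alpha>"
  unfolding sum_monomial_norm_sq_inc[of \<alpha>, symmetric]
  by (rule member_le_sum) (auto intro: less_imp_le monomial_norm_sq_pos)

text \<open>The reproducing kernel of the Hardy space on the diagonal, as a power series in \<open>r = |z|\<close>.\<close>

definition hardy_kernel :: "nat \<Rightarrow> real \<Rightarrow> real" where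
  "hardy_kernel d r = (\<Sum>n. fact (n + d - 1) / (fact n * fact (d - 1)) * (r\<^sup>2) ^ n)"

lemma hardy_kernel_summable:
  assumes r: "0 \<le> r" "r < 1" and d: "0 < d"
  shows "summable (\<lambda>n. fact (n + d - 1) / (fact n * fact (d - 1)) * (r\<^sup>2) ^ n :: real)"
proof -
  let ?x = "r\<^sup>2"
  have x: "0 \<le> ?x" "?x < 1" using r by (simp_all add: power_less_one_iff abs_square_less_1)
  \<comment> \<open>The ratio of consecutive terms is (n + d) x / (n + 1) with x = r^2. From this
    \<open>N\<close> on it is at most (1 + x) / 2, the midpoint between its limit x and 1.\<close>
  obtain N where N: "2 * real d / (1 - ?x) \<le> real N" using real_arch_simple by blast
  show ?thesis
  proof (rule summable_ratio_test[where N = N])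
    show "(1 + ?x) / 2 < 1" using x by simp
    fix n assume "N \<le> n"
    then have "2 * real d / (1 - ?x) \<le> real n" using N by linarith
    then have le1: "2 * real d \<le> real n * (1 - ?x)" using x by (simp add: field_simps)
    have le2: "real d * ?x \<le> real d * 1" using x by (intro mult_left_mono) auto
    have key: "(real n + real d) * ?x \<le> (real n + 1) * ((1 + ?x) / 2)"
    proof -
      have "(real n + real d) * ?x = real n * ?x + real d * ?x"
        "(real n + 1) * ((1 + ?x) / 2) = (real n + real n * ?x + 1 + ?x) / 2"
        "real n * (1 - ?x) = real n - real n * ?x"
        by (simp_all add: field_simps)
      moreover have "real n * ?x + 2 * (real d * ?x) \<le> real n"
        using le1 le2 by (simp add: right_diff_distrib)
      ultimately show ?thesis using x(1) by argo
    qed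
    have f: "(fact (Suc n + d - 1) :: real) = (real n + real d) * fact (n + d - 1)"
    proof -
      have "Suc n + d - 1 = Suc (n + d - 1)" "Suc (n + d - 1) = n + d" using d by simp_all
      then show ?thesis by (metis fact_Suc of_nat_add)
    qed
    have "fact (Suc n + d - 1) / (fact (Suc n) * fact (d - 1)) * ?x ^ Suc n =
      (fact (n + d - 1) / (fact n * fact (d - 1)) * ?x ^ n) * ((real n + real d) * ?x / (real n + 1))"
      unfolding f by (simp add: field_simps)
    also have "\<dots> \<le> (fact (n + d - 1) / (fact n * fact (d - 1)) * ?x ^ n) * ((1 + ?x) / 2)"
      using key x by (intro mult_left_mono) (auto simp: field_simps)
    finally show "norm (fact (Suc n + d - 1) / (fact (Suc n) * fact (d - 1)) * ?x ^ Suc n) \<le>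
      (1 + ?x) / 2 * norm (fact (n + d - 1) / (fact n * fact (d - 1)) * ?x ^ n)"
      using x by (simp add: abs_mult mult.commute)
  qed
qed

text \<open>Grouped by degree, the sum is dominated by a partial sum of the kernel series, by the
  multinomial formula in the squared moduli of the coordinates.\<close>

lemma sum_zpow_sq_le:
  fixes z :: "complex ^ 'd"
  assumes z: "norm z \<le> r" "r < 1" and G: "finite G"
  shows "(\<Sum>\<alpha>\<in>G. (norm (zpow z \<alpha>))\<^sup>2 / monomial_norm_sq \<alpha>) \<le> hardy_kernel CARD('d) r"
proof -
  have r: "0 \<le> r" using z norm_ge_zero[of z] by linarith
  define N where "N = (\<Sum>\<alpha>\<in>G. mdeg \<alpha>)"
  have fin: "finite {\<alpha> :: 'd \<Rightarrow> nat. mdeg \<alpha> = m}" for m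
    by (rule finite_subset[OF _ finite_mdeg_le[of m]]) auto
  let ?t = "\<lambda>\<alpha>. (norm (zpow z \<alpha>))\<^sup>2 / monomial_norm_sq \<alpha>"
  let ?c = "\<lambda>n. fact (n + CARD('d) - 1) / (fact n * fact (CARD('d) - 1)) :: real"
  have tpos: "0 \<le> ?t \<alpha>" for \<alpha> using monomial_norm_sq_pos[of \<alpha>] by simp
  have "(\<Sum>\<alpha>\<in>G. ?t \<alpha>) \<le> (\<Sum>\<alpha>\<in>(\<Union>n\<in>{..N}. {\<alpha>. mdeg \<alpha> = n}). ?t \<alpha>)"
  proof (rule sum_mono2)
    show "G \<subseteq> (\<Union>n\<in>{..N}. {\<alpha>. mdeg \<alpha> = n})"
      using member_le_sum[of _ G mdeg] G by (auto simp: N_def)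
  qed (use fin tpos in auto)
  also have "\<dots> = (\<Sum>n\<le>N. \<Sum>\<alpha> | mdeg \<alpha> = n. ?t \<alpha>)"
    by (rule sum.UNION_disjoint) (use fin in auto)
  also have "\<dots> = (\<Sum>n\<le>N. ?c n * ((norm z)\<^sup>2) ^ n)"
  proof (rule sum.cong[OF refl])
    fix n
    have "(\<Sum>\<alpha> | mdeg \<alpha> = n. ?t \<alpha>) = (\<Sum>\<alpha> | mdeg \<alpha> = n. ?c n * ((\<Prod>j\<in>UNIV. ((norm (z $ j))\<^sup>2) ^ \<alpha> j) * (fact n / (\<Prod>j\<in>UNIV. fact (\<alpha> j)))))"
    proof (rule sum.cong[OF refl])
      fix \<alpha> :: "'d \<Rightarrow> nat" assume "\<alpha> \<in> {\<alpha>. mdeg \<alpha> = n}"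
      then have n: "(\<Sum>j\<in>UNIV. \<alpha> j) = n" by (simp add: mdeg_def)
      have "(norm (zpow z \<alpha>))\<^sup>2 = (\<Prod>j\<in>UNIV. ((norm (z $ j))\<^sup>2) ^ \<alpha> j)"
        unfolding norm_zpow prod_power_distrib by (simp add: power_mult[symmetric] mult.commute)
      then show "?t \<alpha> = ?c n * ((\<Prod>j\<in>UNIV. ((norm (z $ j))\<^sup>2) ^ \<alpha> j) * (fact n / (\<Prod>j\<in>UNIV. fact (\<alpha> j))))"
        unfolding monomial_norm_sq_def n by (simp add: mult_ac)
    qed
    also have "\<dots> = ?c n * (\<Sum>j\<in>UNIV. (norm (z $ j))\<^sup>2) ^ n"
      by (simp only: multinomial sum_distrib_left[symmetric])
    also have "(\<Sum>j\<in>UNIV. (norm (z $ j))\<^sup>2) = (norm z)\<^sup>2"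
      by (simp add: norm_vec_def L2_set_def sum_nonneg)
    finally show "(\<Sum>\<alpha> | mdeg \<alpha> = n. ?t \<alpha>) = ?c n * ((norm z)\<^sup>2) ^ n" .
  qed
  also have "\<dots> \<le> (\<Sum>n\<le>N. ?c n * (r\<^sup>2) ^ n)"
    using z r by (intro sum_mono mult_left_mono power_mono) auto
  also have "\<dots> \<le> hardy_kernel CARD('d) r"
    unfolding hardy_kernel_def
    by (rule sum_le_suminf[OF hardy_kernel_summable[OF r z(2)]]) auto
  finally show ?thesis .
qed

section \<open>Square summable coefficient families\<close>

definition hardy_summable :: "(('d::finite \<Rightarrow> nat) \<Rightarrow> 'm::complex_hilbert) \<Rightarrow> bool" where
  "hardy_summable a \<longleftrightarrow> (\<lambda>\<alpha>. (norm (a \<alpha>))\<^sup>2 * monomial_norm_sq \<alpha>) summable_on UNIV"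

definition hardy_sq :: "(('d::finite \<Rightarrow> nat) \<Rightarrow> 'm::complex_hilbert) \<Rightarrow> real" where
  "hardy_sq a = (\<Sum>\<^sub>\<infinity>\<alpha>. (norm (a \<alpha>))\<^sup>2 * monomial_norm_sq \<alpha>)"

lemma hardy_term_nonneg: "0 \<le> (norm (a \<alpha>))\<^sup>2 * monomial_norm_sq \<alpha>"
  using monomial_norm_sq_pos[of \<alpha>] by simp

lemma hardy_sq_nonneg: "0 \<le> hardy_sq a"
  unfolding hardy_sq_def by (rule infsum_nonneg) (rule hardy_term_nonneg)

text \<open>Cauchy-Schwarz with the monomial norms as weights. Since sums of norms are bounded, and
  not just values, the estimate yields absolute convergence as well, and at the points
  \<open>bump k \<delta> z\<close> it bounds derivatives.\<close>

lemma hardy_abs_sum_le: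
  fixes a :: "('d::finite \<Rightarrow> nat) \<Rightarrow> 'm::complex_hilbert"
  assumes a: "hardy_summable a" and z: "norm (z :: complex ^ 'd) \<le> r" "r < 1" and G: "finite G"
  shows "(\<Sum>\<alpha>\<in>G. norm (zpow z \<alpha>) * norm (a \<alpha>)) \<le> sqrt (hardy_kernel CARD('d) r * hardy_sq a)"
proof (rule real_le_rsqrt)
  let ?w = "\<lambda>\<alpha>::'d \<Rightarrow> nat. sqrt (monomial_norm_sq \<alpha>)"
  have w: "?w \<alpha> > 0" "(?w \<alpha>)\<^sup>2 = monomial_norm_sq \<alpha>" for \<alpha>
    using monomial_norm_sq_pos[of \<alpha>] by simp_all
  have "(\<Sum>\<alpha>\<in>G. norm (zpow z \<alpha>) * norm (a \<alpha>)) = (\<Sum>\<alpha>\<in>G. (norm (zpow z \<alpha>) / ?w \<alpha>) * (norm (a \<alpha>) * ?w \<alpha>))"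
    by (rule sum.cong[OF refl]) (use w(1) in \<open>simp add: less_imp_neq[symmetric]\<close>)
  then have "(\<Sum>\<alpha>\<in>G. norm (zpow z \<alpha>) * norm (a \<alpha>))\<^sup>2 \<le>
      (\<Sum>\<alpha>\<in>G. (norm (zpow z \<alpha>) / ?w \<alpha>)\<^sup>2) * (\<Sum>\<alpha>\<in>G. (norm (a \<alpha>) * ?w \<alpha>)\<^sup>2)"
    using Cauchy_Schwarz_ineq_sum[of "\<lambda>\<alpha>. norm (zpow z \<alpha>) / ?w \<alpha>" "\<lambda>\<alpha>. norm (a \<alpha>) * ?w \<alpha>" G] by simp
  also have "\<dots> = (\<Sum>\<alpha>\<in>G. (norm (zpow z \<alpha>))\<^sup>2 / monomial_norm_sq \<alpha>) * (\<Sum>\<alpha>\<in>G. (norm (a \<alpha>))\<^sup>2 * monomial_norm_sq \<alpha>)"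
    by (simp only: power_divide power_mult_distrib w(2))
  also have "\<dots> \<le> hardy_kernel CARD('d) r * hardy_sq a"
  proof (rule mult_mono)
    show "(\<Sum>\<alpha>\<in>G. (norm (a \<alpha>))\<^sup>2 * monomial_norm_sq \<alpha>) \<le> hardy_sq a"
      unfolding hardy_sq_def
      by (rule finite_sum_le_infsum) (use a G hardy_term_nonneg in \<open>auto simp: hardy_summable_def\<close>)
    show "0 \<le> hardy_kernel CARD('d) r"
      by (rule order_trans[OF _ sum_zpow_sq_le[OF z, of "{}"]]) auto
  qed (auto intro: sum_zpow_sq_le[OF z G] sum_nonneg hardy_term_nonneg)
  finally show "(\<Sum>\<alpha>\<in>G. norm (zpow z \<alpha>) * norm (a \<alpha>))\<^sup>2 \<le> hardy_kernel CARD('d) r * hardy_sq a" .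
qed

lemma hardy_abs_conv:
  fixes a :: "('d::finite \<Rightarrow> nat) \<Rightarrow> 'm::complex_hilbert"
  assumes "hardy_summable a"
  shows "abs_conv a"
  unfolding abs_conv_def
proof (intro allI impI nonneg_bdd_above_summable_on)
  fix z :: "complex ^ 'd" assume z: "norm z < 1"
  show "bdd_above (sum (\<lambda>\<alpha>. norm (zpow z \<alpha>) * norm (a \<alpha>)) ` {F. F \<subseteq> UNIV \<and> finite F})"
    by (rule bdd_aboveI2[where M = "sqrt (hardy_kernel CARD('d) (norm z) * hardy_sq a)"])
      (use hardy_abs_sum_le[OF assms order_refl z] in auto)
qed simp

lemma hardy_psum_le:
  fixes a :: "('d::finite \<Rightarrow> nat) \<Rightarrow> 'm::complex_hilbert"
  assumes a: "hardy_summable a" and z: "norm (z :: complex ^ 'd) \<le> r" "r < 1"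
  shows "norm (psum a z) \<le> sqrt (hardy_kernel CARD('d) r * hardy_sq a)"
proof -
  have z1: "norm z < 1" using z by simp
  note s = hardy_abs_conv[OF a, unfolded abs_conv_def, rule_format, OF z1]
  have "norm (psum a z) \<le> (\<Sum>\<^sub>\<infinity>\<alpha>. norm (zpow z \<alpha> *\<^sub>C a \<alpha>))"
    unfolding psum_def by (rule norm_infsum_bound) (simp only: norm_scaleC s)
  also have "\<dots> \<le> sqrt (hardy_kernel CARD('d) r * hardy_sq a)"
    unfolding norm_scaleC
    by (rule infsum_le_finite_sums[OF s]) (rule hardy_abs_sum_le[OF a z])
  finally show ?thesis .
qed

text \<open>For points of norm at most \<open>r\<close>, a bump by \<delta> = (1 - r) / 2 stays
  within radius (1 + r) / 2; the factor 1 / \<delta> of \<open>dcoef_term_le\<close> appears squared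
  because the bound is put under a square root.\<close>

definition hardy_kernel' :: "nat \<Rightarrow> real \<Rightarrow> real" where
  "hardy_kernel' d r = (2 / (1 - r))\<^sup>2 * hardy_kernel d ((1 + r) / 2)"

lemma hardy_dcoef_psum_le:
  fixes a :: "('d::finite \<Rightarrow> nat) \<Rightarrow> 'm::complex_hilbert"
  assumes a: "hardy_summable a" and z: "norm (z :: complex ^ 'd) \<le> r" "r < 1"
  shows "norm (psum (dcoef k a) z) \<le> sqrt (hardy_kernel' CARD('d) r * hardy_sq a)"
proof -
  have z1: "norm z < 1" using z by simp
  define \<delta> where "\<delta> = (1 - r) / 2"
  have \<delta>: "\<delta> > 0" using z by (simp add: \<delta>_def)
  have b: "norm (bump k \<delta> z) \<le> (1 + r) / 2" "(1 + r) / 2 < 1"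
    using norm_bump[of \<delta> k z] z by (simp_all add: \<delta>_def field_simps)
  note s = abs_conv_dcoef[OF hardy_abs_conv[OF a], unfolded abs_conv_def, rule_format, OF z1]
  have "norm (psum (dcoef k a) z) \<le> (\<Sum>\<^sub>\<infinity>\<alpha>. norm (zpow z \<alpha> *\<^sub>C dcoef k a \<alpha>))"
    unfolding psum_def by (rule norm_infsum_bound) (simp only: norm_scaleC s)
  also have "\<dots> \<le> (1 / \<delta>) * sqrt (hardy_kernel CARD('d) ((1 + r) / 2) * hardy_sq a)"
    unfolding norm_scaleC
  proof (rule infsum_le_finite_sums[OF s])
    fix G :: "('d \<Rightarrow> nat) set" assume G: "finite G"
    have "(\<Sum>\<alpha>\<in>G. norm (zpow z \<alpha>) * norm (dcoef k a \<alpha>)) \<le> (\<Sum>\<alpha>\<in>G. (1 / \<delta>) * (norm (zpow (bump k \<delta> z) (inc k \<alpha>)) * norm (a (inc k \<alpha>))))"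
      by (rule sum_mono) (rule dcoef_term_le[OF \<delta>])
    also have "\<dots> = (1 / \<delta>) * (\<Sum>\<alpha>\<in>inc k ` G. norm (zpow (bump k \<delta> z) \<alpha>) * norm (a \<alpha>))"
      by (subst sum.reindex) (auto intro: inj_on_subset[OF inj_inc] simp: sum_distrib_left)
    also have "\<dots> \<le> (1 / \<delta>) * sqrt (hardy_kernel CARD('d) ((1 + r) / 2) * hardy_sq a)"
      using \<delta> by (intro mult_left_mono hardy_abs_sum_le[OF a b]) (use G in auto)
    finally show "(\<Sum>\<alpha>\<in>G. norm (zpow z \<alpha>) * norm (dcoef k a \<alpha>)) \<le> (1 / \<delta>) * sqrt (hardy_kernel CARD('d) ((1 + r) / 2) * hardy_sq a)" .
  qed
  also have "\<dots> = sqrt (hardy_kernel' CARD('d) r * hardy_sq a)"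
    using z by (simp add: hardy_kernel'_def real_sqrt_mult \<delta>_def)
  finally show ?thesis .
qed

section \<open>Green's identity for the Poisson kernel\<close>

definition wirt :: "'d \<Rightarrow> (complex ^ 'd \<Rightarrow> complex) \<Rightarrow> complex \<Rightarrow> complex \<Rightarrow> complex ^ 'd \<Rightarrow> bool" where
  "wirt k h A B z \<longleftrightarrow> ((\<lambda>c. h (z + axis k c)) has_derivative (\<lambda>c. c * A + cnj c * B)) (at 0)"

lemma axis_zero [simp]: "axis k 0 = 0"
  by (simp add: axis_def vec_eq_iff)

lemma axis_add: "axis k (c + c') = axis k c + axis k (c' :: complex)"
  by (simp add: axis_def vec_eq_iff)

lemma norm_axis: "norm (axis k c) = norm (c :: complex)"
proof -
  have "(\<Sum>i\<in>UNIV. (norm (axis k c $ i))\<^sup>2) = (\<Sum>i\<in>UNIV. if i = k then (norm c)\<^sup>2 else 0)"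
    by (rule sum.cong) (auto simp: axis_def)
  then show ?thesis by (simp add: norm_vec_def L2_set_def)
qed

lemma bounded_linear_axis: "bounded_linear (axis k :: complex \<Rightarrow> complex ^ 'd)"
proof (rule bounded_linear_intro[of _ 1])
  show "axis k (r *\<^sub>R c) = r *\<^sub>R axis k c" for r and c :: complex
    by (simp add: axis_def vec_eq_iff)
qed (simp_all add: axis_add norm_axis)

text \<open>In \<open>wirtinger k h A B\<close>, the functions \<open>A\<close> and \<open>B\<close> are the derivatives of \<open>h\<close> with
  respect to the \<open>k\<close>-th coordinate and its conjugate.\<close>

definition wirtinger :: "'d \<Rightarrow> (complex ^ 'd \<Rightarrow> complex) \<Rightarrow> (complex ^ 'd \<Rightarrow> complex) \<Rightarrow> (complex ^ 'd \<Rightarrow> complex) \<Rightarrow> bool" where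
  "wirtinger k h A B \<longleftrightarrow> continuous_on (ball 0 1) h \<and> continuous_on (ball 0 1) A \<and> continuous_on (ball 0 1) B
     \<and> (\<forall>z\<in>ball 0 1. wirt k h (A z) (B z) z)"

lemma wirtinger_const: "wirtinger k (\<lambda>_. c) (\<lambda>_. 0) (\<lambda>_. 0)"
  by (simp add: wirtinger_def wirt_def)

lemma wirtinger_cnj:
  assumes "wirtinger k h A B"
  shows "wirtinger k (\<lambda>z. cnj (h z)) (\<lambda>z. cnj (B z)) (\<lambda>z. cnj (A z))"
proof -
  have "((\<lambda>c. cnj (h (z + axis k c))) has_derivative (\<lambda>c. c * cnj (B z) + cnj c * cnj (A z))) (at 0)"
    if "norm z < 1" for z
  proof -
    have "((\<lambda>c. cnj (h (z + axis k c))) has_derivative (\<lambda>c. cnj (c * A z + cnj c * B z))) (at 0)"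
      by (rule bounded_linear.has_derivative[OF bounded_linear_cnj])
        (use assms that in \<open>simp add: wirtinger_def wirt_def\<close>)
    then show ?thesis by (rule has_derivative_eq_rhs) (simp add: add.commute)
  qed
  with assms show ?thesis
    unfolding wirtinger_def wirt_def by (auto intro!: continuous_on_cnj)
qed

lemma wirtinger_add:
  "wirtinger k h A B \<Longrightarrow> wirtinger k g C D \<Longrightarrow> wirtinger k (\<lambda>z. h z + g z) (\<lambda>z. A z + C z) (\<lambda>z. B z + D z)"
  unfolding wirtinger_def wirt_def
  by (auto intro!: continuous_intros has_derivative_eq_rhs[OF has_derivative_add] simp: algebra_simps)

lemma wirtinger_mult:
  "wirtinger k h A B \<Longrightarrow> wirtinger k g C D \<Longrightarrow>
    wirtinger k (\<lambda>z. h z * g z) (\<lambda>z. h z * C z + A z * g z) (\<lambda>z. h z * D z + B z * g z)"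
  unfolding wirtinger_def wirt_def
  by (auto intro!: continuous_intros has_derivative_eq_rhs[OF has_derivative_mult] simp: algebra_simps)

lemma wirtinger_cmult:
  "wirtinger k g C D \<Longrightarrow> wirtinger k (\<lambda>z. c * g z) (\<lambda>z. c * C z) (\<lambda>z. c * D z)"
  using wirtinger_mult[OF wirtinger_const[of k c]] by simp

lemma wirtinger_diff:
  "wirtinger k h A B \<Longrightarrow> wirtinger k g C D \<Longrightarrow> wirtinger k (\<lambda>z. h z - g z) (\<lambda>z. A z - C z) (\<lambda>z. B z - D z)"
  using wirtinger_add[OF _ wirtinger_cmult[of k g C D "-1"]] by simp

lemma wirtinger_minus:
  "wirtinger k g C D \<Longrightarrow> wirtinger k (\<lambda>z. - g z) (\<lambda>z. - C z) (\<lambda>z. - D z)"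
  using wirtinger_cmult[of k g C D "-1"] by simp

lemma wirtinger_sum:
  "(\<And>i. i \<in> I \<Longrightarrow> wirtinger k (h i) (A i) (B i)) \<Longrightarrow>
    wirtinger k (\<lambda>z. \<Sum>i\<in>I. h i z) (\<lambda>z. \<Sum>i\<in>I. A i z) (\<lambda>z. \<Sum>i\<in>I. B i z)"
  by (induction I rule: infinite_finite_induct) (auto simp: wirtinger_const intro: wirtinger_add)

lemma wirtinger_coord: "wirtinger k (\<lambda>z. z $ j) (\<lambda>_. if j = k then 1 else 0) (\<lambda>_. 0)"
proof -
  have "((\<lambda>c. (z + axis k c) $ j) has_derivative (\<lambda>c. axis k c $ j)) (at 0)" for z :: "complex ^ 'a"
  proof -
    have "bounded_linear (\<lambda>c::complex. axis k c $ j)"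
      by (rule bounded_linear_compose[OF bounded_linear_vec_nth bounded_linear_axis])
    then have "((\<lambda>c. z $ j + axis k c $ j) has_derivative (\<lambda>c. 0 + axis k c $ j)) (at 0)"
      by (intro has_derivative_add has_derivative_const bounded_linear_imp_has_derivative)
    then show ?thesis by simp
  qed
  moreover have "axis k c $ j = c * (if j = k then 1 else 0)" for c :: complex
    by (simp add: axis_def)
  ultimately show ?thesis
    unfolding wirtinger_def wirt_def by (auto intro!: continuous_intros)
qed

lemma wirtinger_zpow: "wirtinger k (\<lambda>z. zpow z \<alpha>) (\<lambda>z. dzpow k z \<alpha>) (\<lambda>_. 0)"
proof -
  have d: "((\<lambda>c. z + axis k c) has_derivative (\<lambda>c. axis k c)) (at 0)" for z :: "complex ^ 'a"
    using bounded_linear.has_derivative[OF bounded_linear_axis has_derivative_ident]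
    by (auto intro!: derivative_eq_intros)
  have "((\<lambda>c. zpow (z + axis k c) \<alpha>) has_derivative (\<lambda>c. \<Sum>j\<in>UNIV. axis k c $ j * dzpow j (z + axis k 0) \<alpha>)) (at 0)" for z :: "complex ^ 'a"
    by (rule has_derivative_compose[OF d zpow_has_derivative])
  moreover have "(\<Sum>j\<in>UNIV. axis k c $ j * dzpow j z \<alpha>) = c * dzpow k z \<alpha>" for c z
    by (simp add: axis_def if_distrib[of "\<lambda>x. x * _"] cong: if_cong)
  ultimately show ?thesis
    unfolding wirtinger_def wirt_def
    by (auto intro!: continuous_intros simp: zpow_def[abs_def] dzpow_def[abs_def])
qed

lemma wirtinger_dzpow: "wirtinger k (\<lambda>z. dzpow j z \<alpha>) (\<lambda>z. of_nat (\<alpha> j) * dzpow k z (dec j \<alpha>)) (\<lambda>_. 0)"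
  using wirtinger_cmult[OF wirtinger_zpow[of k "dec j \<alpha>"], of "of_nat (\<alpha> j)"]
  by (simp add: dzpow_def)

lemma wirtinger_inverse_power:
  assumes h: "wirtinger k h A B" and nz: "\<And>z. norm z < 1 \<Longrightarrow> h z \<noteq> 0"
  shows "wirtinger k (\<lambda>z. inverse (h z) ^ m) (\<lambda>z. - of_nat m * inverse (h z) ^ Suc m * A z)
    (\<lambda>z. - of_nat m * inverse (h z) ^ Suc m * B z)"
proof -
  have "((\<lambda>c. inverse (h (z + axis k c)) ^ m) has_derivative
      (\<lambda>c. c * (- of_nat m * inverse (h z) ^ Suc m * A z) + cnj c * (- of_nat m * inverse (h z) ^ Suc m * B z))) (at 0)"
    if z: "norm z < 1" for z
  proof -
    have "((\<lambda>c. h (z + axis k c)) has_derivative (\<lambda>c. c * A z + cnj c * B z)) (at 0)"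
      using h z by (auto simp: wirtinger_def wirt_def)
    from has_derivative_power[OF Deriv.has_derivative_inverse[OF _ this], of m]
    have "((\<lambda>c. inverse (h (z + axis k c)) ^ m) has_derivative
      (\<lambda>c. of_nat m * - (inverse (h z) * (c * A z + cnj c * B z) * inverse (h z)) * inverse (h z) ^ (m - 1))) (at 0)"
      using nz[OF z] by simp
    moreover have "of_nat m * - (inverse (h z) * (c * A z + cnj c * B z) * inverse (h z)) * inverse (h z) ^ (m - 1)
      = c * (- of_nat m * inverse (h z) ^ Suc m * A z) + cnj c * (- of_nat m * inverse (h z) ^ Suc m * B z)" for c
      by (cases m) (simp_all add: algebra_simps)
    ultimately show ?thesis by simp
  qed
  then show ?thesis
    using h nz unfolding wirtinger_def wirt_def by (auto intro!: continuous_intros)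
qed

text \<open>Complex-valued, so that the Wirtinger rules apply to the squared norm.\<close>

definition nsq :: "complex ^ 'd \<Rightarrow> complex" where "nsq z = (\<Sum>j\<in>UNIV. z $ j * cnj (z $ j))"

lemma nsq: "nsq z = of_real ((norm z)\<^sup>2)"
  unfolding nsq_def norm_vec_def L2_set_def
  by (simp add: sum_nonneg complex_norm_square del: of_real_power flip: complex_norm_square)

lemma wirtinger_nsq_shift: "wirtinger k (\<lambda>z. nsq (z - \<zeta>)) (\<lambda>z. cnj ((z - \<zeta>) $ k)) (\<lambda>z. (z - \<zeta>) $ k)"
proof -
  note w = wirtinger_diff[OF wirtinger_coord wirtinger_const]
  have "wirtinger k (\<lambda>z. \<Sum>j\<in>UNIV. (z $ j - \<zeta> $ j) * cnj (z $ j - \<zeta> $ j))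
    (\<lambda>z. \<Sum>j\<in>UNIV. (z $ j - \<zeta> $ j) * cnj (0 - 0) + ((if j = k then 1 else 0) - 0) * cnj (z $ j - \<zeta> $ j))
    (\<lambda>z. \<Sum>j\<in>UNIV. (z $ j - \<zeta> $ j) * cnj ((if j = k then 1 else 0) - 0) + (0 - 0) * cnj (z $ j - \<zeta> $ j))"
    by (intro wirtinger_sum wirtinger_mult w wirtinger_cnj)
  then show ?thesis
    by (simp add: nsq_def if_distrib[of "\<lambda>x. x * _"] if_distrib[of "\<lambda>x. _ * x"] if_distrib[of cnj] cong: if_cong)
qed

lemma wirtinger_nsq: "wirtinger k nsq (\<lambda>z. cnj (z $ k)) (\<lambda>z. z $ k)"
  using wirtinger_nsq_shift[of k 0] by simp

section \<open>Integration by parts on a ball\<close>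

lemma ae_lborel_off_sphere:
  fixes P :: "'a::euclidean_space \<Rightarrow> bool"
  assumes "\<And>z. norm z \<noteq> r \<Longrightarrow> P z"
  shows "AE z in lborel. P z"
proof -
  have "sphere (0::'a) r \<in> null_sets lebesgue"
    using negligible_sphere negligible_iff_null_sets by blast
  then have "sphere (0::'a) r \<in> null_sets lborel"
    by (simp add: null_sets_completion_iff)
  then have "AE z in lborel. z \<notin> sphere (0::'a) r" by (rule AE_not_in)
  then show ?thesis by eventually_elim (use assms in auto)
qed

lemma set_integrable_ball:
  fixes f :: "'a::euclidean_space \<Rightarrow> 'b::{banach, second_countable_topology}"
  assumes "continuous_on (cball 0 r) f"
  shows "set_integrable lborel (ball 0 r) f"
proof -
  have "set_integrable lborel (cball 0 r) f"
    unfolding set_integrable_def by (rule borel_integrable_compact[OF compact_cball assms])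
  then show ?thesis by (rule set_integrable_subset) auto
qed

text \<open>Integration by parts: the function \<open>h\<close> below, cut off at the sphere of radius \<open>r\<close>, is
  Lipschitz, so by dominated convergence the integral of its derivative is the limit of
  the integrals of difference quotients, which vanish by translation invariance.\<close>

lemma integral_wirtinger_zero:
  fixes g :: "complex ^ 'd \<Rightarrow> complex"
  assumes r: "0 < r" "r < 1"
    and h: "wirtinger k (\<lambda>z. (of_real (r\<^sup>2) - nsq z) * g z) A B" and g: "continuous_on (ball 0 1) g"
  shows "(LINT z:ball 0 r|lborel. A z) = 0" "(LINT z:ball 0 r|lborel. B z) = 0"
proof -
  let ?h = "\<lambda>z. (of_real (r\<^sup>2) - nsq z) * g z"
  have sub: "cball (0::complex^'d) r \<subseteq> ball 0 1" using r by auto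
  have cont: "continuous_on (cball 0 r) g" "continuous_on (cball 0 r) A" "continuous_on (cball 0 r) B"
      "continuous_on (cball 0 r) ?h"
    using h g sub by (auto simp: wirtinger_def intro: continuous_on_subset)
  have bdd: "\<exists>K>0. \<forall>z\<in>cball 0 r. norm (f z) \<le> K" if "continuous_on (cball 0 r) f" for f :: "complex^'d \<Rightarrow> complex"
    using compact_imp_bounded[OF compact_continuous_image[OF that compact_cball]]
    by (auto simp: bounded_pos)
  obtain K where K: "K > 0" "\<And>z. norm z \<le> r \<Longrightarrow> norm (g z) \<le> K" using bdd[OF cont(1)] by auto
  obtain MA where MA: "MA > 0" "\<And>z. norm z \<le> r \<Longrightarrow> norm (A z) \<le> MA" using bdd[OF cont(2)] by auto
  obtain MB where MB: "MB > 0" "\<And>z. norm z \<le> r \<Longrightarrow> norm (B z) \<le> MB" using bdd[OF cont(3)] by auto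
  define H where "H z = indicator (ball 0 r) z *\<^sub>R ?h z" for z
  have H_in: "H z = ?h z" if "norm z < r" for z using that by (simp add: H_def)
  have H_out: "H z = 0" if "norm z \<ge> r" for z using that by (simp add: H_def)
  have intH: "integrable lborel H"
    using set_integrable_ball[OF cont(4)] unfolding set_integrable_def H_def .
  \<comment> \<open>The integrand is the derivative in the real direction \<open>axis k c\<close>;
    the choices \<open>c = 1\<close> and \<open>c = \<i>\<close> separate \<open>A\<close> from
    \<open>B\<close> at the end.\<close>
  have main: "(LINT z:ball 0 r|lborel. c * A z + cnj c * B z) = 0" if c: "norm c = 1" for c
  proof -
    define D where "D z = c * A z + cnj c * B z" for z
    have contD: "continuous_on (cball 0 r) D" unfolding D_def using cont by (intro continuous_intros)
    define M where "M = MA + MB"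
    have M: "norm (D z) \<le> M" if "norm z \<le> r" for z
    proof -
      have "norm (D z) \<le> norm (c * A z) + norm (cnj c * B z)" unfolding D_def by (rule norm_triangle_ineq)
      also have "\<dots> = norm (A z) + norm (B z)" using c by (simp add: norm_mult)
      also have "\<dots> \<le> M" unfolding M_def using MA(2)[OF that] MB(2)[OF that] by simp
      finally show ?thesis .
    qed
    have ax: "norm (axis k (of_real s * c)) = \<bar>s\<bar>" for s by (simp add: norm_axis norm_mult c)
    have deriv: "((\<lambda>t. ?h (z + axis k (of_real t * c))) has_derivative (\<lambda>s. s *\<^sub>R D (z + axis k (of_real t * c)))) (at t)"
      if "norm (z + axis k (of_real t * c)) < 1" for z t
    proof -
      let ?y = "z + axis k (of_real t * c)"
      have "((\<lambda>c. ?h (?y + axis k c)) has_derivative (\<lambda>c. c * A ?y + cnj c * B ?y)) (at (of_real (t - t) * c))"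
        using h that by (simp add: wirtinger_def wirt_def)
      moreover have "((\<lambda>s. of_real (s - t) * c) has_derivative (\<lambda>s. of_real s * c)) (at t)"
        by (auto intro!: derivative_eq_intros)
      ultimately have "((\<lambda>s. ?h (?y + axis k (of_real (s - t) * c))) has_derivative
         (\<lambda>s. (of_real s * c) * A ?y + cnj (of_real s * c) * B ?y)) (at t)"
        by (rule has_derivative_compose[rotated])
      moreover have "?y + axis k (of_real (s - t) * c) = z + axis k (of_real s * c)" for s
        by (simp add: axis_add[symmetric] algebra_simps)
      moreover have "(of_real s * c) * A ?y + cnj (of_real s * c) * B ?y = s *\<^sub>R D ?y" for s
        by (simp add: D_def scaleR_conv_of_real algebra_simps)
      ultimately show ?thesis by (simp only:)
    qed
    \<comment> \<open>For a step that crosses the sphere there is no mean value estimate for the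
      cut-off function. Instead the factor r^2 - |z|^2 is at most 2 s at the inner point.\<close>
    have mixed: "norm (?h z) \<le> 2 * K * s" if "norm z < r" "norm w \<ge> r" "norm (z - w) \<le> s" for z w s
    proof -
      have "norm w \<le> norm z + norm (z - w)" by (metis norm_minus_commute norm_triangle_sub)
      then have d: "r - norm z \<le> s" using that by linarith
      have "of_real (r\<^sup>2) - nsq z = complex_of_real (r\<^sup>2 - (norm z)\<^sup>2)" by (simp add: nsq)
      then have "norm (of_real (r\<^sup>2) - nsq z) = \<bar>r\<^sup>2 - (norm z)\<^sup>2\<bar>" by (simp only: norm_of_real)
      also have "r\<^sup>2 - (norm z)\<^sup>2 = (r + norm z) * (r - norm z)" by (simp add: power2_eq_square algebra_simps)
      also have "\<bar>\<dots>\<bar> = (r + norm z) * (r - norm z)"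
        using that(1) r by (intro abs_of_nonneg mult_nonneg_nonneg add_nonneg_nonneg) auto
      also have "\<dots> \<le> 2 * s" using that d r by (intro mult_mono) auto
      finally have "norm (of_real (r\<^sup>2) - nsq z) \<le> 2 * s" .
      moreover have "norm (g z) \<le> K" using that by (intro K(2)) simp
      moreover have "0 \<le> s" using d that by linarith
      ultimately have "norm (of_real (r\<^sup>2) - nsq z) * norm (g z) \<le> (2 * s) * K"
        by (intro mult_mono) auto
      then show ?thesis by (simp add: norm_mult mult_ac)
    qed
    define L where "L = M + 2 * K"
    have lip: "norm (H (z + axis k (of_real s * c)) - H z) \<le> L * s" if s: "0 < s" for z s
    proof -
      let ?w = "z + axis k (of_real s * c)"
      have "M \<ge> 0" using MA MB by (simp add: M_def)
      then have L: "M * s \<le> L * s" "2 * K * s \<le> L * s" "0 \<le> L * s"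
        using s K(1) by (auto simp: L_def distrib_right)
      have d: "norm (z - ?w) = s" "norm (?w - z) = s" using s ax[of s] by simp_all
      consider "norm z < r" "norm ?w < r" | "norm z < r" "norm ?w \<ge> r" | "norm z \<ge> r" "norm ?w < r"
        | "norm z \<ge> r" "norm ?w \<ge> r" by linarith
      then show ?thesis
      proof cases
        case 1
        have seg: "norm (z + axis k (of_real t * c)) < r" if "t \<in> {0..s}" for t
        proof -
          have "(t / s) *\<^sub>R ?w + (1 - t / s) *\<^sub>R z \<in> ball 0 r"
            using that s 1 by (intro convexD[OF convex_ball]) (auto simp: field_simps)
          moreover have "(t / s) *\<^sub>R ?w + (1 - t / s) *\<^sub>R z = z + axis k (of_real t * c)"
            using s by (simp add: vec_eq_iff axis_def algebra_simps scaleR_conv_of_real[where 'a = complex])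
          ultimately show ?thesis by simp
        qed
        have "norm (?h (z + axis k (of_real s * c)) - ?h (z + axis k (of_real 0 * c))) \<le> M * norm (s - 0)"
        proof (rule differentiable_bound)
          show "convex {0..s}" by simp
          show "((\<lambda>t. ?h (z + axis k (of_real t * c))) has_derivative (\<lambda>s. s *\<^sub>R D (z + axis k (of_real t * c)))) (at t within {0..s})"
            if "t \<in> {0..s}" for t
            by (rule has_derivative_at_withinI, rule deriv) (use seg[OF that] r in linarith)
          show "onorm (\<lambda>s. s *\<^sub>R D (z + axis k (of_real t * c))) \<le> M" if "t \<in> {0..s}" for t
          proof (rule onorm_le)
            have "norm (D (z + axis k (of_real t * c))) \<le> M"
              by (rule M) (use seg[OF that] in linarith)
            then show "norm (s' *\<^sub>R D (z + axis k (of_real t * c))) \<le> M * norm s'" for s' :: real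
              using mult_right_mono[of "norm (D (z + axis k (of_real t * c)))" M "norm s'"]
              by (simp add: mult.commute)
          qed
        qed (use s in auto)
        then have "norm (?h ?w - ?h z) \<le> M * s" using s by simp
        moreover have "H ?w = ?h ?w" "H z = ?h z" using 1 H_in by blast+
        ultimately show ?thesis using L(1) by (simp only:)
      next
        case 2
        then show ?thesis using mixed[OF 2, of s] d L by (simp add: H_in H_out)
      next
        case 3
        then show ?thesis using mixed[OF 3(2,1), of s] d L by (simp add: H_in H_out)
      next
        case 4
        then show ?thesis using L by (simp add: H_out)
      qed
    qed
    define s where "s n = 1 / real (Suc n)" for n
    have s: "0 < s n" "s n \<le> 1" for n by (simp_all add: s_def)
    have s0: "s \<longlonglongrightarrow> 0" unfolding s_def[abs_def] by (rule LIMSEQ_inverse_real_of_nat[unfolded inverse_eq_divide])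
    define q where "q n z = (H (z + axis k (of_real (s n) * c)) - H z) /\<^sub>R s n" for n z
    have tr: "integrable lborel (\<lambda>z. H (z + v))" "(\<integral>z. H (z + v) \<partial>lborel) = (\<integral>z. H z \<partial>lborel)" for v
    proof -
      have Hm: "H \<in> borel_measurable borel" using borel_measurable_integrable[OF intH] by simp
      have "integrable (distr lborel borel ((+) v)) H" using intH by (simp add: lborel_distr_plus)
      then show "integrable lborel (\<lambda>z. H (z + v))"
        by (subst (asm) integrable_distr_eq) (auto simp: Hm add.commute)
      have "(\<integral>z. H z \<partial>distr lborel borel ((+) v)) = (\<integral>z. H (v + z) \<partial>lborel)"
        by (rule integral_distr) (auto simp: Hm)
      then show "(\<integral>z. H (z + v) \<partial>lborel) = (\<integral>z. H z \<partial>lborel)" by (simp add: lborel_distr_plus add.commute)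
    qed
    have q0: "(\<integral>z. q n z \<partial>lborel) = 0" for n
      unfolding q_def using tr intH by simp
    have qm: "q n \<in> borel_measurable lborel" for n
      unfolding q_def using tr(1) intH by (intro borel_measurable_scaleR borel_measurable_diff borel_measurable_integrable) auto
    have "(\<lambda>n. \<integral>z. q n z \<partial>lborel) \<longlonglongrightarrow> (\<integral>z. indicator (ball 0 r) z *\<^sub>R D z \<partial>lborel)"
    proof (rule integral_dominated_convergence[where w = "\<lambda>z. L * indicator (ball 0 (r + 1)) z"])
      show "(\<lambda>z. indicator (ball 0 r) z *\<^sub>R D z) \<in> borel_measurable lborel"
        using set_integrable_ball[OF contD] unfolding set_integrable_def by (rule borel_measurable_integrable)
      show "integrable lborel (\<lambda>z. L * indicator (ball (0::complex^'d) (r + 1)) z)"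
        using emeasure_bounded_finite[OF bounded_ball, of "0::complex^'d" "r + 1"]
        by (intro integrable_mult_right integrable_real_indicator) auto
      \<comment> \<open>The step sizes are at most 1, so every difference quotient vanishes outside
        the ball of radius r + 1.\<close>
      show "AE z in lborel. norm (q n z) \<le> L * indicator (ball 0 (r + 1)) z" for n
      proof (rule AE_I2)
        fix z :: "complex ^ 'd"
        show "norm (q n z) \<le> L * indicator (ball 0 (r + 1)) z"
        proof (cases "norm z < r + 1")
          case True
          have "norm (q n z) = norm (H (z + axis k (of_real (s n) * c)) - H z) / s n"
            using s(1)[of n] by (simp add: q_def divide_inverse mult.commute)
          also have "\<dots> \<le> L" using lip[OF s(1), of z n] s(1)[of n] by (simp add: divide_le_eq)
          finally show ?thesis using True by simp
        next
          case False
          have "norm z \<le> norm (z + axis k (of_real (s n) * c)) + norm (axis k (of_real (s n) * c))"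
            by (metis add_diff_cancel_right' norm_triangle_ineq4)
          then have "r \<le> norm (z + axis k (of_real (s n) * c))" "r \<le> norm z"
            using False s[of n] ax[of "s n"] by auto
          then show ?thesis using False by (simp add: q_def H_out)
        qed
      qed
      \<comment> \<open>The sphere itself, where the cut-off function may have a kink, is a null
        set.\<close>
      show "AE z in lborel. (\<lambda>n. q n z) \<longlonglongrightarrow> indicator (ball 0 r) z *\<^sub>R D z"
      proof (rule ae_lborel_off_sphere[of r])
        fix z :: "complex ^ 'd" assume z: "norm z \<noteq> r"
        have lim: "(\<lambda>n. z + axis k (of_real (s n) * c)) \<longlonglongrightarrow> z + axis k (of_real 0 * c)"
          by (intro tendsto_intros bounded_linear.tendsto[OF bounded_linear_axis] s0)
        show "(\<lambda>n. q n z) \<longlonglongrightarrow> indicator (ball 0 r) z *\<^sub>R D z"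
        proof (cases "norm z < r")
          case True
          have ev: "\<forall>\<^sub>F n in sequentially. z + axis k (of_real (s n) * c) \<in> ball 0 r"
            by (rule topological_tendstoD[OF lim]) (use True in auto)
          have "((\<lambda>t. ?h (z + axis k (of_real t * c))) has_derivative (\<lambda>s. s *\<^sub>R D (z + axis k (of_real 0 * c)))) (at 0)"
            by (rule deriv) (use True r in auto)
          then have lim0: "((\<lambda>t. norm (?h (z + axis k (of_real t * c)) - ?h z - t *\<^sub>R D z) / norm t) \<longlongrightarrow> 0) (at 0)"
            unfolding has_derivative_at by simp
          have "filterlim s (at 0) sequentially"
            using s0 s(1) by (intro filterlim_atI) (auto intro!: always_eventually simp: less_imp_neq[symmetric])
          from filterlim_compose[OF lim0 this]
          have "(\<lambda>n. norm (?h (z + axis k (of_real (s n) * c)) - ?h z - s n *\<^sub>R D z) / norm (s n)) \<longlonglongrightarrow> 0" .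
          moreover have "\<forall>\<^sub>F n in sequentially.
            norm (?h (z + axis k (of_real (s n) * c)) - ?h z - s n *\<^sub>R D z) / norm (s n) = norm (q n z - D z)"
            using ev
          proof eventually_elim
            case (elim n)
            have "q n z - D z = (?h (z + axis k (of_real (s n) * c)) - ?h z - s n *\<^sub>R D z) /\<^sub>R s n"
              using elim True s(1)[of n] by (simp add: q_def H_in scaleR_diff_right)
            then show ?case using s(1)[of n] by (simp add: divide_inverse mult.commute)
          qed
          ultimately have "(\<lambda>n. norm (q n z - D z)) \<longlonglongrightarrow> 0" by (rule Lim_transform_eventually)
          then have "(\<lambda>n. q n z) \<longlonglongrightarrow> D z" by (rule LIM_zero_cancel[OF tendsto_norm_zero_cancel])
          then show ?thesis using True by simp
        next
          case False
          then have "z \<in> - cball 0 r" using z by auto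
          then have "\<forall>\<^sub>F n in sequentially. z + axis k (of_real (s n) * c) \<in> - cball 0 r"
            by (intro topological_tendstoD[OF lim]) auto
          then have "\<forall>\<^sub>F n in sequentially. q n z = 0"
            by eventually_elim (use False in \<open>simp add: q_def H_out\<close>)
          then show ?thesis using False by (simp add: tendsto_eventually)
        qed
      qed
    qed (rule qm)
    then show ?thesis
      unfolding set_lebesgue_integral_def D_def[symmetric] q0 by (simp add: LIMSEQ_const_iff)
  qed
  have int: "set_integrable lborel (ball 0 r) A" "set_integrable lborel (ball 0 r) B"
    by (rule set_integrable_ball, fact cont)+
  have 1: "(LINT z:ball 0 r|lborel. A z) + (LINT z:ball 0 r|lborel. B z) = 0"
    using main[of 1] int by (simp add: set_integral_add)
  have 2: "\<i> * (LINT z:ball 0 r|lborel. A z) - \<i> * (LINT z:ball 0 r|lborel. B z) = 0"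
    using main[of \<i>] int by (simp add: set_integral_diff)
  have "\<i> * ((LINT z:ball 0 r|lborel. A z) - (LINT z:ball 0 r|lborel. B z)) = 0"
    using 2 by (simp add: algebra_simps)
  then have 3: "(LINT z:ball 0 r|lborel. A z) = (LINT z:ball 0 r|lborel. B z)" by simp
  show "(LINT z:ball 0 r|lborel. A z) = 0" "(LINT z:ball 0 r|lborel. B z) = 0"
    using 1 unfolding 3 by simp_all
qed

text \<open>With \<open>\<phi> = (r\<^sup>2 - |z|\<^sup>2)\<^sup>2\<close>, \<open>p = z\<^sup>\<alpha>\<close> and \<open>q = z\<^sup>\<beta>\<close> this is
  \<open>\<Sum>\<^sub>k \<partial>\<^sub>k \<partial>\<^sub>k\<^sup>* (\<phi> p cnj q)\<close>.\<close>

definition green_density :: "real \<Rightarrow> ('d \<Rightarrow> nat) \<Rightarrow> ('d \<Rightarrow> nat) \<Rightarrow> complex ^ 'd \<Rightarrow> complex" where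
  "green_density r \<alpha> \<beta> z =
     (2 * nsq z - 2 * of_nat CARD('d) * (of_real (r\<^sup>2) - nsq z)) * (zpow z \<alpha> * cnj (zpow z \<beta>))
     - 2 * (of_real (r\<^sup>2) - nsq z) *
        (\<Sum>k\<in>UNIV. z $ k * dzpow k z \<alpha> * cnj (zpow z \<beta>) + zpow z \<alpha> * cnj (z $ k * dzpow k z \<beta>))
     + (of_real (r\<^sup>2) - nsq z)\<^sup>2 * (\<Sum>k\<in>UNIV. dzpow k z \<alpha> * cnj (dzpow k z \<beta>))"

text \<open>Green's second identity for the kernel P and v = N^2 p conj(q), where N = r^2 - |z|^2.
  In each variable, P d dbar(v) - v dbar d(P) equals d(P dbar v) - dbar(v d P). Both differentiated
  products carry a factor N, so \<open>integral_wirtinger_zero\<close> makes their integrals vanish,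
  and the sum of dbar_k d_k P over all variables is 0.\<close>

lemma poisson_green:
  fixes \<zeta> :: "complex ^ 'd"
  assumes r: "0 < r" "r < 1" and \<zeta>: "norm \<zeta> = 1"
  shows "(LINT z:ball 0 r|lborel. of_real (poisson_kernel z \<zeta>) * green_density r \<alpha> \<beta> z) = 0"
proof -
  define d where "d = CARD('d)"
  have d: "d > 0" by (simp add: d_def)
  define I where "I z = inverse (nsq (z - \<zeta>))" for z
  have nz: "nsq (z - \<zeta>) \<noteq> 0" if "norm z < 1" for z
    using that \<zeta> by (auto simp: nsq)
  have I: "I z ^ Suc m * nsq (z - \<zeta>) = I z ^ m" if "norm z < 1" for z m
    using nz[OF that] by (simp add: I_def)
  have wI: "wirtinger k (\<lambda>z. I z ^ m) (\<lambda>z. - of_nat m * I z ^ Suc m * cnj ((z - \<zeta>) $ k))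
      (\<lambda>z. - of_nat m * I z ^ Suc m * (z - \<zeta>) $ k)" for k m
    unfolding I_def by (rule wirtinger_inverse_power[OF wirtinger_nsq_shift nz])
  define P where "P z = (1 - nsq z) * I z ^ d" for z
  have P: "complex_of_real (poisson_kernel z \<zeta>) = P z" for z
    by (simp add: P_def I_def poisson_kernel_def nsq d_def power_mult divide_inverse power_inverse)
  define N where "N z = of_real (r\<^sup>2) - nsq z" for z :: "complex ^ 'd"
  define P1 where "P1 k z = - cnj (z $ k) * I z ^ d - of_nat d * ((1 - nsq z) * (I z ^ Suc d * cnj ((z - \<zeta>) $ k)))" for k z
  define P2 where "P2 k z = - z $ k * I z ^ d - of_nat d * ((1 - nsq z) * (I z ^ Suc d * (z - \<zeta>) $ k))" for k z
  have w1n: "wirtinger k (\<lambda>z. 1 - nsq z) (\<lambda>z. - cnj (z $ k)) (\<lambda>z. - z $ k)" for k :: 'd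
    using wirtinger_diff[OF wirtinger_const[of k 1] wirtinger_nsq] by simp
  have wN: "wirtinger k N (\<lambda>z. - cnj (z $ k)) (\<lambda>z. - z $ k)" for k
    unfolding N_def using wirtinger_diff[OF wirtinger_const[of k "of_real (r\<^sup>2)"] wirtinger_nsq] by simp
  have wP: "wirtinger k P (P1 k) (P2 k)" for k
  proof -
    have "wirtinger k P (\<lambda>z. (1 - nsq z) * (- of_nat d * I z ^ Suc d * cnj ((z - \<zeta>) $ k)) + - cnj (z $ k) * I z ^ d)
      (\<lambda>z. (1 - nsq z) * (- of_nat d * I z ^ Suc d * (z - \<zeta>) $ k) + - z $ k * I z ^ d)"
      unfolding P_def by (rule wirtinger_mult[OF w1n wI])
    moreover have "(\<lambda>z. (1 - nsq z) * (- of_nat d * I z ^ Suc d * cnj ((z - \<zeta>) $ k)) + - cnj (z $ k) * I z ^ d) = P1 k"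
      "(\<lambda>z. (1 - nsq z) * (- of_nat d * I z ^ Suc d * (z - \<zeta>) $ k) + - z $ k * I z ^ d) = P2 k"
      by (rule ext, simp add: P1_def P2_def algebra_simps)+
    ultimately show ?thesis by simp
  qed
  \<comment> \<open>The mixed second derivative of the kernel: \<open>wP1\<close> shows that it is
    the conjugate derivative of \<open>P1 k\<close>.\<close>
  define P12 where "P12 k z = - (I z ^ d) + of_nat d * I z ^ Suc d * (cnj (z $ k) * (z - \<zeta>) $ k + z $ k * cnj ((z - \<zeta>) $ k))
     + of_nat d * of_nat (Suc d) * (1 - nsq z) * I z ^ Suc (Suc d) * ((z - \<zeta>) $ k * cnj ((z - \<zeta>) $ k))
     - of_nat d * (1 - nsq z) * I z ^ Suc d" for k z
  have wP1: "\<exists>A. wirtinger k (P1 k) A (P12 k)" for k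
  proof -
    have a: "wirtinger k (\<lambda>z. - cnj (z $ k)) (\<lambda>_. - cnj 0) (\<lambda>_. - cnj 1)"
      using wirtinger_minus[OF wirtinger_cnj[OF wirtinger_coord[of k k]]] by simp
    have b: "wirtinger k (\<lambda>z. cnj ((z - \<zeta>) $ k)) (\<lambda>_. 0) (\<lambda>_. 1)"
      using wirtinger_cnj[OF wirtinger_diff[OF wirtinger_coord[of k k] wirtinger_const[of k "\<zeta> $ k"]]] by simp
    note w = wirtinger_diff[OF wirtinger_mult[OF a wI[of k d]]
      wirtinger_cmult[OF wirtinger_mult[OF w1n wirtinger_mult[OF wI[of k "Suc d"] b]], of "of_nat d"]]
    show ?thesis
      unfolding P1_def
      by (rule exI, rule back_subst[of "wirtinger k _ _", OF w]) 
        (rule ext, simp add: P12_def algebra_simps)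
  qed
  \<comment> \<open>Harmonicity of the kernel. By \<open>cross\<close> the mixed products are
    expressed through |z|^2, |\<zeta>|^2 and the squared distance of the two points; then |\<zeta>|
    = 1 makes everything cancel.\<close>
  have P12_sum: "(\<Sum>k\<in>UNIV. P12 k z) = 0" if z: "norm z < 1" for z
  proof -
    have cross: "cnj (z $ k) * (z - \<zeta>) $ k + z $ k * cnj ((z - \<zeta>) $ k)
      = z $ k * cnj (z $ k) + (z - \<zeta>) $ k * cnj ((z - \<zeta>) $ k) - \<zeta> $ k * cnj (\<zeta> $ k)" for k
      by (simp add: algebra_simps)
    have "(\<Sum>k\<in>UNIV. P12 k z) = - of_nat d * I z ^ d + of_nat d * I z ^ Suc d * (nsq z + nsq (z - \<zeta>) - nsq \<zeta>)
       + of_nat d * of_nat (Suc d) * (1 - nsq z) * I z ^ Suc (Suc d) * nsq (z - \<zeta>)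
       - of_nat d * (of_nat d * (1 - nsq z) * I z ^ Suc d)"
      unfolding P12_def cross
      by (simp add: sum.distrib sum_subtractf nsq_def d_def sum_distrib_left[symmetric] del: power_Suc of_nat_Suc)
    also have "nsq \<zeta> = 1" using \<zeta> by (simp add: nsq)
    also have "of_nat d * of_nat (Suc d) * (1 - nsq z) * I z ^ Suc (Suc d) * nsq (z - \<zeta>)
      = of_nat d * of_nat (Suc d) * (1 - nsq z) * I z ^ Suc d"
      using I[OF z, of "Suc d"] by (simp only: mult.assoc)
    also have "of_nat d * I z ^ Suc d * (nsq z + nsq (z - \<zeta>) - 1)
      = of_nat d * I z ^ Suc d * (nsq z - 1) + of_nat d * (I z ^ Suc d * nsq (z - \<zeta>))"
      by (simp add: algebra_simps)
    also have "I z ^ Suc d * nsq (z - \<zeta>) = I z ^ d" by (rule I[OF z])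
    finally show ?thesis by (simp add: algebra_simps)
  qed
  let ?p = "\<lambda>z. zpow z \<alpha>" and ?q = "\<lambda>z. zpow z \<beta>"
  let ?dp = "\<lambda>k z. dzpow k z \<alpha>" and ?dq = "\<lambda>k z. dzpow k z \<beta>"
  have wq: "wirtinger k (\<lambda>z. cnj (?q z)) (\<lambda>z. 0) (\<lambda>z. cnj (?dq k z))" for k
    using wirtinger_cnj[OF wirtinger_zpow[of k \<beta>]] by simp
  have wdq: "wirtinger k (\<lambda>z. cnj (?dq k z)) (\<lambda>z. 0) (\<lambda>z. cnj (of_nat (\<beta> k) * dzpow k z (dec k \<beta>)))" for k
    using wirtinger_cnj[OF wirtinger_dzpow[of k k \<beta>]] by simp
  have wm2z: "wirtinger k (\<lambda>z. - 2 * z $ k) (\<lambda>z. - 2) (\<lambda>z. 0)" for k :: 'd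
    using wirtinger_cmult[OF wirtinger_coord[of k k], of "- 2"] by simp
  have cont: "continuous_on (ball 0 1) h" if "wirtinger k h A B" for k :: 'd and h A B
    using that by (simp add: wirtinger_def)
  \<comment> \<open>Chosen so that \<open>N z * E k z\<close> is the conjugate derivative of N^2 p
    conj(q) in the \<open>k\<close>-th variable.\<close>
  define E where "E k z = - 2 * z $ k * (?p z * cnj (?q z)) + N z * (?p z * cnj (?dq k z))" for k z
  define E1 where "E1 k z = - 2 * (?p z * cnj (?q z)) - 2 * z $ k * (?dp k z * cnj (?q z))
     - cnj (z $ k) * (?p z * cnj (?dq k z)) + N z * (?dp k z * cnj (?dq k z))" for k z
  have wE: "\<exists>B. wirtinger k (E k) (E1 k) B" for k
  proof -
    note w = wirtinger_add[OF wirtinger_mult[OF wm2z wirtinger_mult[OF wirtinger_zpow[of k \<alpha>] wq]]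
       wirtinger_mult[OF wN wirtinger_mult[OF wirtinger_zpow[of k \<alpha>] wdq]]]
    show ?thesis
      unfolding E_def
      by (rule exI, rule back_subst[of "\<lambda>A. wirtinger k _ A _", OF w])
        (rule ext, simp add: E1_def algebra_simps)
  qed
  \<comment> \<open>The derivative of N P E, arranged as a product with the factor \<open>N\<close>
    in front to match \<open>integral_wirtinger_zero\<close>.\<close>
  define A1 where "A1 k z = N z * (P z * E1 k z + P1 k z * E k z) - cnj (z $ k) * (P z * E k z)" for k z
  have int1: "(LINT z:ball 0 r|lborel. A1 k z) = 0" "continuous_on (ball 0 1) (A1 k)" for k
  proof -
    obtain B where B: "wirtinger k (E k) (E1 k) B" using wE by blast
    note w = wirtinger_mult[OF wN wirtinger_mult[OF wP B]]
    have e: "(\<lambda>z. N z * (P z * E1 k z + P1 k z * E k z) + - cnj (z $ k) * (P z * E k z)) = A1 k"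
      by (rule ext) (simp add: A1_def)
    show "(LINT z:ball 0 r|lborel. A1 k z) = 0"
      by (rule integral_wirtinger_zero(1)[OF r w[unfolded e, unfolded N_def]])
        (intro continuous_on_mult cont[OF wP] cont[OF B])
    show "continuous_on (ball 0 1) (A1 k)" using w unfolding e by (simp add: wirtinger_def)
  qed
  \<comment> \<open>The conjugate derivative of N^2 p conj(q) times \<open>P1 k\<close>, again with
    one factor \<open>N\<close> split off.\<close>
  define B1 where "B1 k z = N z * (N z * (P1 k z * (?p z * cnj (?dq k z)) + P12 k z * (?p z * cnj (?q z)))
      - z $ k * (P1 k z * (?p z * cnj (?q z)))) - z $ k * (N z * (P1 k z * (?p z * cnj (?q z))))" for k z
  have int2: "(LINT z:ball 0 r|lborel. B1 k z) = 0" "continuous_on (ball 0 1) (B1 k)" for k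
  proof -
    obtain A where A: "wirtinger k (P1 k) A (P12 k)" using wP1 by blast
    note w' = wirtinger_mult[OF wN wirtinger_mult[OF A wirtinger_mult[OF wirtinger_zpow[of k \<alpha>] wq]]]
    note w = wirtinger_mult[OF wN w']
    have e: "(\<lambda>z. N z * (N z * (P1 k z * (?p z * cnj (?dq k z) + 0 * cnj (?q z)) + P12 k z * (?p z * cnj (?q z)))
      + - z $ k * (P1 k z * (?p z * cnj (?q z)))) + - z $ k * (N z * (P1 k z * (?p z * cnj (?q z))))) = B1 k"
      by (rule ext) (simp add: B1_def)
    show "(LINT z:ball 0 r|lborel. B1 k z) = 0"
      by (rule integral_wirtinger_zero(2)[OF r w[unfolded e, unfolded N_def]])
        (use cont[OF w'] in \<open>simp add: N_def\<close>)
    show "continuous_on (ball 0 1) (B1 k)" using w unfolding e by (simp add: wirtinger_def)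
  qed
  \<comment> \<open>The terms with \<open>P1 k\<close> cancel in the difference, and the second
    derivatives of the kernel enter only through \<open>P12 k\<close>, whose sum over
    \<open>k\<close> is 0.\<close>
  have alg: "P z * green_density r \<alpha> \<beta> z = (\<Sum>k\<in>UNIV. A1 k z - B1 k z)" if z: "norm z < 1" for z
  proof -
    have "A1 k z - B1 k z = P z * ((2 * (z $ k * cnj (z $ k)) - 2 * N z) * (?p z * cnj (?q z))
        - 2 * N z * (z $ k * ?dp k z * cnj (?q z) + ?p z * cnj (z $ k * ?dq k z))
        + (N z)\<^sup>2 * (?dp k z * cnj (?dq k z))) - (N z)\<^sup>2 * (?p z * cnj (?q z)) * P12 k z" for k
      by (simp add: A1_def B1_def E_def E1_def power2_eq_square algebra_simps)
    then have "(\<Sum>k\<in>UNIV. A1 k z - B1 k z) = P z * ((\<Sum>k\<in>UNIV. (2 * (z $ k * cnj (z $ k)) - 2 * N z) * (?p z * cnj (?q z)))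
        - 2 * N z * (\<Sum>k\<in>UNIV. z $ k * ?dp k z * cnj (?q z) + ?p z * cnj (z $ k * ?dq k z))
        + (N z)\<^sup>2 * (\<Sum>k\<in>UNIV. ?dp k z * cnj (?dq k z))) - (N z)\<^sup>2 * (?p z * cnj (?q z)) * (\<Sum>k\<in>UNIV. P12 k z)"
      by (simp only: sum.distrib sum_subtractf sum_distrib_left[symmetric])
    also have "(\<Sum>k\<in>UNIV. (2 * (z $ k * cnj (z $ k)) - 2 * N z) * (?p z * cnj (?q z)))
       = (2 * nsq z - 2 * of_nat CARD('d) * N z) * (?p z * cnj (?q z))"
      by (simp add: sum_distrib_right[symmetric] sum_subtractf sum_distrib_left[symmetric] nsq_def mult.assoc mult.left_commute[of _ "of_nat _"])
    finally show ?thesis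
      by (simp add: P12_sum[OF z] green_density_def N_def)
  qed
  have sub: "cball (0::complex^'d) r \<subseteq> ball 0 1" "ball (0::complex^'d) r \<subseteq> ball 0 1" using r by auto
  have si: "set_integrable lborel (ball 0 r) (A1 k)" "set_integrable lborel (ball 0 r) (B1 k)" for k
    by (rule set_integrable_ball, rule continuous_on_subset[OF _ sub(1)], rule int1(2) int2(2))+
  have "(LINT z:ball 0 r|lborel. of_real (poisson_kernel z \<zeta>) * green_density r \<alpha> \<beta> z)
    = (LINT z:ball 0 r|lborel. (\<Sum>k\<in>UNIV. A1 k z - B1 k z))"
    by (rule set_lebesgue_integral_cong) (use alg sub in \<open>auto simp: P\<close>)
  also have "\<dots> = (\<Sum>k\<in>UNIV. (LINT z:ball 0 r|lborel. A1 k z - B1 k z))"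
    unfolding set_lebesgue_integral_def scaleR_sum_right
    by (rule Bochner_Integration.integral_sum)
      (use set_integral_diff(1)[OF si] in \<open>simp add: set_integrable_def\<close>)
  also have "\<dots> = 0" by (simp add: set_integral_diff(2)[OF si] int1 int2)
  finally show ?thesis .
qed

section \<open>The Poisson integral as a sesquilinear form\<close>

context semispectral
begin

text \<open>On the unit ball this is the form of the operator \<open>poisson_integral F z\<close>,
  by \<open>W_eq\<close>. Being built from integrals against fixed measures, it shows the
  measurability in \<open>z\<close>.\<close>

definition W :: "complex ^ 'd \<Rightarrow> 'm \<Rightarrow> 'm \<Rightarrow> complex" where
  "W z = semi_form F (poisson_kernel z)"

lemma W_def': "W z x y = (\<Sum>k<4. \<i> ^ k * of_real (U z (polar_vec k x y)))"
  by (simp add: W_def semi_form_def U_def)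

context
  fixes z :: "complex ^ 'd"
  assumes z: "norm z < 1"
begin

lemma W_eq: "W z x y = cinner (poisson_integral F z x) y"
  using poisson_integral(2)[OF z] by (simp add: W_def)

lemma u_linear: "bounded_linear (poisson_integral F z)"
  "poisson_integral F z (c *\<^sub>C x) = c *\<^sub>C poisson_integral F z x"
  using poisson_integral(1)[OF z] by (auto simp: bounded_clinear_def)

lemma W_add_left: "W z (x + x') y = W z x y + W z x' y"
  by (simp add: W_eq linear_add[OF bounded_linear.linear[OF u_linear(1)]] cinner_add_left)

lemma W_add_right: "W z x (y + y') = W z x y + W z x y'"
  by (simp add: W_eq cinner_add_right)

lemma W_scale_left: "W z (c *\<^sub>C x) y = c * W z x y"
  by (simp add: W_eq u_linear cinner_scaleC_left)

lemma W_scale_right: "W z x (c *\<^sub>C y) = cnj c * W z x y"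
  by (simp add: W_eq cinner_scaleC_right)

lemma W_zero_left [simp]: "W z 0 y = 0"
  using W_scale_left[of 0 0 y] by simp

lemma W_zero_right [simp]: "W z x 0 = 0"
  using W_scale_right[of x 0 0] by simp

lemma W_diff_left: "W z (x - x') y = W z x y - W z x' y"
  using W_add_left[of "x - x'" x' y] by simp

lemma W_diff_right: "W z x (y - y') = W z x y - W z x y'"
  using W_add_right[of x "y - y'" y'] by simp

lemma W_sum_left: "W z (\<Sum>i\<in>I. f i) y = (\<Sum>i\<in>I. W z (f i) y)"
  by (induction I rule: infinite_finite_induct) (auto simp: W_add_left)

lemma W_sum_right: "W z x (\<Sum>i\<in>I. f i) = (\<Sum>i\<in>I. W z x (f i))"
  by (induction I rule: infinite_finite_induct) (auto simp: W_add_right)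

lemma W_self: "W z x x = of_real (U z x)"
  using poisson_integral_self[OF z] by (simp add: W_eq)

lemma W_bound: "norm z \<le> r \<Longrightarrow> r < 1 \<Longrightarrow> cmod (W z x y) \<le> K r * norm x * norm y"
  using poisson_integral_bound[OF z] by (simp add: W_eq)

lemma W_le: "cmod (W z x y) \<le> U z x + U z y"
  using poisson_integral_le[OF z] by (simp add: W_eq)

text \<open>The diagonal of \<open>W z\<close> is real; at \<open>x + y\<close> this gives the
  imaginary part of the symmetry and at \<open>x + \<i> *\<^sub>C y\<close> the real part.\<close>

lemma W_commute: "W z x y = cnj (W z y x)"
proof -
  have "W z (x + y) (x + y) = W z x x + W z y y + (W z x y + W z y x)"
    by (simp add: W_add_left W_add_right)
  then have "W z x y + W z y x = of_real (U z (x + y) - U z x - U z y)"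
    by (simp add: W_self algebra_simps)
  then have 1: "Im (W z x y + W z y x) = 0" by simp
  have "W z (x + \<i> *\<^sub>C y) (x + \<i> *\<^sub>C y) = W z x x + W z y y + \<i> * (W z y x - W z x y)"
    by (simp add: W_add_left W_add_right W_scale_left W_scale_right algebra_simps)
  then have "\<i> * (W z y x - W z x y) = of_real (U z (x + \<i> *\<^sub>C y) - U z x - U z y)"
    by (simp add: W_self algebra_simps)
  then have "Im (\<i> * (W z y x - W z x y)) = 0" by simp
  then show ?thesis using 1 by (simp add: complex_eq_iff)
qed

text \<open>The parallelogram law with a nonnegative term dropped.\<close>

lemma U_add_le: "U z (x + y) \<le> 2 * U z x + 2 * U z y"
proof -
  have "complex_of_real (U z (x + y) + U z (x - y)) = of_real (2 * U z x + 2 * U z y)"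
    by (simp add: W_self[symmetric] W_add_left W_add_right W_diff_left W_diff_right)
  then have "U z (x + y) + U z (x - y) = 2 * U z x + 2 * U z y" by (simp only: of_real_eq_iff)
  then show ?thesis using U_nonneg[OF z, of "x - y"] by simp
qed

lemma U_scale: "U z (c *\<^sub>C x) = (cmod c)\<^sup>2 * U z x"
proof -
  have "complex_of_real (U z (c *\<^sub>C x)) = c * cnj c * of_real (U z x)"
    by (simp add: W_self[symmetric] W_scale_left W_scale_right)
  also have "\<dots> = of_real ((cmod c)\<^sup>2 * U z x)" by (simp flip: complex_norm_square)
  finally show ?thesis by (simp only: of_real_eq_iff)
qed

lemma W_tendsto:
  assumes "(f \<longlongrightarrow> x) G" "(g \<longlongrightarrow> y) G"
  shows "((\<lambda>n. W z (f n) (g n)) \<longlongrightarrow> W z x y) G"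
  unfolding W_eq by (intro tendsto_cinner bounded_linear.tendsto[OF u_linear(1)] assms)

lemma U_tendsto:
  assumes "(f \<longlongrightarrow> x) G"
  shows "((\<lambda>n. U z (f n)) \<longlongrightarrow> U z x) G"
proof -
  have "((\<lambda>n. Re (W z (f n) (f n))) \<longlongrightarrow> Re (W z x x)) G"
    by (intro tendsto_Re W_tendsto assms)
  then show ?thesis by (simp add: W_self)
qed

end

section \<open>Measurability and Fubini's theorem\<close>

lemma kernel_measurable_pair:
  "(\<lambda>(z, \<zeta>). poisson_kernel z \<zeta>) \<in> borel_measurable (lborel \<Otimes>\<^sub>M semi_measure F v)"
proof -
  have id: "(\<lambda>x. x) \<in> measurable (semi_measure F v) borel"
  proof -
    have "(\<lambda>x. x) \<in> measurable sphere_borel (borel :: (complex ^ 'd) measure)"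
      unfolding sphere_borel_def by (rule measurable_restrict_space1) simp
    then show ?thesis by (subst measurable_cong_sets[OF semi_measure(1) refl])
  qed
  have [measurable]: "snd \<in> measurable (lborel \<Otimes>\<^sub>M semi_measure F v) borel"
    using measurable_compose[OF measurable_snd id] .
  have [measurable]: "fst \<in> measurable ((lborel :: (complex ^ 'd) measure) \<Otimes>\<^sub>M semi_measure F v) borel"
    using measurable_fst[of "lborel :: (complex ^ 'd) measure" "semi_measure F v"] by simp
  show ?thesis unfolding poisson_kernel_def case_prod_beta by measurable
qed

lemma U_measurable [measurable]: "(\<lambda>z. U z v) \<in> borel_measurable borel"
proof -
  interpret M: finite_measure "semi_measure F v" by (rule semi_measure(2))
  have "(\<lambda>z. U z v) \<in> borel_measurable lborel"
    unfolding U_def semi_integral_def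
    by (rule M.borel_measurable_lebesgue_integral) (rule kernel_measurable_pair)
  then show ?thesis by simp
qed

lemma W_measurable [measurable]: "(\<lambda>z. W z x y) \<in> borel_measurable borel"
  unfolding W_def' by measurable

lemma ball_measurable [measurable]: "ball (0 :: complex ^ 'd) r \<in> sets borel"
  by (rule borel_open) simp

lemma continuous_zpow: "continuous_on S (\<lambda>z. zpow z \<alpha>)"
  unfolding zpow_def by (intro continuous_intros)

lemma continuous_dzpow: "continuous_on S (\<lambda>z. dzpow k z \<alpha>)"
  unfolding dzpow_def by (intro continuous_intros continuous_zpow)

lemma continuous_green_density: "continuous_on S (green_density r \<alpha> \<beta>)"
  unfolding green_density_def[abs_def] nsq_def
  by (intro continuous_intros continuous_zpow continuous_dzpow)

lemma green_density_bounded: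
  "\<exists>G. \<forall>z. norm z \<le> r \<longrightarrow> norm (green_density r \<alpha> \<beta> z) \<le> G"
proof -
  have "bounded (green_density r \<alpha> \<beta> ` cball 0 r)"
    by (rule compact_imp_bounded[OF compact_continuous_image[OF continuous_green_density compact_cball]])
  then obtain G where "\<forall>z\<in>cball 0 r. norm (green_density r \<alpha> \<beta> z) \<le> G"
    by (auto simp: bounded_iff)
  then show ?thesis by (intro exI[of _ G]) simp
qed

text \<open>Fubini: for fixed \<zeta> the integral over \<open>z\<close> vanishes by
  \<open>poisson_green\<close>. On the ball of radius r < 1 the kernel and the density are bounded,
  and the product of the ball with the sphere has finite measure, whence joint
  integrability.\<close>

lemma U_green_zero:
  fixes \<alpha> \<beta> :: "'d \<Rightarrow> nat"
  assumes r: "0 < r" "r < 1"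
  shows "(LINT z:ball 0 r|lborel. of_real (U z v) * green_density r \<alpha> \<beta> z) = 0"
proof -
  let ?M = "semi_measure F v"
  interpret M: finite_measure ?M by (rule semi_measure(2))
  interpret P: pair_sigma_finite "lborel :: (complex ^ 'd) measure" ?M ..
  define f where "f z \<zeta> = indicator (ball 0 r) z *\<^sub>R (of_real (poisson_kernel z \<zeta>) * green_density r \<alpha> \<beta> z)" for z \<zeta>
  obtain G where G: "\<And>z. norm z \<le> r \<Longrightarrow> norm (green_density r \<alpha> \<beta> z) \<le> G"
    using green_density_bounded by blast
  define C where "C = (1 / (1 - r) ^ (2 * CARD('d))) * G"
  have bound: "norm (f z \<zeta>) \<le> C * indicator (ball 0 r) z" if \<zeta>: "\<zeta> \<in> sphere 0 1" for z \<zeta>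
  proof (cases "norm z < r")
    case True
    have "norm (f z \<zeta>) = poisson_kernel z \<zeta> * norm (green_density r \<alpha> \<beta> z)"
      using True r poisson_kernel_nonneg[of z \<zeta>] by (simp add: f_def norm_mult)
    also have "\<dots> \<le> C"
      unfolding C_def using True r \<zeta>
      by (intro mult_mono poisson_kernel_le G) auto
    finally show ?thesis using True by simp
  qed (simp add: f_def)
  have [measurable]: "green_density r \<alpha> \<beta> \<in> borel_measurable borel"
    by (rule borel_measurable_continuous_onI[OF continuous_green_density])
  have fm: "case_prod f \<in> borel_measurable ((lborel :: (complex ^ 'd) measure) \<Otimes>\<^sub>M ?M)"
  proof -
    have [measurable]: "(\<lambda>p. poisson_kernel (fst p) (snd p)) \<in> borel_measurable ((lborel :: (complex ^ 'd) measure) \<Otimes>\<^sub>M ?M)"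
      using kernel_measurable_pair[of v] by (simp add: case_prod_beta')
    have [measurable]: "fst \<in> measurable ((lborel :: (complex ^ 'd) measure) \<Otimes>\<^sub>M ?M) borel"
      using measurable_fst[of "lborel :: (complex ^ 'd) measure" ?M] by simp
    show ?thesis unfolding f_def case_prod_beta' by measurable
  qed
  have int: "integrable ((lborel :: (complex ^ 'd) measure) \<Otimes>\<^sub>M ?M) (case_prod f)"
  proof (rule Bochner_Integration.integrable_bound[OF _ fm])
    show "integrable ((lborel :: (complex ^ 'd) measure) \<Otimes>\<^sub>M ?M) (\<lambda>p. C * indicator (ball 0 r \<times> space ?M) p)"
    proof (intro integrable_mult_right integrable_real_indicator)
      have "emeasure ((lborel :: (complex ^ 'd) measure) \<Otimes>\<^sub>M ?M) (ball 0 r \<times> space ?M) = emeasure lborel (ball (0::complex^'d) r) * emeasure ?M (space ?M)"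
        by (rule M.emeasure_pair_measure_Times) auto
      also have "\<dots> < \<infinity>"
        using emeasure_bounded_finite[OF bounded_ball, of "0::complex^'d" r]
        by (simp add: ennreal_mult_less_top M.emeasure_eq_measure)
      finally show "emeasure ((lborel :: (complex ^ 'd) measure) \<Otimes>\<^sub>M ?M) (ball 0 r \<times> space ?M) < \<infinity>" .
    qed auto
    show "AE p in (lborel :: (complex ^ 'd) measure) \<Otimes>\<^sub>M ?M. norm (case_prod f p) \<le> norm (C * indicator (ball 0 r \<times> space ?M) p)"
    proof (rule AE_I2)
      fix p assume "p \<in> space ((lborel :: (complex ^ 'd) measure) \<Otimes>\<^sub>M ?M)"
      then obtain z \<zeta> where p: "p = (z, \<zeta>)" and \<zeta>: "\<zeta> \<in> space ?M" by (auto simp: space_pair_measure)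
      have "norm (f z \<zeta>) \<le> C * indicator (ball 0 r) z"
        using \<zeta> by (intro bound) (simp add: space_semi_measure)
      then show "norm (case_prod f p) \<le> norm (C * indicator (ball 0 r \<times> space ?M) p)"
        using \<zeta> by (auto simp: p indicator_def split: if_splits)
    qed
  qed
  have 1: "(\<integral>\<zeta>. f z \<zeta> \<partial>?M) = indicator (ball 0 r) z *\<^sub>R (of_real (U z v) * green_density r \<alpha> \<beta> z)" for z
    unfolding f_def U_def semi_integral_def by simp
  have 2: "(\<integral>z. f z \<zeta> \<partial>lborel) = 0" if "\<zeta> \<in> space ?M" for \<zeta>
    using poisson_green[OF r, of \<zeta> \<alpha> \<beta>] that
    unfolding f_def set_lebesgue_integral_def by (simp add: space_semi_measure)
  have "(\<integral>z. (\<integral>\<zeta>. f z \<zeta> \<partial>?M) \<partial>lborel) = (\<integral>\<zeta>. (\<integral>z. f z \<zeta> \<partial>lborel) \<partial>?M)"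
    by (rule P.Fubini_integral[OF int, symmetric])
  also have "\<dots> = (\<integral>\<zeta>. 0 \<partial>?M)" by (rule Bochner_Integration.integral_cong) (simp_all add: 2)
  finally show ?thesis by (simp add: 1 set_lebesgue_integral_def)
qed

text \<open>\<open>W z x y\<close> is a combination of four values of \<open>U z\<close>, so the
  identity carries over by polarization.\<close>

lemma W_green_zero:
  fixes \<alpha> \<beta> :: "'d \<Rightarrow> nat"
  assumes r: "0 < r" "r < 1"
  shows "set_integrable lborel (ball 0 r) (\<lambda>z. W z x y * green_density r \<alpha> \<beta> z)"
    "(LINT z:ball 0 r|lborel. W z x y * green_density r \<alpha> \<beta> z) = 0"
proof -
  obtain G where G: "\<And>z. norm z \<le> r \<Longrightarrow> norm (green_density r \<alpha> \<beta> z) \<le> G"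
    using green_density_bounded by blast
  have [measurable]: "green_density r \<alpha> \<beta> \<in> borel_measurable borel"
    by (rule borel_measurable_continuous_onI[OF continuous_green_density])
  have si: "set_integrable lborel (ball 0 r) (\<lambda>z. of_real (U z v) * green_density r \<alpha> \<beta> z)" for v
    unfolding set_integrable_def
  proof (rule Bochner_Integration.integrable_bound)
    show "integrable lborel (\<lambda>z. (K r * norm v * norm v * G) * indicator (ball (0::complex^'d) r) z)"
      using emeasure_bounded_finite[OF bounded_ball, of "0::complex^'d" r]
      by (intro integrable_mult_right integrable_real_indicator) auto
    show "AE z in lborel. norm (indicator (ball 0 r) z *\<^sub>R (of_real (U z v) * green_density r \<alpha> \<beta> z))
        \<le> norm ((K r * norm v * norm v * G) * indicator (ball 0 r) z)"
    proof (rule AE_I2)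
      fix z :: "complex ^ 'd"
      show "norm (indicator (ball 0 r) z *\<^sub>R (of_real (U z v) * green_density r \<alpha> \<beta> z))
        \<le> norm ((K r * norm v * norm v * G) * indicator (ball 0 r) z)"
      proof (cases "norm z < r")
        case True
        then have z: "norm z < 1" using r by simp
        have le: "norm (complex_of_real (U z v)) \<le> K r * norm v * norm v"
          using W_bound[OF z, of r v v] True r by (simp add: W_self[OF z])
        have "norm (of_real (U z v) * green_density r \<alpha> \<beta> z) \<le> (K r * norm v * norm v) * G"
          unfolding norm_mult
          by (rule mult_mono[OF le G order_trans[OF norm_ge_zero le] norm_ge_zero]) (use True in simp)
        then show ?thesis using True by simp
      qed simp
    qed
  qed measurable
  have e: "W z x y * green_density r \<alpha> \<beta> z
      = (\<Sum>k<4. \<i> ^ k * (of_real (U z (polar_vec k x y)) * green_density r \<alpha> \<beta> z))" for z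
    by (simp add: W_def' sum_distrib_right mult.assoc)
  have si': "set_integrable lborel (ball 0 r) (\<lambda>z. \<i> ^ k * (of_real (U z (polar_vec k x y)) * green_density r \<alpha> \<beta> z))" for k
    by (intro set_integrable_mult_right si)
  have "set_integrable lborel (ball 0 r) (\<lambda>z. \<Sum>k<4. \<i> ^ k * (of_real (U z (polar_vec k x y)) * green_density r \<alpha> \<beta> z))"
    using si' unfolding set_integrable_def scaleR_sum_right by (rule Bochner_Integration.integrable_sum)
  then show "set_integrable lborel (ball 0 r) (\<lambda>z. W z x y * green_density r \<alpha> \<beta> z)" unfolding e .
  have "(LINT z:ball 0 r|lborel. (\<Sum>k<4. \<i> ^ k * (of_real (U z (polar_vec k x y)) * green_density r \<alpha> \<beta> z)))
    = (\<Sum>k<4. LINT z:ball 0 r|lborel. \<i> ^ k * (of_real (U z (polar_vec k x y)) * green_density r \<alpha> \<beta> z))"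
    using si' unfolding set_integrable_def set_lebesgue_integral_def scaleR_sum_right
    by (rule Bochner_Integration.integral_sum)
  also have "\<dots> = 0" by (simp add: U_green_zero[OF r])
  finally show "(LINT z:ball 0 r|lborel. W z x y * green_density r \<alpha> \<beta> z) = 0" unfolding e .
qed

section \<open>Green's identity for functions in the Hardy space\<close>

definition trunc :: "nat \<Rightarrow> (('d \<Rightarrow> nat) \<Rightarrow> 'm) \<Rightarrow> ('d \<Rightarrow> nat) \<Rightarrow> 'm" where
  "trunc n a \<alpha> = (if mdeg \<alpha> \<le> n then a \<alpha> else 0)"

lemma hardy_summable_trunc:
  assumes "hardy_summable a"
  shows "hardy_summable (trunc n a)" "hardy_sq (trunc n a) \<le> hardy_sq a"
proof -
  show 1: "hardy_summable (trunc n a)"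
    unfolding hardy_summable_def
    by (rule nonneg_summable_on_le[OF assms[unfolded hardy_summable_def]])
      (auto simp: trunc_def intro!: hardy_term_nonneg mult_nonneg_nonneg less_imp_le[OF monomial_norm_sq_pos])
  show "hardy_sq (trunc n a) \<le> hardy_sq a"
    unfolding hardy_sq_def
    by (rule infsum_mono[OF 1[unfolded hardy_summable_def] assms[unfolded hardy_summable_def]])
      (auto simp: trunc_def intro!: mult_nonneg_nonneg less_imp_le[OF monomial_norm_sq_pos])
qed

lemma psum_trunc: "psum (trunc n a) z = (\<Sum>\<alpha> | mdeg \<alpha> \<le> n. zpow z \<alpha> *\<^sub>C a \<alpha>)"
proof -
  have "psum (trunc n a) z = (\<Sum>\<^sub>\<infinity>\<alpha>\<in>{\<alpha>. mdeg \<alpha> \<le> n}. zpow z \<alpha> *\<^sub>C a \<alpha>)"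
    unfolding psum_def by (rule infsum_cong_neutral) (auto simp: trunc_def)
  then show ?thesis by (simp add: finite_mdeg_le)
qed

lemma psum_dcoef_trunc:
  assumes "abs_conv a" "norm z < 1"
  shows "psum (dcoef k (trunc n a)) z = (\<Sum>\<alpha> | mdeg \<alpha> \<le> n. dzpow k z \<alpha> *\<^sub>C a \<alpha>)"
proof -
  have "abs_conv (trunc n a)"
    unfolding abs_conv_def
  proof (intro allI impI)
    fix z :: "complex ^ 'd" assume "norm z < 1"
    with assms(1) have "(\<lambda>\<alpha>. norm (zpow z \<alpha>) * norm (a \<alpha>)) summable_on UNIV" by (simp add: abs_conv_def)
    then show "(\<lambda>\<alpha>. norm (zpow z \<alpha>) * norm (trunc n a \<alpha>)) summable_on UNIV"
      by (rule nonneg_summable_on_le) (auto simp: trunc_def)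
  qed
  then have "((\<lambda>\<alpha>. dzpow k z \<alpha> *\<^sub>C trunc n a \<alpha>) has_sum psum (dcoef k (trunc n a)) z) UNIV"
    by (rule dzpow_has_sum[OF _ assms(2)])
  then have "((\<lambda>\<alpha>. dzpow k z \<alpha> *\<^sub>C a \<alpha>) has_sum psum (dcoef k (trunc n a)) z) {\<alpha>. mdeg \<alpha> \<le> n}"
    by (subst has_sum_cong_neutral[where T = UNIV]) (auto simp: trunc_def)
  then show ?thesis
    using has_sum_finite[OF finite_mdeg_le, of "\<lambda>\<alpha>. dzpow k z \<alpha> *\<^sub>C a \<alpha>" n] has_sum_unique by blast
qed

lemma psum_trunc_tendsto:
  assumes "abs_conv a" "norm z < 1"
  shows "(\<lambda>n. psum (trunc n a) z) \<longlonglongrightarrow> psum a z"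
    "(\<lambda>n. psum (dcoef k (trunc n a)) z) \<longlonglongrightarrow> psum (dcoef k a) z"
  unfolding psum_trunc psum_dcoef_trunc[OF assms]
  by (rule has_sum_mdeg_tendsto, rule psum_has_sum[OF assms] dzpow_has_sum[OF assms])+

text \<open>The density of Green's identity with \<open><u f, f>\<close> in place of \<open>u p cnj q\<close>.\<close>

definition green_form :: "real \<Rightarrow> (('d \<Rightarrow> nat) \<Rightarrow> 'm) \<Rightarrow> complex ^ 'd \<Rightarrow> complex" where
  "green_form r a z =
     (2 * nsq z - 2 * of_nat CARD('d) * (of_real (r\<^sup>2) - nsq z)) * W z (psum a z) (psum a z)
     - 2 * (of_real (r\<^sup>2) - nsq z) *
        (\<Sum>k\<in>UNIV. z $ k * W z (psum (dcoef k a) z) (psum a z) + cnj (z $ k) * W z (psum a z) (psum (dcoef k a) z))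
     + (of_real (r\<^sup>2) - nsq z)\<^sup>2 * (\<Sum>k\<in>UNIV. W z (psum (dcoef k a) z) (psum (dcoef k a) z))"

lemma green_form_trunc:
  assumes a: "abs_conv a" and z: "norm z < 1"
  shows "green_form r (trunc n a) z
    = (\<Sum>\<alpha> | mdeg \<alpha> \<le> n. \<Sum>\<beta> | mdeg \<beta> \<le> n. W z (a \<alpha>) (a \<beta>) * green_density r \<alpha> \<beta> z)"
proof -
  let ?A = "{\<alpha> :: 'd \<Rightarrow> nat. mdeg \<alpha> \<le> n}"
  have s: "W z (\<Sum>\<alpha>\<in>?A. p \<alpha> *\<^sub>C a \<alpha>) (\<Sum>\<beta>\<in>?A. q \<beta> *\<^sub>C a \<beta>) = (\<Sum>\<alpha>\<in>?A. \<Sum>\<beta>\<in>?A. p \<alpha> * cnj (q \<beta>) * W z (a \<alpha>) (a \<beta>))" for p q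
    unfolding W_sum_left[OF z] W_sum_right[OF z] W_scale_left[OF z] W_scale_right[OF z]
    by (subst sum.swap) (simp add: mult.assoc sum_distrib_left mult.left_commute)
  show ?thesis
    unfolding green_form_def psum_trunc psum_dcoef_trunc[OF a z] s green_density_def
    by (simp add: sum_distrib_left sum_distrib_right sum.distrib sum_subtractf distrib_left distrib_right
        right_diff_distrib left_diff_distrib sum.swap[of _ _ "UNIV :: 'd set"] mult_ac)
qed

text \<open>In all four cases the form is a pointwise limit of finite sums of the scalar functions
  \<open>W z (a \<alpha>) (b \<beta>)\<close> with continuous coefficients. The indicator restricts
  to the ball, where the series converge.\<close>

lemma W_psum_measurable:
  assumes a: "hardy_summable a" and b: "hardy_summable b"
  shows "(\<lambda>z. indicator (ball 0 1) z *\<^sub>R W z (psum a z) (psum b z)) \<in> borel_measurable lborel"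
    and "(\<lambda>z. indicator (ball 0 1) z *\<^sub>R W z (psum (dcoef k a) z) (psum b z)) \<in> borel_measurable lborel"
    and "(\<lambda>z. indicator (ball 0 1) z *\<^sub>R W z (psum a z) (psum (dcoef k b) z)) \<in> borel_measurable lborel"
    and "(\<lambda>z. indicator (ball 0 1) z *\<^sub>R W z (psum (dcoef k a) z) (psum (dcoef k b) z)) \<in> borel_measurable lborel"
proof -
  have *: "(\<lambda>z. indicator (ball 0 1) z *\<^sub>R W z (f z) (g z)) \<in> borel_measurable lborel"
    if f: "\<And>z. norm z < 1 \<Longrightarrow> (\<lambda>n. \<Sum>\<alpha> | mdeg \<alpha> \<le> n. p \<alpha> z *\<^sub>C a \<alpha>) \<longlonglongrightarrow> f z"
      and g: "\<And>z. norm z < 1 \<Longrightarrow> (\<lambda>n. \<Sum>\<alpha> | mdeg \<alpha> \<le> n. q \<alpha> z *\<^sub>C b \<alpha>) \<longlonglongrightarrow> g z"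
      and pq: "\<And>\<alpha>. continuous_on UNIV (p \<alpha>)" "\<And>\<alpha>. continuous_on UNIV (q \<alpha>)"
    for f g p q
  proof (rule borel_measurable_LIMSEQ_metric)
    have [measurable]: "p \<alpha> \<in> borel_measurable borel" "q \<alpha> \<in> borel_measurable borel" for \<alpha>
      using pq by (simp_all add: borel_measurable_continuous_onI)
    have [measurable]: "(\<lambda>z. cnj (q \<alpha> z)) \<in> borel_measurable borel" for \<alpha>
      by (intro borel_measurable_continuous_onI continuous_on_cnj pq)
    show "(\<lambda>z. indicator (ball 0 1) z *\<^sub>R (\<Sum>\<alpha> | mdeg \<alpha> \<le> n. \<Sum>\<beta> | mdeg \<beta> \<le> n. p \<alpha> z * cnj (q \<beta> z) * W z (a \<alpha>) (b \<beta>)))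
      \<in> borel_measurable lborel" for n
      by measurable
    show "(\<lambda>n. indicator (ball 0 1) z *\<^sub>R (\<Sum>\<alpha> | mdeg \<alpha> \<le> n. \<Sum>\<beta> | mdeg \<beta> \<le> n. p \<alpha> z * cnj (q \<beta> z) * W z (a \<alpha>) (b \<beta>)))
      \<longlonglongrightarrow> indicator (ball 0 1) z *\<^sub>R W z (f z) (g z)" for z
    proof (cases "norm z < 1")
      case True
      have "(\<lambda>n. W z (\<Sum>\<alpha> | mdeg \<alpha> \<le> n. p \<alpha> z *\<^sub>C a \<alpha>) (\<Sum>\<alpha> | mdeg \<alpha> \<le> n. q \<alpha> z *\<^sub>C b \<alpha>)) \<longlonglongrightarrow> W z (f z) (g z)"
        by (rule W_tendsto[OF True f[OF True] g[OF True]])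
      moreover have "W z (\<Sum>\<alpha> | mdeg \<alpha> \<le> n. p \<alpha> z *\<^sub>C a \<alpha>) (\<Sum>\<alpha> | mdeg \<alpha> \<le> n. q \<alpha> z *\<^sub>C b \<alpha>)
          = (\<Sum>\<alpha> | mdeg \<alpha> \<le> n. \<Sum>\<beta> | mdeg \<beta> \<le> n. p \<alpha> z * cnj (q \<beta> z) * W z (a \<alpha>) (b \<beta>))" for n
        unfolding W_sum_left[OF True] W_sum_right[OF True] W_scale_left[OF True] W_scale_right[OF True]
        by (subst sum.swap) (simp add: mult.assoc sum_distrib_left mult.left_commute)
      ultimately show ?thesis using True by simp
    qed simp
  qed
  note ca = hardy_abs_conv[OF a] and cb = hardy_abs_conv[OF b]
  note fa = has_sum_mdeg_tendsto[OF psum_has_sum[OF ca]] and fb = has_sum_mdeg_tendsto[OF psum_has_sum[OF cb]]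
    and ga = has_sum_mdeg_tendsto[OF dzpow_has_sum[OF ca]] and gb = has_sum_mdeg_tendsto[OF dzpow_has_sum[OF cb]]
  show "(\<lambda>z. indicator (ball 0 1) z *\<^sub>R W z (psum a z) (psum b z)) \<in> borel_measurable lborel"
    by (rule *[OF fa fb continuous_zpow continuous_zpow])
  show "(\<lambda>z. indicator (ball 0 1) z *\<^sub>R W z (psum (dcoef k a) z) (psum b z)) \<in> borel_measurable lborel"
    by (rule *[OF ga fb continuous_dzpow continuous_zpow])
  show "(\<lambda>z. indicator (ball 0 1) z *\<^sub>R W z (psum a z) (psum (dcoef k b) z)) \<in> borel_measurable lborel"
    by (rule *[OF fa gb continuous_zpow continuous_dzpow])
  show "(\<lambda>z. indicator (ball 0 1) z *\<^sub>R W z (psum (dcoef k a) z) (psum (dcoef k b) z)) \<in> borel_measurable lborel"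
    by (rule *[OF ga gb continuous_dzpow continuous_dzpow])
qed

lemma K_nonneg: "r < 1 \<Longrightarrow> 0 \<le> K r"
  unfolding K_def using total_nonneg by simp

lemma green_form_measurable:
  assumes a: "hardy_summable a" and r: "0 < r" "r < 1"
  shows "(\<lambda>z. indicator (ball 0 r) z *\<^sub>R green_form r a z) \<in> borel_measurable lborel"
proof -
  have [measurable]: "nsq \<in> borel_measurable (borel :: (complex ^ 'd) measure)"
    unfolding nsq[abs_def] by measurable
  have [measurable]: "(\<lambda>z. z $ k) \<in> borel_measurable (borel :: (complex ^ 'd) measure)"
    "(\<lambda>z. cnj (z $ k)) \<in> borel_measurable (borel :: (complex ^ 'd) measure)" for k
    by (rule borel_measurable_continuous_onI, intro continuous_intros)+
  \<comment> \<open>The forms are known to be measurable after multiplication by the indicator of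
    the unit ball; on the ball of radius \<open>r\<close> this factor is 1.\<close>
  define A where "A z = indicator (ball 0 1) z *\<^sub>R W z (psum a z) (psum a z)" for z
  define B where "B k z = indicator (ball 0 1) z *\<^sub>R W z (psum (dcoef k a) z) (psum a z)" for k z
  define C where "C k z = indicator (ball 0 1) z *\<^sub>R W z (psum a z) (psum (dcoef k a) z)" for k z
  define D where "D k z = indicator (ball 0 1) z *\<^sub>R W z (psum (dcoef k a) z) (psum (dcoef k a) z)" for k z
  have [measurable]: "A \<in> borel_measurable borel" "B k \<in> borel_measurable borel"
    "C k \<in> borel_measurable borel" "D k \<in> borel_measurable borel" for k
    using W_psum_measurable(1)[OF a a] W_psum_measurable(2)[OF a a, of k]
      W_psum_measurable(3)[OF a a, of k] W_psum_measurable(4)[OF a a, of k]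
    unfolding A_def[abs_def] B_def[abs_def] C_def[abs_def] D_def[abs_def] by simp_all
  have "(\<lambda>z. indicator (ball 0 r) z *\<^sub>R
     ((2 * nsq z - 2 * of_nat CARD('d) * (of_real (r\<^sup>2) - nsq z)) * A z
     - 2 * (of_real (r\<^sup>2) - nsq z) * (\<Sum>k\<in>UNIV. z $ k * B k z + cnj (z $ k) * C k z)
     + (of_real (r\<^sup>2) - nsq z)\<^sup>2 * (\<Sum>k\<in>UNIV. D k z))) \<in> borel_measurable lborel"
    by measurable
  moreover have "indicator (ball 0 r) z *\<^sub>R
     ((2 * nsq z - 2 * of_nat CARD('d) * (of_real (r\<^sup>2) - nsq z)) * A z
     - 2 * (of_real (r\<^sup>2) - nsq z) * (\<Sum>k\<in>UNIV. z $ k * B k z + cnj (z $ k) * C k z)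
     + (of_real (r\<^sup>2) - nsq z)\<^sup>2 * (\<Sum>k\<in>UNIV. D k z))
     = indicator (ball 0 r) z *\<^sub>R green_form r a z" for z
    using r by (cases "norm z < r") (simp_all add: green_form_def A_def B_def C_def D_def)
  ultimately show ?thesis by (simp only:)
qed

text \<open>For truncated series the integral is a finite combination of those in
  \<open>W_green_zero\<close>. Dominated convergence removes the truncation: truncating does not
  increase the Hardy norm, which on the ball of radius r < 1 controls the function and its first
  derivatives.\<close>

lemma green_form_zero:
  assumes a: "hardy_summable a" and r: "0 < r" "r < 1"
  shows "(LINT z:ball 0 r|lborel. green_form r a z) = 0"
proof -
  \<comment> \<open>A common bound on the ball of radius \<open>r\<close> for the values and the
    partial derivatives of all truncations.\<close>
  define c where "c = max (sqrt (hardy_kernel CARD('d) r * hardy_sq a)) (sqrt (hardy_kernel' CARD('d) r * hardy_sq a))"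
  have hk: "0 \<le> hardy_kernel CARD('d) s" if "0 \<le> s" "s < 1" for s
    using sum_zpow_sq_le[of "0 :: complex ^ 'd" s "{}"] that by simp
  have hk': "0 \<le> hardy_kernel' CARD('d) r"
    unfolding hardy_kernel'_def using r by (intro mult_nonneg_nonneg hk) auto
  have c: "0 \<le> c" unfolding c_def using hk[of r] r hardy_sq_nonneg[of a] by (simp add: le_max_iff_disj)
  \<comment> \<open>One summand for each of the three terms of \<open>green_form\<close>, with
    |z|^2, |r^2 - |z|^2| and |z_k| all estimated by 1.\<close>
  define C where "C = (2 + 2 * real CARD('d)) * (K r * c * c) + 2 * (real CARD('d) * (2 * (K r * c * c))) + real CARD('d) * (K r * c * c)"
  have Kcc: "0 \<le> K r * c * c" using K_nonneg[OF r(2)] c by simp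
  have bound: "norm (green_form r (trunc n a) z) \<le> C" if z: "norm z < r" for z n
  proof -
    have z1: "norm z < 1" using z r by simp
    have p: "norm (psum (trunc n a) z) \<le> c"
    proof -
      have "norm (psum (trunc n a) z) \<le> sqrt (hardy_kernel CARD('d) r * hardy_sq (trunc n a))"
        by (rule hardy_psum_le[OF hardy_summable_trunc(1)[OF a]]) (use z r in auto)
      also have "\<dots> \<le> sqrt (hardy_kernel CARD('d) r * hardy_sq a)"
        using hk[of r] r hardy_summable_trunc(2)[OF a] by (intro real_sqrt_le_mono mult_left_mono) auto
      finally show ?thesis by (simp add: c_def le_max_iff_disj)
    qed
    have g: "norm (psum (dcoef k (trunc n a)) z) \<le> c" for k
    proof -
      have "norm (psum (dcoef k (trunc n a)) z) \<le> sqrt (hardy_kernel' CARD('d) r * hardy_sq (trunc n a))"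
        by (rule hardy_dcoef_psum_le[OF hardy_summable_trunc(1)[OF a]]) (use z r in auto)
      also have "\<dots> \<le> sqrt (hardy_kernel' CARD('d) r * hardy_sq a)"
        using hk' hardy_summable_trunc(2)[OF a] by (intro real_sqrt_le_mono mult_left_mono) auto
      finally show ?thesis by (simp add: c_def le_max_iff_disj)
    qed
    have w: "norm (W z x y) \<le> K r * c * c" if "norm x \<le> c" "norm y \<le> c" for x y
    proof -
      have "norm (W z x y) \<le> K r * norm x * norm y" using z r by (intro W_bound[OF z1]) auto
      also have "\<dots> \<le> K r * c * c" using that K_nonneg[OF r(2)] c by (intro mult_mono) auto
      finally show ?thesis .
    qed
    have N1: "norm (of_real (r\<^sup>2) - nsq z) \<le> 1"
    proof -
      have "of_real (r\<^sup>2) - nsq z = complex_of_real (r\<^sup>2 - (norm z)\<^sup>2)" by (simp add: nsq)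
      then have "norm (of_real (r\<^sup>2) - nsq z) = \<bar>r\<^sup>2 - (norm z)\<^sup>2\<bar>" by (simp only: norm_of_real)
      moreover have "(norm z)\<^sup>2 \<le> r\<^sup>2" "r\<^sup>2 \<le> 1" using z r by (auto simp: power_le_one)
      ultimately show ?thesis using zero_le_power2[of "norm z"] by linarith
    qed
    have n1: "norm (nsq z) \<le> 1" using z1 by (simp add: nsq norm_power power_le_one)
    have zk: "norm (z $ k) \<le> 1" for k
      using Finite_Cartesian_Product.norm_nth_le[of z k] z1 by linarith
    have 1: "norm ((2 * nsq z - 2 * of_nat CARD('d) * (of_real (r\<^sup>2) - nsq z)) * W z (psum (trunc n a) z) (psum (trunc n a) z))
      \<le> (2 + 2 * real CARD('d)) * (K r * c * c)"
    proof -
      have "norm (2 * nsq z - 2 * of_nat CARD('d) * (of_real (r\<^sup>2) - nsq z)) \<le> 2 * norm (nsq z) + 2 * real CARD('d) * norm (of_real (r\<^sup>2) - nsq z)"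
        by (rule order_trans[OF norm_triangle_ineq4]) (simp add: norm_mult)
      also have "\<dots> \<le> 2 * 1 + 2 * real CARD('d) * 1"
        using n1 N1 by (intro add_mono mult_left_mono) auto
      finally show ?thesis unfolding norm_mult using w[OF p p] by (intro mult_mono) auto
    qed
    have 2: "norm (2 * (of_real (r\<^sup>2) - nsq z) *
        (\<Sum>k\<in>UNIV. z $ k * W z (psum (dcoef k (trunc n a)) z) (psum (trunc n a) z) + cnj (z $ k) * W z (psum (trunc n a) z) (psum (dcoef k (trunc n a)) z)))
      \<le> 2 * (real CARD('d) * (2 * (K r * c * c)))"
    proof -
      have "norm (\<Sum>k\<in>UNIV. z $ k * W z (psum (dcoef k (trunc n a)) z) (psum (trunc n a) z) + cnj (z $ k) * W z (psum (trunc n a) z) (psum (dcoef k (trunc n a)) z))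
        \<le> (\<Sum>k\<in>(UNIV::'d set). 2 * (K r * c * c))"
      proof (rule sum_norm_le)
        fix k
        have "norm (z $ k * W z (psum (dcoef k (trunc n a)) z) (psum (trunc n a) z)) \<le> 1 * (K r * c * c)"
          "norm (cnj (z $ k) * W z (psum (trunc n a) z) (psum (dcoef k (trunc n a)) z)) \<le> 1 * (K r * c * c)"
          unfolding norm_mult complex_mod_cnj
          by (rule mult_mono[OF zk w[OF g p]] mult_mono[OF zk w[OF p g]]; simp)+
        then show "norm (z $ k * W z (psum (dcoef k (trunc n a)) z) (psum (trunc n a) z) + cnj (z $ k) * W z (psum (trunc n a) z) (psum (dcoef k (trunc n a)) z)) \<le> 2 * (K r * c * c)"
          using norm_triangle_ineq[of "z $ k * W z (psum (dcoef k (trunc n a)) z) (psum (trunc n a) z)"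
            "cnj (z $ k) * W z (psum (trunc n a) z) (psum (dcoef k (trunc n a)) z)"] by linarith
      qed
      moreover have "norm (2 * (of_real (r\<^sup>2) - nsq z)) \<le> 2" using N1 by (simp only: norm_mult) simp
      ultimately show ?thesis unfolding norm_mult[of "2 * _"] using Kcc by (intro mult_mono) auto
    qed
    have 3: "norm ((of_real (r\<^sup>2) - nsq z)\<^sup>2 * (\<Sum>k\<in>UNIV. W z (psum (dcoef k (trunc n a)) z) (psum (dcoef k (trunc n a)) z)))
      \<le> real CARD('d) * (K r * c * c)"
    proof -
      have "norm (\<Sum>k\<in>UNIV. W z (psum (dcoef k (trunc n a)) z) (psum (dcoef k (trunc n a)) z)) \<le> (\<Sum>k\<in>(UNIV::'d set). K r * c * c)"
        by (rule sum_norm_le) (rule w[OF g g])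
      moreover have "norm ((of_real (r\<^sup>2) - nsq z)\<^sup>2) \<le> 1" using N1 by (simp only: norm_power) (simp add: power_le_one)
      ultimately have "norm ((of_real (r\<^sup>2) - nsq z)\<^sup>2) * norm (\<Sum>k\<in>UNIV. W z (psum (dcoef k (trunc n a)) z) (psum (dcoef k (trunc n a)) z)) \<le> 1 * (\<Sum>k\<in>(UNIV::'d set). K r * c * c)"
        by (intro mult_mono) auto
      then show ?thesis by (simp only: norm_mult) simp
    qed
    show ?thesis
      unfolding green_form_def C_def
      by (rule order_trans[OF norm_triangle_ineq], rule add_mono[OF order_trans[OF norm_triangle_ineq4 add_mono[OF 1 2]] 3])
  qed
  have "(\<lambda>n. \<integral>z. indicator (ball 0 r) z *\<^sub>R green_form r (trunc n a) z \<partial>lborel)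
      \<longlonglongrightarrow> (\<integral>z. indicator (ball 0 r) z *\<^sub>R green_form r a z \<partial>lborel)"
  proof (rule integral_dominated_convergence[where w = "\<lambda>z. C * indicator (ball 0 r) z"])
    show "(\<lambda>z. indicator (ball 0 r) z *\<^sub>R green_form r a z) \<in> borel_measurable lborel"
      "(\<lambda>z. indicator (ball 0 r) z *\<^sub>R green_form r (trunc n a) z) \<in> borel_measurable lborel" for n
      by (rule green_form_measurable[OF _ r], rule a hardy_summable_trunc(1)[OF a])+
    show "integrable lborel (\<lambda>z. C * indicator (ball (0::complex^'d) r) z)"
      using emeasure_bounded_finite[OF bounded_ball, of "0::complex^'d" r]
      by (intro integrable_mult_right integrable_real_indicator) auto
    show "AE z in lborel. norm (indicator (ball 0 r) z *\<^sub>R green_form r (trunc n a) z) \<le> C * indicator (ball 0 r) z" for n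
      by (rule AE_I2) (use bound in \<open>simp add: indicator_def\<close>)
    show "AE z in lborel. (\<lambda>n. indicator (ball 0 r) z *\<^sub>R green_form r (trunc n a) z)
        \<longlonglongrightarrow> indicator (ball 0 r) z *\<^sub>R green_form r a z"
    proof (rule AE_I2)
      fix z :: "complex ^ 'd"
      show "(\<lambda>n. indicator (ball 0 r) z *\<^sub>R green_form r (trunc n a) z) \<longlonglongrightarrow> indicator (ball 0 r) z *\<^sub>R green_form r a z"
      proof (cases "norm z < r")
        case True
        then have z: "norm z < 1" using r by simp
        note t = psum_trunc_tendsto[OF hardy_abs_conv[OF a] z]
        have "(\<lambda>n. green_form r (trunc n a) z) \<longlonglongrightarrow> green_form r a z"
          unfolding green_form_def
          by (intro tendsto_add tendsto_diff tendsto_mult_left tendsto_sum W_tendsto[OF z] t)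
        then show ?thesis using True by simp
      qed simp
    qed
  qed
  moreover have "(\<integral>z. indicator (ball 0 r) z *\<^sub>R green_form r (trunc n a) z \<partial>lborel) = 0" for n
  proof -
    let ?A = "{\<alpha> :: 'd \<Rightarrow> nat. mdeg \<alpha> \<le> n}"
    have "(\<integral>z. indicator (ball 0 r) z *\<^sub>R green_form r (trunc n a) z \<partial>lborel)
      = (\<integral>z. (\<Sum>\<alpha>\<in>?A. \<Sum>\<beta>\<in>?A. indicator (ball 0 r) z *\<^sub>R (W z (a \<alpha>) (a \<beta>) * green_density r \<alpha> \<beta> z)) \<partial>lborel)"
    proof (rule Bochner_Integration.integral_cong[OF refl])
      fix z :: "complex ^ 'd"
      show "indicator (ball 0 r) z *\<^sub>R green_form r (trunc n a) z
        = (\<Sum>\<alpha>\<in>?A. \<Sum>\<beta>\<in>?A. indicator (ball 0 r) z *\<^sub>R (W z (a \<alpha>) (a \<beta>) * green_density r \<alpha> \<beta> z))"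
        using r green_form_trunc[OF hardy_abs_conv[OF a], of z r n] by (cases "norm z < r") simp_all
    qed
    also have "\<dots> = (\<Sum>\<alpha>\<in>?A. \<Sum>\<beta>\<in>?A. \<integral>z. indicator (ball 0 r) z *\<^sub>R (W z (a \<alpha>) (a \<beta>) * green_density r \<alpha> \<beta> z) \<partial>lborel)"
      using W_green_zero(1)[OF r] unfolding set_integrable_def by simp
    also have "\<dots> = 0"
      using W_green_zero(2)[OF r] unfolding set_lebesgue_integral_def by simp
    finally show ?thesis .
  qed
  ultimately show ?thesis by (simp add: LIMSEQ_const_iff set_lebesgue_integral_def)
qed

section \<open>The Dirichlet density of shifted functions\<close>

definition dens :: "(('d \<Rightarrow> nat) \<Rightarrow> 'm) \<Rightarrow> complex ^ 'd \<Rightarrow> real" where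
  "dens a z = (\<Sum>k\<in>UNIV. U z (psum (dcoef k a) z))"

lemma dens_nonneg: "norm z < 1 \<Longrightarrow> 0 \<le> dens a z"
  unfolding dens_def by (intro sum_nonneg U_nonneg)

context
  fixes z :: "complex ^ 'd" and a :: "('d \<Rightarrow> nat) \<Rightarrow> 'm"
  assumes z: "norm z < 1" and a: "abs_conv a"
begin

lemma dens_W: "of_real (dens a z) = (\<Sum>k\<in>UNIV. W z (psum (dcoef k a) z) (psum (dcoef k a) z))"
  by (simp add: dens_def W_self[OF z])

end

text \<open>With R the radial derivative, the sum of all z_k d_k, this is <u R f, f> + <u f, R
  f>.\<close>

definition cross_term :: "complex ^ 'd \<Rightarrow> (('d \<Rightarrow> nat) \<Rightarrow> 'm) \<Rightarrow> complex" where
  "cross_term z a = (\<Sum>k\<in>UNIV. z $ k * W z (psum (dcoef k a) z) (psum a z) + cnj (z $ k) * W z (psum a z) (psum (dcoef k a) z))"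

text \<open>The product rule summed over all coordinates: differentiating the coordinate on both
  sides gives one copy of <u f, f> per variable, the mixed terms give \<open>cross_term\<close>, and
  the rest is |z|^2 times the density of f.\<close>

lemma sum_dens_shift:
  assumes z: "norm z < 1" and a: "abs_conv a"
  shows "of_real (\<Sum>j\<in>UNIV. dens (shift j a) z)
    = of_nat CARD('d) * W z (psum a z) (psum a z) + cross_term z a + nsq z * of_real (dens a z)"
proof -
  let ?f = "psum a z" and ?g = "\<lambda>k. psum (dcoef k a) z"
  have "complex_of_real (dens (shift j a) z) = W z ?f ?f + (z $ j * W z (?g j) ?f + cnj (z $ j) * W z ?f (?g j))
    + z $ j * cnj (z $ j) * of_real (dens a z)" for j
  proof -
    have "of_real (dens (shift j a) z) = (\<Sum>k\<in>UNIV. (if k = j then W z ?f ?f + (z $ j * W z (?g j) ?f + cnj (z $ j) * W z ?f (?g j)) else 0)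
       + z $ j * cnj (z $ j) * W z (?g k) (?g k))"
      unfolding dens_W[OF z abs_conv_shift[OF a]] psum_dcoef_shift[OF a z]
      by (rule sum.cong[OF refl])
        (simp add: W_add_left[OF z] W_add_right[OF z] W_scale_left[OF z] W_scale_right[OF z] W_zero_left[OF z] W_zero_right[OF z] algebra_simps)
    then show ?thesis by (simp add: sum.distrib dens_W[OF z a] sum_distrib_left)
  qed
  then have "of_real (\<Sum>j\<in>UNIV. dens (shift j a) z) = (\<Sum>j\<in>UNIV. W z ?f ?f + (z $ j * W z (?g j) ?f + cnj (z $ j) * W z ?f (?g j))
    + z $ j * cnj (z $ j) * of_real (dens a z))" by simp
  also have "\<dots> = of_nat CARD('d) * W z ?f ?f + cross_term z a + nsq z * of_real (dens a z)"
    by (simp add: sum.distrib cross_term_def nsq_def sum_distrib_right)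
  finally show ?thesis .
qed

text \<open>The radial derivative satisfies R(z_i f) = z_i (f + R f); the summand f accounts for the
  term 2 <u f, f>.\<close>

lemma cross_term_shift:
  assumes z: "norm z < 1" and a: "abs_conv a"
  shows "cross_term z (shift i a) = z $ i * cnj (z $ i) * (2 * W z (psum a z) (psum a z) + cross_term z a)"
proof -
  let ?f = "psum a z" and ?g = "\<lambda>k. psum (dcoef k a) z"
  have "cross_term z (shift i a) = (\<Sum>k\<in>UNIV. (if k = i then 2 * (z $ i * cnj (z $ i)) * W z ?f ?f else 0)
     + z $ i * cnj (z $ i) * (z $ k * W z (?g k) ?f + cnj (z $ k) * W z ?f (?g k)))"
    unfolding cross_term_def psum_dcoef_shift[OF a z] psum_shift[OF a z]
    by (rule sum.cong[OF refl])
      (simp add: W_add_left[OF z] W_add_right[OF z] W_scale_left[OF z] W_scale_right[OF z] W_zero_left[OF z] W_zero_right[OF z] algebra_simps)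
  also have "\<dots> = 2 * (z $ i * cnj (z $ i)) * W z ?f ?f + z $ i * cnj (z $ i) * cross_term z a"
    by (simp add: sum.distrib cross_term_def flip: sum_distrib_left)
  finally show ?thesis by (simp add: algebra_simps)
qed

text \<open>\<open>sum_dens_shift\<close> is applied to f and to each z_i f. The densities of f then
  combine to (|z|^2 - r^2)^2, and the summand 2 |z|^2 <u f, f> of \<open>green_form\<close> that is
  free of the dimension comes from \<open>cross_term_shift\<close>.\<close>

lemma green_form_eq:
  assumes z: "norm z < 1" and a: "abs_conv a"
  shows "green_form r a z = of_real ((\<Sum>i\<in>UNIV. \<Sum>j\<in>UNIV. dens (shift j (shift i a)) z)
    - 2 * r\<^sup>2 * (\<Sum>j\<in>UNIV. dens (shift j a) z) + r ^ 4 * dens a z)"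
proof -
  let ?f = "psum a z"
  have "of_real (\<Sum>i\<in>UNIV. \<Sum>j\<in>UNIV. dens (shift j (shift i a)) z)
    = (\<Sum>i\<in>UNIV. of_nat CARD('d) * (z $ i * cnj (z $ i) * W z ?f ?f)
       + z $ i * cnj (z $ i) * (2 * W z ?f ?f + cross_term z a) + nsq z * of_real (dens (shift i a) z))"
    unfolding of_real_sum[of "\<lambda>i. \<Sum>j\<in>UNIV. dens (shift j (shift i a)) z"]
    by (rule sum.cong[OF refl], subst sum_dens_shift[OF z abs_conv_shift[OF a]])
      (simp add: psum_shift[OF a z] W_scale_left[OF z] W_scale_right[OF z] cross_term_shift[OF z a] mult.assoc)
  also have "\<dots> = of_nat CARD('d) * (nsq z * W z ?f ?f) + nsq z * (2 * W z ?f ?f + cross_term z a)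
      + nsq z * of_real (\<Sum>j\<in>UNIV. dens (shift j a) z)"
    by (simp add: sum.distrib nsq_def sum_distrib_left sum_distrib_right)
  finally have 2: "of_real (\<Sum>i\<in>UNIV. \<Sum>j\<in>UNIV. dens (shift j (shift i a)) z)
    = of_nat CARD('d) * (nsq z * W z ?f ?f) + nsq z * (2 * W z ?f ?f + cross_term z a)
      + nsq z * of_real (\<Sum>j\<in>UNIV. dens (shift j a) z)" .
  have 0: "green_form r a z = (2 * nsq z - 2 * of_nat CARD('d) * (of_real (r\<^sup>2) - nsq z)) * W z ?f ?f
     - 2 * (of_real (r\<^sup>2) - nsq z) * cross_term z a + (of_real (r\<^sup>2) - nsq z)\<^sup>2 * of_real (dens a z)"
    unfolding green_form_def cross_term_def dens_W[OF z a] ..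
  show ?thesis
    unfolding of_real_add of_real_diff of_real_mult of_real_power of_real_numeral 2 0 sum_dens_shift[OF z a]
    by (simp add: power2_eq_square power4_eq_xxxx algebra_simps)
qed

text \<open>For r < 1 the weighted combination \<open>J r\<close> is the integral of
  \<open>green_form\<close>, hence 0. Integrability of each density over the whole ball permits the
  passage to r = 1 term by term.\<close>

lemma dens_identity:
  assumes a: "hardy_summable a"
    and int: "set_integrable lborel (ball 0 1) (dens a)"
      "\<And>j. set_integrable lborel (ball 0 1) (dens (shift j a))"
      "\<And>i j. set_integrable lborel (ball 0 1) (dens (shift j (shift i a)))"
  shows "(\<Sum>i\<in>UNIV. \<Sum>j\<in>UNIV. LINT z:ball 0 1|lborel. dens (shift j (shift i a)) z)
    - 2 * (\<Sum>j\<in>UNIV. LINT z:ball 0 1|lborel. dens (shift j a) z) + (LINT z:ball 0 1|lborel. dens a z) = 0"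
proof -
  define J where "J r = (\<Sum>i\<in>UNIV. \<Sum>j\<in>UNIV. LINT z:ball 0 r|lborel. dens (shift j (shift i a)) z)
    - 2 * r\<^sup>2 * (\<Sum>j\<in>UNIV. LINT z:ball 0 r|lborel. dens (shift j a) z) + r ^ 4 * (LINT z:ball 0 r|lborel. dens a z)" for r
  have J0: "J r = 0" if r: "0 < r" "r < 1" for r
  proof -
    have sub: "set_integrable lborel (ball 0 r) f" if "set_integrable lborel (ball 0 1) f" for f :: "complex^'d \<Rightarrow> real"
      by (rule set_integrable_subset[OF that]) (use r in auto)
    note i0 = sub[OF int(1), unfolded set_integrable_def] and i1 = sub[OF int(2), unfolded set_integrable_def]
      and i2 = sub[OF int(3), unfolded set_integrable_def]
    define X where "X z = (\<Sum>i\<in>UNIV. \<Sum>j\<in>UNIV. indicator (ball 0 r) z *\<^sub>R dens (shift j (shift i a)) z)" for z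
    define Y where "Y z = (\<Sum>j\<in>UNIV. indicator (ball 0 r) z *\<^sub>R dens (shift j a) z)" for z
    define Z where "Z z = indicator (ball 0 r) z *\<^sub>R dens a z" for z
    have iX: "integrable lborel X" unfolding X_def[abs_def] by (intro Bochner_Integration.integrable_sum i2)
    have iY: "integrable lborel Y" unfolding Y_def[abs_def] by (intro Bochner_Integration.integrable_sum i1)
    have iZ: "integrable lborel Z" unfolding Z_def[abs_def] by (rule i0)
    have "(\<integral>z. X z \<partial>lborel) = (\<Sum>i\<in>UNIV. \<Sum>j\<in>UNIV. LINT z:ball 0 r|lborel. dens (shift j (shift i a)) z)"
      unfolding X_def set_lebesgue_integral_def
      by (subst Bochner_Integration.integral_sum, intro Bochner_Integration.integrable_sum i2,
          subst Bochner_Integration.integral_sum, rule i2, rule refl)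
    moreover have "(\<integral>z. Y z \<partial>lborel) = (\<Sum>j\<in>UNIV. LINT z:ball 0 r|lborel. dens (shift j a) z)"
      unfolding Y_def set_lebesgue_integral_def by (rule Bochner_Integration.integral_sum[OF i1])
    moreover have "(\<integral>z. Z z \<partial>lborel) = (LINT z:ball 0 r|lborel. dens a z)"
      unfolding Z_def set_lebesgue_integral_def ..
    ultimately have "J r = (\<integral>z. X z - 2 * r\<^sup>2 * Y z + r ^ 4 * Z z \<partial>lborel)"
      unfolding J_def using iX iY iZ by simp
    then have "complex_of_real (J r) = (\<integral>z. complex_of_real (X z - 2 * r\<^sup>2 * Y z + r ^ 4 * Z z) \<partial>lborel)"
      by (simp only: integral_complex_of_real)
    also have "\<dots> = (LINT z:ball 0 r|lborel. green_form r a z)"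
      unfolding set_lebesgue_integral_def
    proof (rule Bochner_Integration.integral_cong[OF refl])
      fix z :: "complex ^ 'd"
      show "complex_of_real (X z - 2 * r\<^sup>2 * Y z + r ^ 4 * Z z) = indicator (ball 0 r) z *\<^sub>R green_form r a z"
        using r green_form_eq[OF _ hardy_abs_conv[OF a], of z r]
        by (cases "norm z < r") (simp_all add: X_def Y_def Z_def)
    qed
    also have "\<dots> = 0" by (rule green_form_zero[OF a r])
    finally show ?thesis by simp
  qed
  \<comment> \<open>The shift by 2 keeps the first radius, 1/2, positive.\<close>
  define s where "s n = 1 - 1 / real (n + 2)" for n
  have s: "0 < s n" "s n < 1" for n by (simp_all add: s_def)
  have s1: "s \<longlonglongrightarrow> 1"
  proof -
    have "(\<lambda>n. 1 - 1 / real (n + 2)) \<longlonglongrightarrow> 1 - 0"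
      by (intro tendsto_diff tendsto_const LIMSEQ_ignore_initial_segment[OF lim_const_over_n, of 1 2])
    then show ?thesis by (simp add: s_def[abs_def])
  qed
  have lim: "(\<lambda>n. LINT z:ball 0 (s n)|lborel. f z) \<longlonglongrightarrow> (LINT z:ball 0 1|lborel. f z)"
    if f: "set_integrable lborel (ball 0 1) f" for f :: "complex^'d \<Rightarrow> real"
    unfolding set_lebesgue_integral_def
  proof (rule integral_dominated_convergence[where w = "\<lambda>z. norm (indicator (ball 0 1) z *\<^sub>R f z)"])
    show "(\<lambda>z. indicator (ball 0 1) z *\<^sub>R f z) \<in> borel_measurable lborel"
      using f unfolding set_integrable_def by (rule borel_measurable_integrable)
    have "set_integrable lborel (ball 0 (s n)) f" for n
      by (rule set_integrable_subset[OF f]) (use s[of n] in auto)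
    then show "(\<lambda>z. indicator (ball 0 (s n)) z *\<^sub>R f z) \<in> borel_measurable lborel" for n
      unfolding set_integrable_def by (rule borel_measurable_integrable)
    show "integrable lborel (\<lambda>z. norm (indicator (ball 0 1) z *\<^sub>R f z))"
      using f unfolding set_integrable_def by (rule integrable_norm)
    show "AE z in lborel. norm (indicator (ball 0 (s n)) z *\<^sub>R f z) \<le> norm (indicator (ball 0 1) z *\<^sub>R f z)" for n
      by (rule AE_I2) (use s(2)[of n] in \<open>auto simp: indicator_def\<close>)
    show "AE z in lborel. (\<lambda>n. indicator (ball 0 (s n)) z *\<^sub>R f z) \<longlonglongrightarrow> indicator (ball 0 1) z *\<^sub>R f z"
    proof (rule AE_I2)
      fix z :: "complex ^ 'd"
      have "\<forall>\<^sub>F n in sequentially. indicator (ball 0 (s n)) z *\<^sub>R f z = indicator (ball 0 1) z *\<^sub>R f z"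
      proof (cases "norm z < 1")
        case True
        show ?thesis
          using order_tendstoD(1)[OF s1 True] by eventually_elim (use True in simp)
      next
        case False
        then have "\<not> norm z < s n" for n using s(2)[of n] by linarith
        then show ?thesis using False by simp
      qed
      then show "(\<lambda>n. indicator (ball 0 (s n)) z *\<^sub>R f z) \<longlonglongrightarrow> indicator (ball 0 1) z *\<^sub>R f z"
        by (rule tendsto_eventually)
    qed
  qed
  have "(\<lambda>n. J (s n)) \<longlonglongrightarrow> (\<Sum>i\<in>UNIV. \<Sum>j\<in>UNIV. LINT z:ball 0 1|lborel. dens (shift j (shift i a)) z)
    - 2 * 1\<^sup>2 * (\<Sum>j\<in>UNIV. LINT z:ball 0 1|lborel. dens (shift j a) z) + 1 ^ 4 * (LINT z:ball 0 1|lborel. dens a z)"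
    unfolding J_def by (intro tendsto_intros lim int s1)
  then show ?thesis using J0[OF s] by (simp add: LIMSEQ_const_iff)
qed

end

section \<open>Hardy sums\<close>

lemma has_sum_finite_sum:
  fixes f :: "'k \<Rightarrow> 'a \<Rightarrow> 'b::topological_comm_monoid_add"
  assumes "\<And>k. k \<in> I \<Longrightarrow> (f k has_sum s k) A"
  shows "((\<lambda>x. \<Sum>k\<in>I. f k x) has_sum (\<Sum>k\<in>I. s k)) A"
  using assms by (induction I rule: infinite_finite_induct) (auto intro: has_sum_add)

lemma norm_add_sq_le: "(norm (x + y))\<^sup>2 \<le> 2 * (norm x)\<^sup>2 + 2 * (norm (y :: 'a::real_normed_vector))\<^sup>2"
proof -
  have "(norm (x + y))\<^sup>2 \<le> (norm x + norm y)\<^sup>2" by (intro power_mono norm_triangle_ineq) simp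
  also have "\<dots> \<le> 2 * (norm x)\<^sup>2 + 2 * (norm y)\<^sup>2"
    using zero_le_power2[of "norm x - norm y"] by (simp add: power2_sum power2_diff)
  finally show ?thesis .
qed

lemma hardy_has_sum:
  "hardy_summable a \<Longrightarrow> ((\<lambda>\<alpha>. (norm (a \<alpha>))\<^sup>2 * monomial_norm_sq \<alpha>) has_sum hardy_sq a) UNIV"
  unfolding hardy_summable_def hardy_sq_def by (rule has_sum_infsum)

lemma hardy_summable_add:
  assumes "hardy_summable a" "hardy_summable b"
  shows "hardy_summable (\<lambda>\<alpha>. a \<alpha> + b \<alpha>)"
  unfolding hardy_summable_def
proof (rule nonneg_summable_on_le)
  show "(\<lambda>\<alpha>. 2 * ((norm (a \<alpha>))\<^sup>2 * monomial_norm_sq \<alpha>) + 2 * ((norm (b \<alpha>))\<^sup>2 * monomial_norm_sq \<alpha>)) summable_on UNIV"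
    using assms unfolding hardy_summable_def by (intro summable_on_add summable_on_cmult_right)
  show "(norm (a \<alpha> + b \<alpha>))\<^sup>2 * monomial_norm_sq \<alpha>
    \<le> 2 * ((norm (a \<alpha>))\<^sup>2 * monomial_norm_sq \<alpha>) + 2 * ((norm (b \<alpha>))\<^sup>2 * monomial_norm_sq \<alpha>)" for \<alpha>
    using mult_right_mono[OF norm_add_sq_le[of "a \<alpha>" "b \<alpha>"] less_imp_le[OF monomial_norm_sq_pos[of \<alpha>]]]
    by (simp add: algebra_simps)
qed (rule hardy_term_nonneg)

lemma hardy_summable_scale:
  assumes "hardy_summable a"
  shows "hardy_summable (\<lambda>\<alpha>. c *\<^sub>C a \<alpha>)"
  using summable_on_cmult_right[OF assms[unfolded hardy_summable_def], of "(cmod c)\<^sup>2"]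
  by (simp add: hardy_summable_def norm_scaleC power_mult_distrib mult.assoc)

lemma hardy_summable_diff:
  assumes "hardy_summable a" "hardy_summable b"
  shows "hardy_summable (\<lambda>\<alpha>. a \<alpha> - b \<alpha>)"
  using hardy_summable_add[OF assms(1) hardy_summable_scale[OF assms(2), of "-1"]] by simp

lemma hardy_term_le:
  assumes "hardy_summable a"
  shows "(norm (a \<alpha>))\<^sup>2 * monomial_norm_sq \<alpha> \<le> hardy_sq a"
proof -
  have "(\<Sum>\<alpha>\<in>{\<alpha>}. (norm (a \<alpha>))\<^sup>2 * monomial_norm_sq \<alpha>) \<le> hardy_sq a"
    unfolding hardy_sq_def
    by (rule finite_sum_le_infsum[OF assms[unfolded hardy_summable_def]]) (auto intro: hardy_term_nonneg)
  then show ?thesis by simp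
qed

text \<open>The shifted family vanishes off the range of \<open>inc k\<close>, so its Hardy sum can
  be reindexed by \<open>inc k\<close>; the summability comes from the monotonicity of the
  weights.\<close>

lemma hardy_shift_has_sum:
  assumes "hardy_summable a"
  shows "((\<lambda>\<alpha>. (norm (a \<alpha>))\<^sup>2 * monomial_norm_sq (inc k \<alpha>)) has_sum hardy_sq (shift k a)) UNIV"
    and "hardy_summable (shift k a)"
proof -
  have "(\<lambda>\<alpha>. (norm (a \<alpha>))\<^sup>2 * monomial_norm_sq (inc k \<alpha>)) summable_on UNIV"
    by (rule nonneg_summable_on_le[OF assms[unfolded hardy_summable_def]])
      (auto intro!: mult_left_mono monomial_norm_sq_inc_le mult_nonneg_nonneg less_imp_le[OF monomial_norm_sq_pos])
  then obtain s where s: "((\<lambda>\<alpha>. (norm (a \<alpha>))\<^sup>2 * monomial_norm_sq (inc k \<alpha>)) has_sum s) UNIV"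
    by (auto simp: summable_on_def)
  then have "((\<lambda>\<alpha>. (norm (shift k a (inc k \<alpha>)))\<^sup>2 * monomial_norm_sq (inc k \<alpha>)) has_sum s) UNIV" by simp
  then have "((\<lambda>\<alpha>. (norm (shift k a \<alpha>))\<^sup>2 * monomial_norm_sq \<alpha>) has_sum s) (range (inc k))"
    unfolding has_sum_reindex[OF inj_inc] o_def .
  then have s': "((\<lambda>\<alpha>. (norm (shift k a \<alpha>))\<^sup>2 * monomial_norm_sq \<alpha>) has_sum s) UNIV"
    by (subst has_sum_cong_neutral[where T = "range (inc k)"]) (auto simp: range_inc shift_def)
  then have "s = hardy_sq (shift k a)" by (simp add: hardy_sq_def infsumI)
  with s show "((\<lambda>\<alpha>. (norm (a \<alpha>))\<^sup>2 * monomial_norm_sq (inc k \<alpha>)) has_sum hardy_sq (shift k a)) UNIV" by simp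
  show "hardy_summable (shift k a)" using s' unfolding hardy_summable_def summable_on_def by blast
qed

lemma sum_hardy_sq_shift:
  fixes a :: "('d::finite \<Rightarrow> nat) \<Rightarrow> 'm::complex_hilbert"
  assumes "hardy_summable a"
  shows "(\<Sum>k\<in>UNIV. hardy_sq (shift k a)) = hardy_sq a"
proof -
  have "((\<lambda>\<alpha>. \<Sum>k\<in>UNIV. (norm (a \<alpha>))\<^sup>2 * monomial_norm_sq (inc k \<alpha>)) has_sum (\<Sum>k\<in>UNIV. hardy_sq (shift k a))) UNIV"
    by (rule has_sum_finite_sum) (rule hardy_shift_has_sum(1)[OF assms])
  then have "((\<lambda>\<alpha>. (norm (a \<alpha>))\<^sup>2 * monomial_norm_sq \<alpha>) has_sum (\<Sum>k\<in>UNIV. hardy_sq (shift k a))) UNIV"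
    by (simp only: sum_distrib_left[symmetric] sum_monomial_norm_sq_inc)
  then show ?thesis by (simp add: hardy_sq_def infsumI)
qed

lemma hardy_sq_shift_le:
  assumes "hardy_summable a"
  shows "hardy_sq (shift k a) \<le> hardy_sq a"
  unfolding sum_hardy_sq_shift[OF assms, symmetric]
  by (rule member_le_sum) (auto intro: hardy_sq_nonneg)

text \<open>The squared Hardy norm with infinity allowed; as a supremum of finite sums it lends
  itself to lower semicontinuity.\<close>

definition hardy_ennreal :: "(('d::finite \<Rightarrow> nat) \<Rightarrow> 'm::complex_hilbert) \<Rightarrow> ennreal" where
  "hardy_ennreal a = (\<Sum>\<^sub>\<infinity>\<alpha>. ennreal ((norm (a \<alpha>))\<^sup>2 * monomial_norm_sq \<alpha>))"

lemma hardy_ennreal_SUP: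
  "hardy_ennreal a = (SUP G\<in>{G. finite G \<and> G \<subseteq> UNIV}. \<Sum>\<alpha>\<in>G. ennreal ((norm (a \<alpha>))\<^sup>2 * monomial_norm_sq \<alpha>))"
  unfolding hardy_ennreal_def by (rule nonneg_infsum_complete) simp

lemma sum_hardy_ennreal:
  "(\<Sum>\<alpha>\<in>G. ennreal ((norm (a \<alpha>))\<^sup>2 * monomial_norm_sq \<alpha>)) = ennreal (\<Sum>\<alpha>\<in>G. (norm (a \<alpha>))\<^sup>2 * monomial_norm_sq \<alpha>)"
  by (rule sum_ennreal) (rule hardy_term_nonneg)

lemma hardy_ennreal_eq:
  assumes "hardy_summable a"
  shows "hardy_ennreal a = ennreal (hardy_sq a)"
  unfolding hardy_ennreal_SUP sum_hardy_ennreal hardy_sq_def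
  by (rule infsum_nonneg_is_SUPREMUM_ennreal[symmetric])
    (use assms hardy_term_nonneg in \<open>auto simp: hardy_summable_def\<close>)

lemma hardy_summable_of_bound:
  assumes "\<And>G. finite G \<Longrightarrow> (\<Sum>\<alpha>\<in>G. (norm (a \<alpha>))\<^sup>2 * monomial_norm_sq \<alpha>) \<le> C"
  shows "hardy_summable a" "hardy_sq a \<le> C"
proof -
  show 1: "hardy_summable a"
    unfolding hardy_summable_def
    by (rule nonneg_bdd_above_summable_on[OF hardy_term_nonneg]) (auto intro!: bdd_aboveI2[where M = C] assms)
  show "hardy_sq a \<le> C"
    unfolding hardy_sq_def
    by (rule infsum_le_finite_sums[OF 1[unfolded hardy_summable_def]]) (rule assms)
qed

lemma hardy_summable_of_finite:
  assumes "hardy_ennreal a < \<infinity>"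
  shows "hardy_summable a"
proof (rule hardy_summable_of_bound(1))
  fix G :: "('a \<Rightarrow> nat) set" assume "finite G"
  then have "ennreal (\<Sum>\<alpha>\<in>G. (norm (a \<alpha>))\<^sup>2 * monomial_norm_sq \<alpha>) \<le> hardy_ennreal a"
    unfolding hardy_ennreal_SUP sum_hardy_ennreal[symmetric] by (intro SUP_upper) auto
  also have "\<dots> = ennreal (enn2real (hardy_ennreal a))" using assms by (simp add: less_top)
  finally show "(\<Sum>\<alpha>\<in>G. (norm (a \<alpha>))\<^sup>2 * monomial_norm_sq \<alpha>) \<le> enn2real (hardy_ennreal a)"
    by (simp add: ennreal_le_iff)
qed

lemma hardy_norm_sq_ball_ext: "abs_conv a \<Longrightarrow> hardy_norm_sq (ball_ext a) = hardy_ennreal a"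
  by (simp add: hardy_norm_sq_def hardy_ennreal_def taylor_coeff_ball_ext)

lemma dcoef_diff: "dcoef k (\<lambda>\<alpha>. a \<alpha> - b \<alpha>) = (\<lambda>\<alpha>. dcoef k a \<alpha> - dcoef k b \<alpha>)"
  by (rule ext) (simp add: dcoef_def hilbert.scale_right_diff_distrib)

lemma dcoef_add: "dcoef k (\<lambda>\<alpha>. a \<alpha> + b \<alpha>) = (\<lambda>\<alpha>. dcoef k a \<alpha> + dcoef k b \<alpha>)"
  by (rule ext) (simp add: dcoef_def scaleC_add_right)

lemma dcoef_scale: "dcoef k (\<lambda>\<alpha>. c *\<^sub>C a \<alpha>) = (\<lambda>\<alpha>. c *\<^sub>C dcoef k a \<alpha>)"
  by (rule ext) (simp add: dcoef_def scaleC_scaleC mult.commute)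

text \<open>Coefficients and derivatives at points of the ball depend continuously on the Hardy
  norm, by \<open>hardy_term_le\<close> and the kernel bound
  \<open>hardy_dcoef_psum_le\<close>.\<close>

lemma hardy_tendsto:
  fixes a :: "('d::finite \<Rightarrow> nat) \<Rightarrow> 'm::complex_hilbert"
  assumes b: "\<And>n. hardy_summable (b n)" and a: "hardy_summable a"
    and lim: "(\<lambda>n. hardy_sq (\<lambda>\<alpha>. b n \<alpha> - a \<alpha>)) \<longlonglongrightarrow> 0"
  shows "(\<lambda>n. b n \<alpha>) \<longlonglongrightarrow> a \<alpha>"
    and "norm z < 1 \<Longrightarrow> (\<lambda>n. psum (dcoef k (b n)) z) \<longlonglongrightarrow> psum (dcoef k a) z"
proof -
  have d: "hardy_summable (\<lambda>\<alpha>. b n \<alpha> - a \<alpha>)" for n by (rule hardy_summable_diff[OF b a])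
  have 1: "norm (b n \<alpha> - a \<alpha>) \<le> sqrt (hardy_sq (\<lambda>\<alpha>. b n \<alpha> - a \<alpha>) / monomial_norm_sq \<alpha>)" for n
    using hardy_term_le[OF d, of n \<alpha>] monomial_norm_sq_pos[of \<alpha>]
    by (intro real_le_rsqrt) (simp add: field_simps)
  have 2: "(\<lambda>n. sqrt (hardy_sq (\<lambda>\<alpha>. b n \<alpha> - a \<alpha>) / monomial_norm_sq \<alpha>)) \<longlonglongrightarrow> 0"
    using tendsto_real_sqrt[OF tendsto_divide_zero[OF lim, of "monomial_norm_sq \<alpha>"]] by simp
  have "(\<lambda>n. b n \<alpha> - a \<alpha>) \<longlonglongrightarrow> 0"
    by (rule Lim_null_comparison[OF always_eventually 2]) (use 1 in simp)
  then show "(\<lambda>n. b n \<alpha>) \<longlonglongrightarrow> a \<alpha>" by (rule LIM_zero_cancel)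
  assume z: "norm z < 1"
  let ?C = "hardy_kernel' CARD('d) (norm z)"
  have 3: "norm (psum (dcoef k (b n)) z - psum (dcoef k a) z) \<le> sqrt (?C * hardy_sq (\<lambda>\<alpha>. b n \<alpha> - a \<alpha>))" for n
  proof -
    have "psum (dcoef k (\<lambda>\<alpha>. b n \<alpha> - a \<alpha>)) z = psum (dcoef k (b n)) z - psum (dcoef k a) z"
      unfolding dcoef_diff
      by (rule psum_diff[OF abs_conv_dcoef[OF hardy_abs_conv[OF b]] abs_conv_dcoef[OF hardy_abs_conv[OF a]] z])
    then show ?thesis using hardy_dcoef_psum_le[OF d order_refl z, of k n] by (simp only:)
  qed
  have 4: "(\<lambda>n. sqrt (?C * hardy_sq (\<lambda>\<alpha>. b n \<alpha> - a \<alpha>))) \<longlonglongrightarrow> 0"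
    using tendsto_real_sqrt[OF tendsto_mult_right_zero[OF lim, of ?C]] by simp
  have "(\<lambda>n. psum (dcoef k (b n)) z - psum (dcoef k a) z) \<longlonglongrightarrow> 0"
    by (rule Lim_null_comparison[OF always_eventually 4]) (use 3 in simp)
  then show "(\<lambda>n. psum (dcoef k (b n)) z) \<longlonglongrightarrow> psum (dcoef k a) z" by (rule LIM_zero_cancel)
qed

text \<open>Fatou's lemma on a space with two points.\<close>

lemma liminf_add_ennreal:
  fixes f g :: "nat \<Rightarrow> ennreal"
  shows "liminf f + liminf g \<le> liminf (\<lambda>n. f n + g n)"
proof -
  have "(\<integral>\<^sup>+b. liminf (\<lambda>n. if b then f n else g n) \<partial>count_space UNIV)
      \<le> liminf (\<lambda>n. \<integral>\<^sup>+b. (if b then f n else g n) \<partial>count_space (UNIV :: bool set))"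
    by (rule nn_integral_liminf) simp
  then show ?thesis by (simp add: nn_integral_count_space_finite UNIV_bool add.commute)
qed

section \<open>The Dirichlet-type space in terms of coefficients\<close>

lemma measure_ball_pos: "measure lborel (ball (0 :: complex ^ 'd) 1) > 0"
  using content_ball_pos[of 1 "0 :: complex ^ 'd"] by simp

context semispectral
begin

text \<open>The factor 1 / d of the norm combined with the normalization of the volume, so that
  integrals can be taken with respect to Lebesgue measure.\<close>

definition kappa :: real where
  "kappa = 1 / (real CARD('d) * measure lborel (ball (0 :: complex ^ 'd) 1))"

lemma kappa_pos: "kappa > 0"
  unfolding kappa_def using measure_ball_pos[where 'd = 'd] by simp

lemma dens_measurable:
  assumes "hardy_summable a"
  shows "(\<lambda>z. indicator (ball 0 1) z * dens a z) \<in> borel_measurable lborel"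
proof -
  have "(\<lambda>z. \<Sum>k\<in>UNIV. Re (indicator (ball 0 1) z *\<^sub>R W z (psum (dcoef k a) z) (psum (dcoef k a) z))) \<in> borel_measurable lborel"
    by (rule borel_measurable_sum,
        rule measurable_compose[OF W_psum_measurable(4)[OF assms assms] borel_measurable_continuous_onI[OF continuous_on_Re[OF continuous_on_id]]])
  moreover have "(\<Sum>k\<in>UNIV. Re (indicator (ball 0 1) z *\<^sub>R W z (psum (dcoef k a) z) (psum (dcoef k a) z)))
    = indicator (ball 0 1) z * dens a z" for z
    by (cases "norm z < 1") (simp_all add: dens_def W_self)
  ultimately show ?thesis by (simp only:)
qed

definition dens_ennreal :: "(('d \<Rightarrow> nat) \<Rightarrow> 'm) \<Rightarrow> ennreal" where
  "dens_ennreal a = (\<integral>\<^sup>+z. ennreal (indicator (ball 0 1) z * dens a z) \<partial>lborel)"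

definition E :: "(('d \<Rightarrow> nat) \<Rightarrow> 'm) \<Rightarrow> ennreal" where
  "E a = dirichlet_norm_sq F (ball_ext a)"

lemma E_eq:
  assumes a: "hardy_summable a"
  shows "E a = hardy_ennreal a + ennreal kappa * dens_ennreal a"
proof -
  let ?B = "ball (0 :: complex ^ 'd) 1"
  let ?m = "measure lborel ?B"
  have m: "emeasure lborel ?B = ennreal ?m" "?m > 0"
    using emeasure_bounded_finite[OF bounded_ball, of "0 :: complex ^ 'd" 1] measure_ball_pos[where 'd = 'd]
    by (simp_all add: emeasure_eq_ennreal_measure less_top)
  have "(\<integral>\<^sup>+z. ennreal (\<Sum>j\<in>UNIV. Re (cinner (poisson_integral F z (cpartial j (ball_ext a) z)) (cpartial j (ball_ext a) z))) \<partial>ball_volume)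
    = (\<integral>\<^sup>+z. ennreal (indicator ?B z * dens a z) \<partial>ball_volume)"
    unfolding ball_volume_def
  proof (rule nn_integral_cong_AE, rule AE_uniform_measureI)
    show "AE z in lborel. z \<in> ?B \<longrightarrow> ennreal (\<Sum>j\<in>UNIV. Re (cinner (poisson_integral F z (cpartial j (ball_ext a) z)) (cpartial j (ball_ext a) z)))
      = ennreal (indicator ?B z * dens a z)"
      by (rule AE_I2) (simp add: cpartial_ball_ext[OF hardy_abs_conv[OF a]] poisson_integral_self dens_def)
  qed simp
  also have "\<dots> = (\<integral>\<^sup>+z. ennreal (indicator ?B z * dens a z) * indicator ?B z \<partial>lborel) / emeasure lborel ?B"
    unfolding ball_volume_def
    by (rule nn_integral_uniform_measure) (use dens_measurable[OF a] in auto)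
  also have "(\<integral>\<^sup>+z. ennreal (indicator ?B z * dens a z) * indicator ?B z \<partial>lborel) = dens_ennreal a"
    unfolding dens_ennreal_def by (rule nn_integral_cong) (simp add: indicator_def)
  finally have *: "(\<integral>\<^sup>+z. ennreal (\<Sum>j\<in>UNIV. Re (cinner (poisson_integral F z (cpartial j (ball_ext a) z)) (cpartial j (ball_ext a) z))) \<partial>ball_volume)
    = dens_ennreal a / ennreal ?m" unfolding m(1) .
  have "dens_ennreal a / ennreal ?m = ennreal (1 / ?m) * dens_ennreal a"
    using m(2) by (simp add: divide_ennreal_def inverse_ennreal mult.commute inverse_eq_divide)
  moreover have "ennreal (1 / real CARD('d)) * ennreal (1 / ?m) = ennreal kappa"
    using m(2) by (simp add: kappa_def ennreal_mult[symmetric])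
  ultimately have "ennreal (1 / real CARD('d)) * (\<integral>\<^sup>+z. ennreal (\<Sum>j\<in>UNIV. Re (cinner (poisson_integral F z (cpartial j (ball_ext a) z)) (cpartial j (ball_ext a) z))) \<partial>ball_volume)
    = ennreal kappa * dens_ennreal a"
    unfolding * by (simp add: mult.assoc[symmetric])
  then show ?thesis
    unfolding E_def dirichlet_norm_sq_def hardy_norm_sq_ball_ext[OF hardy_abs_conv[OF a]] by simp
qed

text \<open>The coefficient families of the Dirichlet-type space, by
  \<open>dirichlet_space_eq\<close>. On them sums, shifts and limits are taken coefficient by
  coefficient.\<close>

definition D :: "(('d \<Rightarrow> nat) \<Rightarrow> 'm) set" where
  "D = {a. hardy_summable a \<and> set_integrable lborel (ball 0 1) (dens a)}"

definition nsqD :: "(('d \<Rightarrow> nat) \<Rightarrow> 'm) \<Rightarrow> real" where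
  "nsqD a = hardy_sq a + kappa * (LINT z:ball 0 1|lborel. dens a z)"

lemma dens_integral_nonneg: "0 \<le> (LINT z:ball 0 1|lborel. dens a z)"
  unfolding set_lebesgue_integral_def
  by (rule Bochner_Integration.integral_nonneg) (simp add: indicator_def dens_nonneg)

lemma nsqD_nonneg: "0 \<le> nsqD a"
  unfolding nsqD_def using kappa_pos hardy_sq_nonneg[of a] dens_integral_nonneg[of a] by simp

lemma hardy_sq_le_nsqD: "hardy_sq a \<le> nsqD a"
  unfolding nsqD_def using kappa_pos dens_integral_nonneg[of a] by simp

lemma E_D:
  assumes "a \<in> D"
  shows "E a = ennreal (nsqD a)"
proof -
  have a: "hardy_summable a" and int: "integrable lborel (\<lambda>z. indicator (ball 0 1) z * dens a z)"
    using assms by (simp_all add: D_def set_integrable_def)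
  have "dens_ennreal a = ennreal (LINT z:ball 0 1|lborel. dens a z)"
    unfolding dens_ennreal_def set_lebesgue_integral_def real_scaleR_def
    by (rule nn_integral_eq_integral[OF int]) (simp add: indicator_def dens_nonneg)
  then show ?thesis
    using kappa_pos dens_integral_nonneg[of a] hardy_sq_nonneg[of a]
    by (simp add: E_eq[OF a] hardy_ennreal_eq[OF a] nsqD_def ennreal_mult[symmetric] ennreal_plus[symmetric] del: ennreal_plus)
qed

lemma E_finite_D:
  assumes "abs_conv a" "E a < \<infinity>"
  shows "a \<in> D"
proof -
  have "hardy_ennreal a \<le> E a"
    unfolding E_def dirichlet_norm_sq_def hardy_norm_sq_ball_ext[OF assms(1)] by simp
  then have a: "hardy_summable a" using assms(2) by (intro hardy_summable_of_finite) (rule le_less_trans)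
  have "ennreal kappa * dens_ennreal a < \<infinity>"
    using assms(2) unfolding E_eq[OF a] by (simp add: less_top)
  then have "dens_ennreal a < \<infinity>" using kappa_pos by (auto simp: ennreal_mult_less_top)
  then have "integrable lborel (\<lambda>z. indicator (ball 0 1) z * dens a z)"
    unfolding integrable_iff_bounded dens_ennreal_def
    by (intro conjI dens_measurable[OF a])
      (simp add: abs_of_nonneg indicator_def dens_nonneg cong: if_cong)
  then show ?thesis using a by (simp add: D_def set_integrable_def)
qed

lemma dirichlet_space_eq: "dirichlet_space F = ball_ext ` D"
proof (intro set_eqI iffI)
  fix f assume f: "f \<in> dirichlet_space F"
  then obtain a where a: "abs_conv a" "f = ball_ext a"
    unfolding dirichlet_space_def by (blast elim: ball_holomorphicE)
  have "E a < \<infinity>" using f a unfolding dirichlet_space_def E_def by simp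
  then show "f \<in> ball_ext ` D" using a E_finite_D by blast
next
  fix f assume "f \<in> ball_ext ` D"
  then obtain a where a: "a \<in> D" "f = ball_ext a" by blast
  then have "hardy_summable a" by (simp add: D_def)
  then have "f \<in> ball_holomorphic" using a ball_ext_holomorphic[OF hardy_abs_conv] by blast
  moreover have "dirichlet_norm_sq F f < \<infinity>" using E_D[OF a(1)] a(2) unfolding E_def by simp
  ultimately show "f \<in> dirichlet_space F" by (simp add: dirichlet_space_def)
qed

text \<open>Hardy convergence makes the densities converge pointwise on the ball, so Fatou's lemma
  bounds the Dirichlet part, while the Hardy part is a supremum of finite sums of convergent terms.
  Asking only for Hardy convergence makes the lemma applicable both to Cauchy sequences and to
  images under a multiplication whose continuity is still to be shown.\<close>

lemma E_lsc:
  assumes b: "\<And>n. hardy_summable (b n)" and a: "hardy_summable a"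
    and lim: "(\<lambda>n. hardy_sq (\<lambda>\<alpha>. b n \<alpha> - a \<alpha>)) \<longlonglongrightarrow> 0" and le: "\<And>n. E (b n) \<le> c"
  shows "E a \<le> c"
proof -
  note conv = hardy_tendsto[OF b a lim]
  have "ennreal kappa * dens_ennreal a = (\<integral>\<^sup>+z. liminf (\<lambda>n. ennreal kappa * ennreal (indicator (ball 0 1) z * dens (b n) z)) \<partial>lborel)"
  proof -
    have "ennreal kappa * ennreal (indicator (ball 0 1) z * dens a z)
      = liminf (\<lambda>n. ennreal kappa * ennreal (indicator (ball 0 1) z * dens (b n) z))" for z :: "complex ^ 'd"
    proof (cases "norm z < 1")
      case True
      have "(\<lambda>n. dens (b n) z) \<longlonglongrightarrow> dens a z"
        unfolding dens_def by (intro tendsto_sum U_tendsto[OF True] conv(2)[OF True])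
      then have "(\<lambda>n. ennreal (kappa * dens (b n) z)) \<longlonglongrightarrow> ennreal (kappa * dens a z)"
        by (intro tendsto_ennrealI tendsto_mult_left)
      then have "(\<lambda>n. ennreal kappa * ennreal (indicator (ball 0 1) z * dens (b n) z))
          \<longlonglongrightarrow> ennreal kappa * ennreal (indicator (ball 0 1) z * dens a z)"
        using True kappa_pos dens_nonneg[OF True] by (simp add: ennreal_mult)
      then show ?thesis by (intro lim_imp_Liminf[symmetric]) simp_all
    qed (simp add: Liminf_const)
    then show ?thesis
      unfolding dens_ennreal_def using dens_measurable[OF a]
      by (subst nn_integral_cmult[symmetric]) simp_all
  qed
  also have "\<dots> \<le> liminf (\<lambda>n. \<integral>\<^sup>+z. ennreal kappa * ennreal (indicator (ball 0 1) z * dens (b n) z) \<partial>lborel)"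
    using dens_measurable[OF b] by (intro nn_integral_liminf) simp
  also have "\<dots> = liminf (\<lambda>n. ennreal kappa * dens_ennreal (b n))"
    unfolding dens_ennreal_def using dens_measurable[OF b] by (simp add: nn_integral_cmult)
  finally have fatou: "ennreal kappa * dens_ennreal a \<le> liminf (\<lambda>n. ennreal kappa * dens_ennreal (b n))" .
  \<comment> \<open>Finite sums converge termwise, so the estimate is made for each finite set
    \<open>G\<close> and the supremum is taken at the end.\<close>
  have G: "(\<Sum>\<alpha>\<in>G. ennreal ((norm (a \<alpha>))\<^sup>2 * monomial_norm_sq \<alpha>)) + ennreal kappa * dens_ennreal a \<le> c"
    if "finite G" for G
  proof -
    have "(\<lambda>n. \<Sum>\<alpha>\<in>G. ennreal ((norm (b n \<alpha>))\<^sup>2 * monomial_norm_sq \<alpha>)) \<longlonglongrightarrow> (\<Sum>\<alpha>\<in>G. ennreal ((norm (a \<alpha>))\<^sup>2 * monomial_norm_sq \<alpha>))"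
      by (intro tendsto_sum tendsto_ennrealI tendsto_mult_right tendsto_power tendsto_norm conv(1))
    then have "(\<Sum>\<alpha>\<in>G. ennreal ((norm (a \<alpha>))\<^sup>2 * monomial_norm_sq \<alpha>)) = liminf (\<lambda>n. \<Sum>\<alpha>\<in>G. ennreal ((norm (b n \<alpha>))\<^sup>2 * monomial_norm_sq \<alpha>))"
      by (intro lim_imp_Liminf[symmetric]) simp_all
    then have "(\<Sum>\<alpha>\<in>G. ennreal ((norm (a \<alpha>))\<^sup>2 * monomial_norm_sq \<alpha>)) + ennreal kappa * dens_ennreal a
      \<le> liminf (\<lambda>n. \<Sum>\<alpha>\<in>G. ennreal ((norm (b n \<alpha>))\<^sup>2 * monomial_norm_sq \<alpha>)) + liminf (\<lambda>n. ennreal kappa * dens_ennreal (b n))"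
      using fatou by (simp add: add_left_mono)
    also have "\<dots> \<le> liminf (\<lambda>n. (\<Sum>\<alpha>\<in>G. ennreal ((norm (b n \<alpha>))\<^sup>2 * monomial_norm_sq \<alpha>)) + ennreal kappa * dens_ennreal (b n))"
      by (rule liminf_add_ennreal)
    also have "\<dots> \<le> liminf (\<lambda>n. c)"
    proof (intro Liminf_mono always_eventually allI)
      fix n
      have "(\<Sum>\<alpha>\<in>G. ennreal ((norm (b n \<alpha>))\<^sup>2 * monomial_norm_sq \<alpha>)) \<le> hardy_ennreal (b n)"
        unfolding hardy_ennreal_SUP using that by (intro SUP_upper) auto
      then show "(\<Sum>\<alpha>\<in>G. ennreal ((norm (b n \<alpha>))\<^sup>2 * monomial_norm_sq \<alpha>)) + ennreal kappa * dens_ennreal (b n) \<le> c"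
        using le[of n] unfolding E_eq[OF b] by (meson add_right_mono order_trans)
    qed
    finally show ?thesis by (simp add: Liminf_const)
  qed
  have "E a = (SUP G\<in>{G. finite G \<and> G \<subseteq> UNIV}. (\<Sum>\<alpha>\<in>G. ennreal ((norm (a \<alpha>))\<^sup>2 * monomial_norm_sq \<alpha>)) + ennreal kappa * dens_ennreal a)"
    unfolding E_eq[OF a] hardy_ennreal_SUP by (rule ennreal_SUP_add_left[symmetric]) auto
  also have "\<dots> \<le> c" by (rule SUP_least) (use G in auto)
  finally show ?thesis .
qed

end

context semispectral
begin

section \<open>Linear structure of the coefficient space\<close>

lemma D_hardy: "a \<in> D \<Longrightarrow> hardy_summable a"
  by (simp add: D_def)

lemma D_abs_conv: "a \<in> D \<Longrightarrow> abs_conv a"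
  by (rule hardy_abs_conv[OF D_hardy])

lemma dens_integrable_of_le:
  assumes "hardy_summable a" "set_integrable lborel (ball 0 1) g"
    "\<And>z. norm z < 1 \<Longrightarrow> dens a z \<le> g z"
  shows "set_integrable lborel (ball 0 1) (dens a)"
  unfolding set_integrable_def
proof (rule Bochner_Integration.integrable_bound[OF assms(2)[unfolded set_integrable_def]])
  show "(\<lambda>z. indicator (ball 0 1) z *\<^sub>R dens a z) \<in> borel_measurable lborel"
    using dens_measurable[OF assms(1)] by simp
  show "AE z in lborel. norm (indicator (ball 0 1) z *\<^sub>R dens a z) \<le> norm (indicator (ball 0 1) z *\<^sub>R g z)"
  proof (rule AE_I2)
    fix z :: "complex ^ 'd"
    show "norm (indicator (ball 0 1) z *\<^sub>R dens a z) \<le> norm (indicator (ball 0 1) z *\<^sub>R g z)"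
      using assms(3)[of z] dens_nonneg[of z a] by (cases "norm z < 1") simp_all
  qed
qed

lemma D_add:
  assumes a: "a \<in> D" and b: "b \<in> D"
  shows "(\<lambda>\<alpha>. a \<alpha> + b \<alpha>) \<in> D"
proof -
  have s: "hardy_summable (\<lambda>\<alpha>. a \<alpha> + b \<alpha>)" by (rule hardy_summable_add[OF D_hardy[OF a] D_hardy[OF b]])
  have "dens (\<lambda>\<alpha>. a \<alpha> + b \<alpha>) z \<le> 2 * dens a z + 2 * dens b z" if z: "norm z < 1" for z
  proof -
    have "dens (\<lambda>\<alpha>. a \<alpha> + b \<alpha>) z = (\<Sum>k\<in>UNIV. U z (psum (dcoef k a) z + psum (dcoef k b) z))"
      unfolding dens_def dcoef_add
      by (intro sum.cong refl) (simp add: psum_add[OF abs_conv_dcoef[OF D_abs_conv[OF a]] abs_conv_dcoef[OF D_abs_conv[OF b]] z])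
    also have "\<dots> \<le> (\<Sum>k\<in>UNIV. 2 * U z (psum (dcoef k a) z) + 2 * U z (psum (dcoef k b) z))"
      by (rule sum_mono) (rule U_add_le[OF z])
    finally show ?thesis by (simp add: dens_def sum.distrib sum_distrib_left)
  qed
  moreover have "set_integrable lborel (ball 0 1) (\<lambda>z. 2 * dens a z + 2 * dens b z)"
    using a b by (intro set_integral_add(1) set_integrable_mult_right) (simp_all add: D_def)
  ultimately show ?thesis using s dens_integrable_of_le[OF s] by (simp add: D_def)
qed

lemma D_scale:
  assumes a: "a \<in> D"
  shows "(\<lambda>\<alpha>. c *\<^sub>C a \<alpha>) \<in> D"
proof -
  have s: "hardy_summable (\<lambda>\<alpha>. c *\<^sub>C a \<alpha>)" by (rule hardy_summable_scale[OF D_hardy[OF a]])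
  have "dens (\<lambda>\<alpha>. c *\<^sub>C a \<alpha>) z \<le> (cmod c)\<^sup>2 * dens a z" if z: "norm z < 1" for z
    unfolding dens_def dcoef_scale psum_scale[OF abs_conv_dcoef[OF D_abs_conv[OF a]] z] U_scale[OF z]
    by (simp add: sum_distrib_left)
  moreover have "set_integrable lborel (ball 0 1) (\<lambda>z. (cmod c)\<^sup>2 * dens a z)"
    using a by (intro set_integrable_mult_right) (simp add: D_def)
  ultimately show ?thesis using s dens_integrable_of_le[OF s] by (simp add: D_def)
qed

lemma D_diff: "a \<in> D \<Longrightarrow> b \<in> D \<Longrightarrow> (\<lambda>\<alpha>. a \<alpha> - b \<alpha>) \<in> D"
  using D_add[OF _ D_scale[of b "-1"]] by simp

lemma D_zero: "(\<lambda>_. 0) \<in> D"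
proof -
  have p: "psum (\<lambda>_. 0) z = 0" for z :: "complex ^ 'd" by (simp add: psum_def)
  have "dcoef k (\<lambda>_. 0 :: 'm) = (\<lambda>_. 0)" for k :: 'd by (rule ext) (simp add: dcoef_def)
  then have "dens (\<lambda>_. 0) z = (\<Sum>k\<in>(UNIV::'d set). U z 0)" for z by (simp add: dens_def p)
  moreover have "U z 0 = 0" if "norm z < 1" for z using U_scale[OF that, of 0 0] by simp
  ultimately have "set_integrable lborel (ball 0 1) (dens (\<lambda>_. 0))"
    unfolding set_integrable_def
    by (subst Bochner_Integration.integrable_cong[where g = "\<lambda>_. 0"]) (auto simp: indicator_def)
  then show ?thesis by (simp add: D_def hardy_summable_def)
qed

section \<open>The inner product\<close>

definition wform :: "(('d \<Rightarrow> nat) \<Rightarrow> 'm) \<Rightarrow> (('d \<Rightarrow> nat) \<Rightarrow> 'm) \<Rightarrow> complex ^ 'd \<Rightarrow> complex" where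
  "wform a b z = (\<Sum>k\<in>UNIV. W z (psum (dcoef k a) z) (psum (dcoef k b) z))"

text \<open>\<open>W_le\<close> dominates the mixed form by the sum of the two densities.\<close>

lemma wform_integrable:
  assumes a: "a \<in> D" and b: "b \<in> D"
  shows "set_integrable lborel (ball 0 1) (wform a b)"
  unfolding set_integrable_def
proof (rule Bochner_Integration.integrable_bound)
  show "integrable lborel (\<lambda>z. indicator (ball 0 1) z *\<^sub>R (dens a z + dens b z))"
    using set_integral_add(1)[of lborel "ball 0 1" "dens a" "dens b"] a b
    by (simp add: D_def set_integrable_def)
  have "(\<lambda>z. \<Sum>k\<in>UNIV. indicator (ball 0 1) z *\<^sub>R W z (psum (dcoef k a) z) (psum (dcoef k b) z)) \<in> borel_measurable lborel"
    by (rule borel_measurable_sum) (rule W_psum_measurable(4)[OF D_hardy[OF a] D_hardy[OF b]])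
  then show "(\<lambda>z. indicator (ball 0 1) z *\<^sub>R wform a b z) \<in> borel_measurable lborel"
    unfolding wform_def scaleR_sum_right .
  show "AE z in lborel. norm (indicator (ball 0 1) z *\<^sub>R wform a b z) \<le> norm (indicator (ball 0 1) z *\<^sub>R (dens a z + dens b z))"
  proof (rule AE_I2)
    fix z :: "complex ^ 'd"
    show "norm (indicator (ball 0 1) z *\<^sub>R wform a b z) \<le> norm (indicator (ball 0 1) z *\<^sub>R (dens a z + dens b z))"
    proof (cases "norm z < 1")
      case True
      have "norm (wform a b z) \<le> (\<Sum>k\<in>UNIV. U z (psum (dcoef k a) z) + U z (psum (dcoef k b) z))"
        unfolding wform_def by (rule sum_norm_le) (rule W_le[OF True])
      then show ?thesis using True by (simp add: dens_def sum.distrib)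
    qed simp
  qed
qed

definition dip :: "(('d \<Rightarrow> nat) \<Rightarrow> 'm) \<Rightarrow> (('d \<Rightarrow> nat) \<Rightarrow> 'm) \<Rightarrow> complex" where
  "dip a b = (LINT z:ball 0 1|lborel. wform a b z)"

definition hip :: "(('d \<Rightarrow> nat) \<Rightarrow> 'm) \<Rightarrow> (('d \<Rightarrow> nat) \<Rightarrow> 'm) \<Rightarrow> complex" where
  "hip a b = (\<Sum>\<^sub>\<infinity>\<alpha>. of_real (monomial_norm_sq \<alpha>) * cinner (a \<alpha>) (b \<alpha>))"

text \<open>The inner product written out. Sesquilinearity is established for this expression and
  carried over to the polarized \<open>dirichlet_inner\<close> by
  \<open>dirichlet_inner_eq\<close>.\<close>

definition ipc :: "(('d \<Rightarrow> nat) \<Rightarrow> 'm) \<Rightarrow> (('d \<Rightarrow> nat) \<Rightarrow> 'm) \<Rightarrow> complex" where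
  "ipc a b = hip a b + of_real kappa * dip a b"

lemma hip_has_sum:
  assumes a: "hardy_summable a" and b: "hardy_summable b"
  shows "((\<lambda>\<alpha>. of_real (monomial_norm_sq \<alpha>) * cinner (a \<alpha>) (b \<alpha>)) has_sum hip a b) UNIV"
  unfolding hip_def
proof (rule has_sum_infsum, rule Infinite_Sum.abs_summable_summable, rule nonneg_summable_on_le)
  show "(\<lambda>\<alpha>. (norm (a \<alpha>))\<^sup>2 * monomial_norm_sq \<alpha> + (norm (b \<alpha>))\<^sup>2 * monomial_norm_sq \<alpha>) summable_on UNIV"
    using a b unfolding hardy_summable_def by (rule summable_on_add)
  show "norm (of_real (monomial_norm_sq \<alpha>) * cinner (a \<alpha>) (b \<alpha>)) \<le> (norm (a \<alpha>))\<^sup>2 * monomial_norm_sq \<alpha> + (norm (b \<alpha>))\<^sup>2 * monomial_norm_sq \<alpha>" for \<alpha>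
  proof -
    have "cmod (cinner (a \<alpha>) (b \<alpha>)) \<le> norm (a \<alpha>) * norm (b \<alpha>)" by (rule cinner_cauchy_schwarz)
    also have "\<dots> \<le> (norm (a \<alpha>))\<^sup>2 + (norm (b \<alpha>))\<^sup>2"
      using zero_le_power2[of "norm (a \<alpha>) - norm (b \<alpha>)"] zero_le_power2[of "norm (a \<alpha>)"] zero_le_power2[of "norm (b \<alpha>)"]
        mult_nonneg_nonneg[OF norm_ge_zero norm_ge_zero, of "a \<alpha>" "b \<alpha>"]
      unfolding power2_diff by linarith
    finally have "monomial_norm_sq \<alpha> * cmod (cinner (a \<alpha>) (b \<alpha>)) \<le> monomial_norm_sq \<alpha> * ((norm (a \<alpha>))\<^sup>2 + (norm (b \<alpha>))\<^sup>2)"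
      using monomial_norm_sq_pos[of \<alpha>] by (intro mult_left_mono) auto
    then show ?thesis using monomial_norm_sq_pos[of \<alpha>] by (simp add: norm_mult algebra_simps)
  qed
qed simp

lemma hipI: "((\<lambda>\<alpha>. of_real (monomial_norm_sq \<alpha>) * cinner (a \<alpha>) (b \<alpha>)) has_sum s) UNIV \<Longrightarrow> hip a b = s"
  unfolding hip_def by (rule infsumI)

lemma ipc_add_left:
  assumes a: "a \<in> D" and b: "b \<in> D" and c: "c \<in> D"
  shows "ipc (\<lambda>\<alpha>. a \<alpha> + b \<alpha>) c = ipc a c + ipc b c"
proof -
  have "hip (\<lambda>\<alpha>. a \<alpha> + b \<alpha>) c = hip a c + hip b c"
    by (rule hipI)
      (use has_sum_add[OF hip_has_sum[OF D_hardy[OF a] D_hardy[OF c]] hip_has_sum[OF D_hardy[OF b] D_hardy[OF c]]]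
        in \<open>simp add: cinner_add_left distrib_left\<close>)
  moreover have "dip (\<lambda>\<alpha>. a \<alpha> + b \<alpha>) c = dip a c + dip b c"
  proof -
    have "wform (\<lambda>\<alpha>. a \<alpha> + b \<alpha>) c z = wform a c z + wform b c z" if z: "norm z < 1" for z
      unfolding wform_def dcoef_add
        psum_add[OF abs_conv_dcoef[OF D_abs_conv[OF a]] abs_conv_dcoef[OF D_abs_conv[OF b]] z]
      by (simp add: W_add_left[OF z] sum.distrib)
    then have "dip (\<lambda>\<alpha>. a \<alpha> + b \<alpha>) c = (LINT z:ball 0 1|lborel. wform a c z + wform b c z)"
      unfolding dip_def by (intro set_lebesgue_integral_cong) auto
    then show ?thesis
      unfolding dip_def set_integral_add(2)[OF wform_integrable[OF a c] wform_integrable[OF b c]] .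
  qed
  ultimately show ?thesis by (simp add: ipc_def algebra_simps)
qed

lemma ipc_scale_left:
  assumes a: "a \<in> D" and b: "b \<in> D"
  shows "ipc (\<lambda>\<alpha>. c *\<^sub>C a \<alpha>) b = c * ipc a b"
proof -
  have "hip (\<lambda>\<alpha>. c *\<^sub>C a \<alpha>) b = c * hip a b"
    by (rule hipI)
      (use has_sum_cmult_right[OF hip_has_sum[OF D_hardy[OF a] D_hardy[OF b]], of c]
        in \<open>simp add: cinner_scaleC_left mult.left_commute\<close>)
  moreover have "dip (\<lambda>\<alpha>. c *\<^sub>C a \<alpha>) b = c * dip a b"
  proof -
    have "wform (\<lambda>\<alpha>. c *\<^sub>C a \<alpha>) b z = c * wform a b z" if z: "norm z < 1" for z
      unfolding wform_def dcoef_scale psum_scale[OF abs_conv_dcoef[OF D_abs_conv[OF a]] z]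
      by (simp add: W_scale_left[OF z] sum_distrib_left)
    then have "dip (\<lambda>\<alpha>. c *\<^sub>C a \<alpha>) b = (LINT z:ball 0 1|lborel. c * wform a b z)"
      unfolding dip_def by (intro set_lebesgue_integral_cong) auto
    then show ?thesis unfolding dip_def by simp
  qed
  ultimately show ?thesis by (simp add: ipc_def algebra_simps)
qed

lemma ipc_commute:
  assumes a: "a \<in> D" and b: "b \<in> D"
  shows "ipc a b = cnj (ipc b a)"
proof -
  have "hip a b = cnj (hip b a)"
  proof (rule hipI)
    have "((\<lambda>\<alpha>. cnj (of_real (monomial_norm_sq \<alpha>) * cinner (b \<alpha>) (a \<alpha>))) has_sum cnj (hip b a)) UNIV"
      using has_sum_bounded_linear[OF bounded_linear_cnj hip_has_sum[OF D_hardy[OF b] D_hardy[OF a]]]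
      by (simp add: o_def)
    then show "((\<lambda>\<alpha>. of_real (monomial_norm_sq \<alpha>) * cinner (a \<alpha>) (b \<alpha>)) has_sum cnj (hip b a)) UNIV"
      by (simp add: cinner_commute[of "a _" "b _"])
  qed
  moreover have "dip a b = cnj (dip b a)"
  proof -
    have "wform a b z = cnj (wform b a z)" if z: "norm z < 1" for z
      unfolding wform_def cnj_sum by (rule sum.cong[OF refl]) (rule W_commute[OF z])
    then have "dip a b = (LINT z:ball 0 1|lborel. cnj (wform b a z))"
      unfolding dip_def by (intro set_lebesgue_integral_cong) auto
    also have "\<dots> = (\<integral>z. cnj (indicator (ball 0 1) z *\<^sub>R wform b a z) \<partial>lborel)"
      unfolding set_lebesgue_integral_def by simp
    also have "\<dots> = cnj (dip b a)"
      unfolding dip_def set_lebesgue_integral_def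
      by (rule Bochner_Integration.integral_cnj)
    finally show ?thesis .
  qed
  ultimately show ?thesis by (simp add: ipc_def)
qed

lemma ipc_add_right: "a \<in> D \<Longrightarrow> b \<in> D \<Longrightarrow> c \<in> D \<Longrightarrow> ipc c (\<lambda>\<alpha>. a \<alpha> + b \<alpha>) = ipc c a + ipc c b"
  using ipc_commute[of c "\<lambda>\<alpha>. a \<alpha> + b \<alpha>"] ipc_commute[of c a] ipc_commute[of c b]
  by (simp add: ipc_add_left D_add)

lemma ipc_scale_right: "a \<in> D \<Longrightarrow> b \<in> D \<Longrightarrow> ipc a (\<lambda>\<alpha>. c *\<^sub>C b \<alpha>) = cnj c * ipc a b"
  using ipc_commute[of a "\<lambda>\<alpha>. c *\<^sub>C b \<alpha>"] ipc_commute[of a b]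
  by (simp add: ipc_scale_left D_scale)

lemma ipc_self:
  assumes a: "a \<in> D"
  shows "ipc a a = of_real (nsqD a)"
proof -
  have "hip a a = of_real (hardy_sq a)"
  proof (rule hipI)
    have "((\<lambda>\<alpha>. complex_of_real ((norm (a \<alpha>))\<^sup>2 * monomial_norm_sq \<alpha>)) has_sum of_real (hardy_sq a)) UNIV"
      using has_sum_bounded_linear[OF bounded_linear_of_real hardy_has_sum[OF D_hardy[OF a]]]
      by (simp add: o_def)
    then show "((\<lambda>\<alpha>. of_real (monomial_norm_sq \<alpha>) * cinner (a \<alpha>) (a \<alpha>)) has_sum of_real (hardy_sq a)) UNIV"
      by (simp add: cinner_self mult.commute)
  qed
  moreover have "dip a a = of_real (LINT z:ball 0 1|lborel. dens a z)"
  proof -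
    have "wform a a z = of_real (dens a z)" if z: "norm z < 1" for z
      by (simp add: wform_def dens_W[OF z D_abs_conv[OF a]])
    then have "dip a a = (LINT z:ball 0 1|lborel. complex_of_real (dens a z))"
      unfolding dip_def by (intro set_lebesgue_integral_cong) auto
    also have "\<dots> = of_real (LINT z:ball 0 1|lborel. dens a z)"
      unfolding set_lebesgue_integral_def
      by (subst integral_complex_of_real[symmetric]) (simp add: scaleR_conv_of_real)
    finally show ?thesis .
  qed
  ultimately show ?thesis by (simp add: ipc_def nsqD_def)
qed

lemma ball_ext_add: "a \<in> D \<Longrightarrow> b \<in> D \<Longrightarrow> ball_ext a + ball_ext b = ball_ext (\<lambda>\<alpha>. a \<alpha> + b \<alpha>)"
  by (rule ext) (simp add: ball_ext_def psum_add[OF D_abs_conv D_abs_conv])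

lemma ball_ext_scale: "a \<in> D \<Longrightarrow> fun_scaleC c (ball_ext a) = ball_ext (\<lambda>\<alpha>. c *\<^sub>C a \<alpha>)"
  by (rule ext) (simp add: ball_ext_def fun_scaleC_def psum_scale[OF D_abs_conv])

lemma ball_ext_diff: "a \<in> D \<Longrightarrow> b \<in> D \<Longrightarrow> ball_ext a - ball_ext b = ball_ext (\<lambda>\<alpha>. a \<alpha> - b \<alpha>)"
  by (rule ext) (simp add: ball_ext_def psum_diff[OF D_abs_conv D_abs_conv])

text \<open>The squared norm of a + c b is expanded for the four powers c of \<open>\<i>\<close>; in
  the weighted sum only the term with the factor \<open>cnj c\<close> survives, four times.\<close>

lemma dirichlet_inner_eq:
  assumes a: "a \<in> D" and b: "b \<in> D"
  shows "dirichlet_inner F (ball_ext a) (ball_ext b) = ipc a b"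
proof -
  have "complex_of_real (enn2real (dirichlet_norm_sq F (ball_ext a + fun_scaleC c (ball_ext b))))
    = ipc a a + cnj c * ipc a b + c * ipc b a + c * cnj c * ipc b b" for c
  proof -
    have d: "(\<lambda>\<alpha>. a \<alpha> + c *\<^sub>C b \<alpha>) \<in> D" by (rule D_add[OF a D_scale[OF b]])
    have "ball_ext a + fun_scaleC c (ball_ext b) = ball_ext (\<lambda>\<alpha>. a \<alpha> + c *\<^sub>C b \<alpha>)"
      unfolding ball_ext_scale[OF b] by (rule ball_ext_add[OF a D_scale[OF b]])
    then have "complex_of_real (enn2real (dirichlet_norm_sq F (ball_ext a + fun_scaleC c (ball_ext b))))
      = ipc (\<lambda>\<alpha>. a \<alpha> + c *\<^sub>C b \<alpha>) (\<lambda>\<alpha>. a \<alpha> + c *\<^sub>C b \<alpha>)"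
      using E_D[OF d] nsqD_nonneg by (simp add: E_def ipc_self[OF d])
    also have "\<dots> = ipc a a + cnj c * ipc a b + c * ipc b a + c * cnj c * ipc b b"
      using a b d D_scale[OF b, of c]
      by (simp add: ipc_add_left ipc_add_right ipc_scale_left ipc_scale_right)
    finally show ?thesis .
  qed
  then show ?thesis
    by (simp add: dirichlet_inner_def eval_nat_numeral algebra_simps)
qed

lemma ip_norm_eq: "a \<in> D \<Longrightarrow> ip_norm (dirichlet_inner F) (ball_ext a) = sqrt (nsqD a)"
  by (simp add: ip_norm_def dirichlet_inner_eq ipc_self)

section \<open>Completeness\<close>

lemma nsqD_le_of_E_le: "a \<in> D \<Longrightarrow> 0 \<le> c \<Longrightarrow> E a \<le> ennreal c \<Longrightarrow> nsqD a \<le> c"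
  by (simp add: E_D ennreal_le_iff)

text \<open>The limit is found coefficient by coefficient, since the Hardy part of the norm controls
  each coefficient. Convergence in the full norm follows from lower semicontinuity, with one index
  of the differences fixed and the other tending to infinity.\<close>

lemma D_complete:
  assumes b: "\<And>n. b n \<in> D"
    and cauchy: "\<And>\<epsilon>. \<epsilon> > 0 \<Longrightarrow> \<exists>N. \<forall>m\<ge>N. \<forall>n\<ge>N. nsqD (\<lambda>\<alpha>. b m \<alpha> - b n \<alpha>) < \<epsilon>"
  obtains a where "a \<in> D" "(\<lambda>n. nsqD (\<lambda>\<alpha>. b n \<alpha> - a \<alpha>)) \<longlonglongrightarrow> 0"
proof -
  have coef: "(norm (b m \<alpha> - b n \<alpha>))\<^sup>2 * monomial_norm_sq \<alpha> \<le> nsqD (\<lambda>\<alpha>. b m \<alpha> - b n \<alpha>)" for m n \<alpha>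
    by (rule order_trans[OF hardy_term_le[OF D_hardy[OF D_diff[OF b b]]] hardy_sq_le_nsqD])
  have "Cauchy (\<lambda>n. b n \<alpha>)" for \<alpha>
  proof (rule metric_CauchyI)
    fix e :: real assume e: "e > 0"
    let ?w = "monomial_norm_sq \<alpha>"
    have "e\<^sup>2 * ?w > 0" using e monomial_norm_sq_pos[of \<alpha>] by simp
    then obtain N where N: "\<forall>m\<ge>N. \<forall>n\<ge>N. nsqD (\<lambda>\<alpha>. b m \<alpha> - b n \<alpha>) < e\<^sup>2 * ?w" using cauchy by blast
    have "dist (b m \<alpha>) (b n \<alpha>) < e" if "m \<ge> N" "n \<ge> N" for m n
    proof -
      have "(norm (b m \<alpha> - b n \<alpha>))\<^sup>2 * ?w < e\<^sup>2 * ?w" using coef[of m \<alpha> n] N that by force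
      then have "(norm (b m \<alpha> - b n \<alpha>))\<^sup>2 < e\<^sup>2" using monomial_norm_sq_pos[of \<alpha>] by simp
      then show ?thesis using e by (simp add: dist_norm power2_less_imp_less)
    qed
    then show "\<exists>N. \<forall>m\<ge>N. \<forall>n\<ge>N. dist (b m \<alpha>) (b n \<alpha>) < e" by blast
  qed
  then have "\<forall>\<alpha>. \<exists>l. (\<lambda>n. b n \<alpha>) \<longlonglongrightarrow> l" using Cauchy_convergent_iff convergent_def by blast
  then obtain a where a: "\<And>\<alpha>. (\<lambda>n. b n \<alpha>) \<longlonglongrightarrow> a \<alpha>" by metis
  have hardy: "hardy_summable (\<lambda>\<alpha>. b n \<alpha> - a \<alpha>)" "hardy_sq (\<lambda>\<alpha>. b n \<alpha> - a \<alpha>) \<le> \<epsilon>"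
    if N: "\<forall>m\<ge>N. \<forall>n\<ge>N. nsqD (\<lambda>\<alpha>. b m \<alpha> - b n \<alpha>) < \<epsilon>" and n: "n \<ge> N" for n N \<epsilon>
  proof -
    have "(\<Sum>\<alpha>\<in>G. (norm (b n \<alpha> - a \<alpha>))\<^sup>2 * monomial_norm_sq \<alpha>) \<le> \<epsilon>" if G: "finite G" for G
    proof (rule LIMSEQ_le_const2)
      show "(\<lambda>m. \<Sum>\<alpha>\<in>G. (norm (b n \<alpha> - b m \<alpha>))\<^sup>2 * monomial_norm_sq \<alpha>) \<longlonglongrightarrow> (\<Sum>\<alpha>\<in>G. (norm (b n \<alpha> - a \<alpha>))\<^sup>2 * monomial_norm_sq \<alpha>)"
        by (intro tendsto_intros a)
      have "(\<Sum>\<alpha>\<in>G. (norm (b n \<alpha> - b m \<alpha>))\<^sup>2 * monomial_norm_sq \<alpha>) \<le> \<epsilon>" if "m \<ge> N" for m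
      proof -
        have "(\<Sum>\<alpha>\<in>G. (norm (b n \<alpha> - b m \<alpha>))\<^sup>2 * monomial_norm_sq \<alpha>) \<le> hardy_sq (\<lambda>\<alpha>. b n \<alpha> - b m \<alpha>)"
          unfolding hardy_sq_def
          by (rule finite_sum_le_infsum[OF D_hardy[OF D_diff[OF b b], unfolded hardy_summable_def]])
            (use G hardy_term_nonneg[where a = "\<lambda>\<alpha>. b n \<alpha> - b m \<alpha>"] in auto)
        also have "\<dots> \<le> nsqD (\<lambda>\<alpha>. b n \<alpha> - b m \<alpha>)" by (rule hardy_sq_le_nsqD)
        also have "\<dots> \<le> \<epsilon>" using N n that by (meson less_imp_le)
        finally show ?thesis .
      qed
      then show "\<exists>N. \<forall>m\<ge>N. (\<Sum>\<alpha>\<in>G. (norm (b n \<alpha> - b m \<alpha>))\<^sup>2 * monomial_norm_sq \<alpha>) \<le> \<epsilon>" by blast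
    qed
    then show "hardy_summable (\<lambda>\<alpha>. b n \<alpha> - a \<alpha>)" "hardy_sq (\<lambda>\<alpha>. b n \<alpha> - a \<alpha>) \<le> \<epsilon>"
      using hardy_summable_of_bound[of "\<lambda>\<alpha>. b n \<alpha> - a \<alpha>" \<epsilon>] by blast+
  qed
  have hardy_lim: "(\<lambda>n. hardy_sq (\<lambda>\<alpha>. b n \<alpha> - a \<alpha>)) \<longlonglongrightarrow> 0"
  proof (rule LIMSEQ_I)
    fix e :: real assume e: "e > 0"
    then obtain N where N: "\<forall>m\<ge>N. \<forall>n\<ge>N. nsqD (\<lambda>\<alpha>. b m \<alpha> - b n \<alpha>) < e / 2" using cauchy[of "e / 2"] by auto
    have "norm (hardy_sq (\<lambda>\<alpha>. b n \<alpha> - a \<alpha>) - 0) < e" if "n \<ge> N" for n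
      using hardy(2)[OF N that] hardy_sq_nonneg[of "\<lambda>\<alpha>. b n \<alpha> - a \<alpha>"] e by simp
    then show "\<exists>N. \<forall>n\<ge>N. norm (hardy_sq (\<lambda>\<alpha>. b n \<alpha> - a \<alpha>) - 0) < e" by blast
  qed
  have main: "(\<lambda>\<alpha>. b n \<alpha> - a \<alpha>) \<in> D" "nsqD (\<lambda>\<alpha>. b n \<alpha> - a \<alpha>) \<le> \<epsilon>"
    if N: "\<forall>m\<ge>N. \<forall>n\<ge>N. nsqD (\<lambda>\<alpha>. b m \<alpha> - b n \<alpha>) < \<epsilon>" and n: "n \<ge> N" for n N \<epsilon>
  proof -
    have "nsqD (\<lambda>\<alpha>. b n \<alpha> - b n \<alpha>) < \<epsilon>" using N n by blast
    then have \<epsilon>: "0 \<le> \<epsilon>" using nsqD_nonneg[of "\<lambda>\<alpha>. b n \<alpha> - b n \<alpha>"] by linarith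
    \<comment> \<open>For fixed \<open>n\<close> the families b n - b (m + N) tend to b n - a in the
      Hardy norm as m grows; starting the index at \<open>N\<close> puts the squared norms of all of
      them below \<epsilon>.\<close>
    have E: "E (\<lambda>\<alpha>. b n \<alpha> - a \<alpha>) \<le> ennreal \<epsilon>"
    proof (rule E_lsc[where b = "\<lambda>m \<alpha>. b n \<alpha> - b (m + N) \<alpha>"])
      show "hardy_summable (\<lambda>\<alpha>. b n \<alpha> - b (m + N) \<alpha>)" for m by (rule D_hardy[OF D_diff[OF b b]])
      show "hardy_summable (\<lambda>\<alpha>. b n \<alpha> - a \<alpha>)" by (rule hardy(1)[OF N n])
      have "hardy_sq (\<lambda>\<alpha>. (b n \<alpha> - b (m + N) \<alpha>) - (b n \<alpha> - a \<alpha>)) = hardy_sq (\<lambda>\<alpha>. b (m + N) \<alpha> - a \<alpha>)" for m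
        by (simp add: hardy_sq_def norm_minus_commute)
      then show "(\<lambda>m. hardy_sq (\<lambda>\<alpha>. (b n \<alpha> - b (m + N) \<alpha>) - (b n \<alpha> - a \<alpha>))) \<longlonglongrightarrow> 0"
        using LIMSEQ_ignore_initial_segment[OF hardy_lim, of N] by (simp only:)
      show "E (\<lambda>\<alpha>. b n \<alpha> - b (m + N) \<alpha>) \<le> ennreal \<epsilon>" for m
        unfolding E_D[OF D_diff[OF b b]] using N n by (intro ennreal_leI less_imp_le) simp
    qed
    show "(\<lambda>\<alpha>. b n \<alpha> - a \<alpha>) \<in> D"
      by (rule E_finite_D[OF hardy_abs_conv[OF hardy(1)[OF N n]]]) (use E in \<open>simp add: le_less_trans\<close>)
    then show "nsqD (\<lambda>\<alpha>. b n \<alpha> - a \<alpha>) \<le> \<epsilon>" by (rule nsqD_le_of_E_le[OF _ \<epsilon> E])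
  qed
  show ?thesis
  proof (rule that)
    obtain N where N: "\<forall>m\<ge>N. \<forall>n\<ge>N. nsqD (\<lambda>\<alpha>. b m \<alpha> - b n \<alpha>) < 1" using cauchy[of 1] by auto
    \<comment> \<open>So far only differences with \<open>a\<close> are known to lie in
      \<open>D\<close>; subtracting one of them from \<open>b N\<close> recovers
      \<open>a\<close>.\<close>
    have "(\<lambda>\<alpha>. b N \<alpha> - (b N \<alpha> - a \<alpha>)) \<in> D" by (rule D_diff[OF b main(1)[OF N order_refl]])
    then show "a \<in> D" by simp
    show "(\<lambda>n. nsqD (\<lambda>\<alpha>. b n \<alpha> - a \<alpha>)) \<longlonglongrightarrow> 0"
    proof (rule LIMSEQ_I)
      fix e :: real assume e: "e > 0"
      then obtain N where N: "\<forall>m\<ge>N. \<forall>n\<ge>N. nsqD (\<lambda>\<alpha>. b m \<alpha> - b n \<alpha>) < e / 2" using cauchy[of "e / 2"] by auto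
      have "norm (nsqD (\<lambda>\<alpha>. b n \<alpha> - a \<alpha>) - 0) < e" if "n \<ge> N" for n
        using main(2)[OF N that] nsqD_nonneg[of "\<lambda>\<alpha>. b n \<alpha> - a \<alpha>"] e by simp
      then show "\<exists>N. \<forall>n\<ge>N. norm (nsqD (\<lambda>\<alpha>. b n \<alpha> - a \<alpha>) - 0) < e" by blast
    qed
  qed
qed

lemma dirichlet_hilbert: "hilbert_space_on fun_scaleC (dirichlet_space F) (dirichlet_inner F)"
proof -
  interpret vector_space "fun_scaleC :: complex \<Rightarrow> (complex ^ 'd \<Rightarrow> 'm) \<Rightarrow> _"
    by standard (simp_all add: fun_scaleC_def fun_eq_iff scaleC_add_right scaleC_add_left scaleC_scaleC)
  show ?thesis
  proof
    show "subspace (dirichlet_space F)"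
      unfolding subspace_def dirichlet_space_eq
    proof (intro conjI ballI allI)
      have "ball_ext (\<lambda>_. 0) = (0 :: complex ^ 'd \<Rightarrow> 'm)" by (rule ext) (simp add: ball_ext_def psum_def)
      then show "0 \<in> ball_ext ` D" using D_zero by force
    qed (auto simp: ball_ext_add ball_ext_scale intro: D_add D_scale)
    show "dirichlet_inner F (x + y) z = dirichlet_inner F x z + dirichlet_inner F y z"
      if "x \<in> dirichlet_space F" "y \<in> dirichlet_space F" "z \<in> dirichlet_space F" for x y z
      using that unfolding dirichlet_space_eq
      by (auto simp: ball_ext_add dirichlet_inner_eq D_add ipc_add_left)
    show "dirichlet_inner F (fun_scaleC c x) y = c * dirichlet_inner F x y"
      if "x \<in> dirichlet_space F" "y \<in> dirichlet_space F" for c x y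
      using that unfolding dirichlet_space_eq
      by (auto simp: ball_ext_scale dirichlet_inner_eq D_scale ipc_scale_left)
    show "dirichlet_inner F x y = cnj (dirichlet_inner F y x)"
      if "x \<in> dirichlet_space F" "y \<in> dirichlet_space F" for x y
      using that unfolding dirichlet_space_eq
      by (auto simp: dirichlet_inner_eq intro: ipc_commute)
    show "dirichlet_inner F x x \<in> \<real>\<^sub>\<ge>\<^sub>0" if "x \<in> dirichlet_space F" for x
      using that unfolding dirichlet_space_eq
      by (auto simp: dirichlet_inner_eq ipc_self nsqD_nonneg complex_nonneg_Reals_iff)
    show "x = 0" if x: "x \<in> dirichlet_space F" "dirichlet_inner F x x = 0" for x
    proof -
      obtain a where a: "a \<in> D" "x = ball_ext a" using x(1) unfolding dirichlet_space_eq by blast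
      then have "nsqD a = 0" using x(2) by (simp add: dirichlet_inner_eq ipc_self)
      then have "hardy_sq a \<le> 0" using hardy_sq_le_nsqD[of a] by simp
      then have "(norm (a \<alpha>))\<^sup>2 * monomial_norm_sq \<alpha> \<le> 0" for \<alpha>
        using hardy_term_le[OF D_hardy[OF a(1)], of \<alpha>] by linarith
      then have "(norm (a \<alpha>))\<^sup>2 * monomial_norm_sq \<alpha> = 0" for \<alpha>
        by (rule order_antisym[OF _ hardy_term_nonneg])
      then have "a \<alpha> = 0" for \<alpha> using monomial_norm_sq_pos[of \<alpha>] by (metis less_irrefl mult_eq_0_iff norm_eq_zero zero_eq_power2)
      then have "a = (\<lambda>_. 0)" by (rule ext)
      then show "x = 0" unfolding a(2) by (intro ext) (simp add: ball_ext_def psum_def)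
    qed
    show "\<exists>x\<in>dirichlet_space F. (\<lambda>n. ip_norm (dirichlet_inner F) (X n - x)) \<longlonglongrightarrow> 0"
      if X: "range X \<subseteq> dirichlet_space F"
        and C: "\<forall>\<epsilon>>0. \<exists>N. \<forall>m\<ge>N. \<forall>n\<ge>N. ip_norm (dirichlet_inner F) (X m - X n) < \<epsilon>" for X
    proof -
      have "\<forall>n. \<exists>a. a \<in> D \<and> X n = ball_ext a" using X unfolding dirichlet_space_eq by blast
      then obtain b where b: "\<And>n. b n \<in> D" "\<And>n. X n = ball_ext (b n)" by metis
      have n: "ip_norm (dirichlet_inner F) (X n - ball_ext a) = sqrt (nsqD (\<lambda>\<alpha>. b n \<alpha> - a \<alpha>))" if "a \<in> D" for n a
        using b that by (simp add: ball_ext_diff ip_norm_eq D_diff)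
      obtain a where a: "a \<in> D" "(\<lambda>n. nsqD (\<lambda>\<alpha>. b n \<alpha> - a \<alpha>)) \<longlonglongrightarrow> 0"
      proof (rule D_complete[OF b(1)])
        fix \<epsilon> :: real assume \<epsilon>: "\<epsilon> > 0"
        then obtain N where N: "\<forall>m\<ge>N. \<forall>n\<ge>N. ip_norm (dirichlet_inner F) (X m - X n) < sqrt \<epsilon>" using C by force
        have "nsqD (\<lambda>\<alpha>. b m \<alpha> - b n \<alpha>) < \<epsilon>" if "m \<ge> N" "n \<ge> N" for m n
          using N that n[OF b(1), of m n] b(2) by force
        then show "\<exists>N. \<forall>m\<ge>N. \<forall>n\<ge>N. nsqD (\<lambda>\<alpha>. b m \<alpha> - b n \<alpha>) < \<epsilon>" by blast
      qed
      have "(\<lambda>n. sqrt (nsqD (\<lambda>\<alpha>. b n \<alpha> - a \<alpha>))) \<longlonglongrightarrow> sqrt 0" by (rule tendsto_real_sqrt[OF a(2)])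
      then have "(\<lambda>n. ip_norm (dirichlet_inner F) (X n - ball_ext a)) \<longlonglongrightarrow> 0" by (simp add: n[OF a(1)])
      then show ?thesis using a(1) unfolding dirichlet_space_eq by blast
    qed
  qed
qed

text \<open>The multiplier hypothesis, applied once and twice, puts the shifted families into
  \<open>D\<close>, which provides the integrability assumed in \<open>dens_identity\<close>.
  Boundedness is obtained from \<open>H.bounded_operator_of_lsc\<close>.\<close>

lemma dirichlet_joint_two_isometry:
  assumes mult: "\<And>k. coord_multiplier F k"
  shows "joint_isometry_on fun_scaleC (dirichlet_space F) (dirichlet_inner F) 2 coord_mult"
proof -
  interpret H: hilbert_space_on fun_scaleC "dirichlet_space F" "dirichlet_inner F"
    by (rule dirichlet_hilbert)
  have shift_D: "shift k a \<in> D" if a: "a \<in> D" for k a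
  proof -
    have "ball_ext a \<in> dirichlet_space F" using a unfolding dirichlet_space_eq by blast
    then have "ball_ext (shift k a) \<in> dirichlet_space F"
      using mult[of k] unfolding coord_multiplier_def coord_mult_ball_ext[OF D_abs_conv[OF a], symmetric] by blast
    then have "E (shift k a) < \<infinity>" by (simp add: dirichlet_space_def E_def)
    then show ?thesis by (rule E_finite_D[OF abs_conv_shift[OF D_abs_conv[OF a]]])
  qed
  have mult_ext: "coord_mult k (ball_ext a) = ball_ext (shift k a)" if "a \<in> D" for k a
    by (rule coord_mult_ball_ext[OF D_abs_conv[OF that]])
  have TH: "coord_mult k f \<in> dirichlet_space F" if "f \<in> dirichlet_space F" for k f
    using mult that unfolding coord_multiplier_def by blast
  have bdd: "bounded_operator_on fun_scaleC (dirichlet_space F) (dirichlet_inner F) (coord_mult k)" for k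
  proof (rule H.bounded_operator_of_lsc)
    show "coord_mult k (x + y) = coord_mult k x + coord_mult k y" for x y :: "complex ^ 'd \<Rightarrow> 'm"
      by (rule ext) (simp add: coord_mult_def scaleC_add_right)
    show "coord_mult k (fun_scaleC c x) = fun_scaleC c (coord_mult k x)" for c and x :: "complex ^ 'd \<Rightarrow> 'm"
      by (rule ext) (simp add: coord_mult_def fun_scaleC_def scaleC_scaleC mult.commute)
    fix X x c
    assume X: "\<And>n. X n \<in> dirichlet_space F" and x: "x \<in> dirichlet_space F"
      and lim: "(\<lambda>n. ip_norm (dirichlet_inner F) (X n - x)) \<longlonglongrightarrow> 0"
      and c: "\<And>n :: nat. ip_norm (dirichlet_inner F) (coord_mult k (X n)) \<le> c"
    have "\<forall>n. \<exists>a. a \<in> D \<and> X n = ball_ext a" using X unfolding dirichlet_space_eq by blast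
    then obtain b where b: "\<And>n. b n \<in> D" "\<And>n. X n = ball_ext (b n)" by metis
    obtain a where a: "a \<in> D" "x = ball_ext a" using x unfolding dirichlet_space_eq by blast
    have nc: "sqrt (nsqD (shift k (b n))) \<le> c" for n
      using c[of n] by (simp add: b mult_ext ip_norm_eq shift_D)
    have c0: "0 \<le> c" by (rule order_trans[OF _ nc[of 0]]) (simp add: nsqD_nonneg)
    \<comment> \<open>Multiplication by a coordinate contracts the Hardy norm, so Dirichlet
      convergence of \<open>b n\<close> implies Hardy convergence of the images, where lower
      semicontinuity applies.\<close>
    have "E (shift k a) \<le> ennreal (c\<^sup>2)"
    proof (rule E_lsc[where b = "\<lambda>n. shift k (b n)"])
      show "hardy_summable (shift k (b n))" "hardy_summable (shift k a)" for n
        by (rule D_hardy[OF shift_D], fact)+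
      have "(\<lambda>n. (ip_norm (dirichlet_inner F) (X n - x))\<^sup>2) \<longlonglongrightarrow> 0\<^sup>2" by (intro tendsto_power lim)
      then have l: "(\<lambda>n. nsqD (\<lambda>\<alpha>. b n \<alpha> - a \<alpha>)) \<longlonglongrightarrow> 0"
        by (simp add: b a ball_ext_diff ip_norm_eq D_diff nsqD_nonneg)
      have le: "norm (hardy_sq (\<lambda>\<alpha>. shift k (b n) \<alpha> - shift k a \<alpha>)) \<le> nsqD (\<lambda>\<alpha>. b n \<alpha> - a \<alpha>)" for n
      proof -
        have "(\<lambda>\<alpha>. shift k (b n) \<alpha> - shift k a \<alpha>) = shift k (\<lambda>\<alpha>. b n \<alpha> - a \<alpha>)"
          by (rule ext) (simp add: shift_def)
        then have "hardy_sq (\<lambda>\<alpha>. shift k (b n) \<alpha> - shift k a \<alpha>) \<le> hardy_sq (\<lambda>\<alpha>. b n \<alpha> - a \<alpha>)"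
          using hardy_sq_shift_le[OF D_hardy[OF D_diff[OF b(1) a(1)]]] by simp
        then show ?thesis
          using hardy_sq_le_nsqD[of "\<lambda>\<alpha>. b n \<alpha> - a \<alpha>"] hardy_sq_nonneg[of "\<lambda>\<alpha>. shift k (b n) \<alpha> - shift k a \<alpha>"] by simp
      qed
      show "(\<lambda>n. hardy_sq (\<lambda>\<alpha>. shift k (b n) \<alpha> - shift k a \<alpha>)) \<longlonglongrightarrow> 0"
        by (rule Lim_null_comparison[OF always_eventually l]) (use le in blast)
      show "E (shift k (b n)) \<le> ennreal (c\<^sup>2)" for n
        unfolding E_D[OF shift_D[OF b(1)]]
        using power_mono[OF nc, of n 2] nsqD_nonneg[of "shift k (b n)"] by (intro ennreal_leI) simp
    qed
    then have "nsqD (shift k a) \<le> c\<^sup>2" by (rule nsqD_le_of_E_le[OF shift_D[OF a(1)], rotated]) simp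
    then have "sqrt (nsqD (shift k a)) \<le> c" using c0 by (simp add: real_le_lsqrt nsqD_nonneg)
    then show "ip_norm (dirichlet_inner F) (coord_mult k x) \<le> c"
      by (simp add: a mult_ext ip_norm_eq shift_D)
  qed (rule TH)
  show ?thesis
  proof (rule H.joint_two_isometry[OF bdd])
    show "coord_mult i (coord_mult j x) = coord_mult j (coord_mult i x)" for i j and x :: "complex ^ 'd \<Rightarrow> 'm"
      by (rule ext) (simp add: coord_mult_def scaleC_scaleC mult.commute)
    fix x assume "x \<in> dirichlet_space F"
    then obtain a where a: "a \<in> D" "x = ball_ext a" unfolding dirichlet_space_eq by blast
    have n: "(ip_norm (dirichlet_inner F) (ball_ext b))\<^sup>2 = nsqD b" if "b \<in> D" for b
      by (simp add: ip_norm_eq[OF that] nsqD_nonneg)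
    let ?I = "\<lambda>b. LINT z:ball 0 1|lborel. dens b z"
    have h1: "(\<Sum>j\<in>UNIV. hardy_sq (shift j a)) = hardy_sq a"
      by (rule sum_hardy_sq_shift[OF D_hardy[OF a(1)]])
    have h2: "(\<Sum>j\<in>UNIV. \<Sum>i\<in>UNIV. hardy_sq (shift i (shift j a))) = hardy_sq a"
      using sum_hardy_sq_shift[OF D_hardy[OF shift_D[OF a(1)]]] h1 by simp
    have d: "(\<Sum>i\<in>UNIV. \<Sum>j\<in>UNIV. ?I (shift j (shift i a))) - 2 * (\<Sum>j\<in>UNIV. ?I (shift j a)) + ?I a = 0"
      by (rule dens_identity[OF D_hardy[OF a(1)]]) (use a(1) shift_D in \<open>auto simp: D_def\<close>)
    \<comment> \<open>In the Hardy part the single value and both sums equal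
      \<open>hardy_sq a\<close>, with the coefficients 1, -2 and 1; the Dirichlet part is
      \<open>kappa\<close> times the expression in \<open>d\<close>.\<close>
    have "nsqD a - 2 * (\<Sum>j\<in>UNIV. nsqD (shift j a)) + (\<Sum>j\<in>UNIV. \<Sum>i\<in>UNIV. nsqD (shift i (shift j a)))
      = (hardy_sq a - 2 * (\<Sum>j\<in>UNIV. hardy_sq (shift j a)) + (\<Sum>j\<in>UNIV. \<Sum>i\<in>UNIV. hardy_sq (shift i (shift j a))))
        + kappa * ((\<Sum>i\<in>UNIV. \<Sum>j\<in>UNIV. ?I (shift j (shift i a))) - 2 * (\<Sum>j\<in>UNIV. ?I (shift j a)) + ?I a)"
      by (simp add: nsqD_def sum.distrib sum_distrib_left[symmetric] algebra_simps)
    also have "\<dots> = 0" unfolding d h1 h2 by simp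
    finally show "(ip_norm (dirichlet_inner F) x)\<^sup>2 - 2 * (\<Sum>j\<in>UNIV. (ip_norm (dirichlet_inner F) (coord_mult j x))\<^sup>2)
      + (\<Sum>j\<in>UNIV. \<Sum>i\<in>UNIV. (ip_norm (dirichlet_inner F) (coord_mult i (coord_mult j x)))\<^sup>2) = 0"
      using a(1) by (simp add: a(2) mult_ext shift_D n)
  qed
qed

end

theorem theorem3p4:
  fixes F :: "(complex ^ 'd) set \<Rightarrow> 'm::complex_hilbert \<Rightarrow> 'm"
  assumes "separable_space (euclidean :: 'm topology)"
    and "semispectral_measure F"
    and "\<And>k. coord_multiplier F k"
  shows "joint_isometry_on fun_scaleC (dirichlet_space F) (dirichlet_inner F) 2 coord_mult"
proof -
  interpret semispectral F by standard (rule assms(2))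
  show ?thesis by (rule dirichlet_joint_two_isometry) (rule assms(3))
qed

end
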